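(* Let $\Sigma$ be a controllable oriented graph on $n$ vertices with skew-adjacency matrix $S$ and skew-walk matrix $W(\Sigma)$, and let $d_n$ be the last invariant factor of $W(\Sigma)$. Suppose that $d_n$ is square-free and that $\operatorname{rank}_2 W(\Sigma)=\lceil n/2\rceil$. For every odd prime divisor $p$ of $d_n$, assume that the following two conditions hold: (i) $\deg \operatorname{sfp}(\Phi_p(\Sigma;x))=\operatorname{nullity}_p W(\Sigma)$; (ii) writing $\operatorname{sfp}(\Phi_p(\Sigma;x))=\varphi_1(x)\cdots\varphi_s(x)$ as a product of distinct monic irreducible polynomials over $\mathbb{F}_p$, one has $\gcd(\varphi_i(x),\varphi_j(-x))=1$ in $\mathbb{F}_p[x]$ whenever $i\neq j$. Then $\Sigma$ is determined by its generalized skew spectrum, i.e. every oriented graph having the same generalized skew spectrum as $\Sigma$ is isomorphic to $\Sigma$.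
   Context: An oriented graph $\Sigma$ on vertices $v_1,\dots,v_n$ is obtained from a finite simple undirected graph by giving each edge one direction. Its skew-adjacency matrix $S=S(\Sigma)=(s_{ij})$ has $s_{ij}=1$ if $(v_i,v_j)$ is an arc, $s_{ij}=-1$ if $(v_j,v_i)$ is an arc, and $s_{ij}=0$ otherwise; so $S^{\mathrm T}=-S$. Let $e$ be the all-one column vector, $J=ee^{\mathrm T}$ the all-one matrix, and $\chi(M;x)=\det(xI-M)$. The skew-walk matrix is the $n\times n$ integral matrix $W(\Sigma)=[e,Se,\ldots,S^{n-1}e]$; $\Sigma$ is controllable if $W(\Sigma)$ is nonsingular (over $\mathbb{Q}$). Two oriented graphs $\Sigma,\Delta$ have the same generalized skew spectrum (are generalized skew cospectral) if $\chi(S(\Sigma);x)=\chi(S(\Delta);x)$ and $\chi(S(\Sigma)+J;x)=\chi(S(\Delta)+J;x)$. The Smith normal form of a nonsingular integral $n\times n$ matrix is the unique diagonal matrix $\operatorname{diag}(d_1,\dots,d_n)$ integrally equivalent to it with positive integers $d_i\mid d_{i+1}$; the $d_i$ are its invariant factors and $d_n$ is the last one. For a prime $p$, $\operatorname{rank}_p M$ and $\operatorname{nullity}_p M$ are the rank and nullity over $\mathbb{F}_p$ of the reduction mod $p$ of an integral matrix $M$. Define $\Phi_p(\Sigma;x)=\gcd(\chi(S;x),\chi(S+J;x))\in\mathbb{F}_p[x]$ (monic gcd of the reductions mod $p$). For a monic $f=\prod_i f_i^{a_i}\in\mathbb{F}_p[x]$ with distinct monic irreducible $f_i$ and $a_i\ge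 1$, the square-free part is $\operatorname{sfp}(f)=\prod_i f_i$. *)

theory Defs
  imports
    "HOL-Computational_Algebra.Squarefree"
    "Graph_Theory.Digraph_Isomorphism"
    "Graph_Theory.Pair_Digraph"
    "Jordan_Normal_Form.Char_Poly"
    "Berlekamp_Zassenhaus.Poly_Mod"
begin

section \<open>Oriented graphs and their matrices\<close>

text \<open>The vertex \<open>v\<^sub>i\<close> is represented by the number \<open>i - 1\<close>. Asymmetry of the arc set says that each
  edge of the underlying simple graph has received exactly one direction.\<close>

definition oriented_graph :: "nat \<Rightarrow> nat pair_pre_digraph \<Rightarrow> bool" where
  "oriented_graph n G \<longleftrightarrow> pair_digraph G \<and> pverts G = {..<n} \<and> asym (parcs G)"

definition skew_adj :: "nat \<Rightarrow> nat pair_pre_digraph \<Rightarrow> int mat" where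
  "skew_adj n G = mat n n (\<lambda>(i, j).
     if (i, j) \<in> parcs G then 1 else if (j, i) \<in> parcs G then -1 else 0)"

definition all_ones_vec :: "nat \<Rightarrow> int vec" where
  "all_ones_vec n = vec n (\<lambda>_. 1)"

definition all_ones_mat :: "nat \<Rightarrow> int mat" where
  "all_ones_mat n = mat n n (\<lambda>_. 1)"

definition skew_walk_mat :: "nat \<Rightarrow> nat pair_pre_digraph \<Rightarrow> int mat" where
  "skew_walk_mat n G =
     mat_of_cols n (map (\<lambda>k. (skew_adj n G ^\<^sub>m k) *\<^sub>v all_ones_vec n) [0..<n])"

definition controllable :: "nat \<Rightarrow> nat pair_pre_digraph \<Rightarrow> bool" where
  "controllable n G \<longleftrightarrow> invertible_mat (map_mat rat_of_int (skew_walk_mat n G))"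

definition gen_skew_cospectral ::
  "nat \<Rightarrow> nat pair_pre_digraph \<Rightarrow> nat \<Rightarrow> nat pair_pre_digraph \<Rightarrow> bool" where
  "gen_skew_cospectral n G m H \<longleftrightarrow>
     char_poly (skew_adj n G) = char_poly (skew_adj m H) \<and>
     char_poly (skew_adj n G + all_ones_mat n) = char_poly (skew_adj m H + all_ones_mat m)"

definition determined_by_gen_skew_spectrum :: "nat \<Rightarrow> nat pair_pre_digraph \<Rightarrow> bool" where
  "determined_by_gen_skew_spectrum n G \<longleftrightarrow>
     (\<forall>m H. oriented_graph m H \<longrightarrow> gen_skew_cospectral n G m H \<longrightarrow>
        digraph_iso (with_proj H) (with_proj G))"


section \<open>Smith normal form of a nonsingular integral matrix\<close>

text \<open>\<^const>\<open>invertible_mat\<close> is invertibility over the integers here, i.e. unimodularity.\<close>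

definition is_smith_normal_form :: "int mat \<Rightarrow> int mat \<Rightarrow> bool" where
  "is_smith_normal_form M D \<longleftrightarrow>
     (let n = dim_row M in
        M \<in> carrier_mat n n \<and> D \<in> carrier_mat n n \<and> diagonal_mat D \<and>
        (\<forall>i<n. 0 < D $$ (i, i)) \<and>
        (\<forall>i. Suc i < n \<longrightarrow> D $$ (i, i) dvd D $$ (Suc i, Suc i)) \<and>
        (\<exists>P\<in>carrier_mat n n. \<exists>Q\<in>carrier_mat n n.
           invertible_mat P \<and> invertible_mat Q \<and> D = P * M * Q))"

definition last_invariant_factor :: "int mat \<Rightarrow> int" where
  "last_invariant_factor M =
     (THE D. is_smith_normal_form M D) $$ (dim_row M - 1, dim_row M - 1)"


section \<open>Rank and nullity modulo a prime\<close>

text \<open>Vectors over the field with \<open>p\<close> elements are represented by integral vectors. The list \<open>vs\<close> of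
  vectors of length \<open>n\<close> is linearly independent modulo \<open>p\<close> if so is the family of reductions.\<close>

definition lin_indep_mod :: "int \<Rightarrow> nat \<Rightarrow> int vec list \<Rightarrow> bool" where
  "lin_indep_mod p n vs \<longleftrightarrow>
     (\<forall>c :: nat \<Rightarrow> int. (\<forall>i<n. p dvd (\<Sum>k<length vs. c k * (vs ! k) $ i)) \<longrightarrow>
        (\<forall>k<length vs. p dvd c k))"

text \<open>Dimension of the reduction modulo \<open>p\<close> of \<open>V\<close>, for sets \<open>V\<close> of integral vectors of length \<open>n\<close>
  whose reduction is a subspace.\<close>

definition dim_mod :: "int \<Rightarrow> nat \<Rightarrow> int vec set \<Rightarrow> nat" where
  "dim_mod p n V = Max {length vs | vs. set vs \<subseteq> V \<and> lin_indep_mod p n vs}"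

definition rank_mod :: "int \<Rightarrow> int mat \<Rightarrow> nat" where
  "rank_mod p M = dim_mod p (dim_row M) {M *\<^sub>v x | x. x \<in> carrier_vec (dim_col M)}"

definition nullity_mod :: "int \<Rightarrow> int mat \<Rightarrow> nat" where
  "nullity_mod p M = dim_mod p (dim_col M)
     {x \<in> carrier_vec (dim_col M). \<forall>i<dim_row M. p dvd (M *\<^sub>v x) $ i}"


section \<open>Polynomials over the field with \<open>p\<close> elements\<close>

text \<open>A polynomial over the field with \<open>p\<close> elements is represented by its unique integral lift with
  coefficients in \<open>{0..<p}\<close>, i.e. by a fixed point of \<^const>\<open>poly_mod.Mp\<close>.\<close>

definition gcd_mod :: "int \<Rightarrow> int poly \<Rightarrow> int poly \<Rightarrow> int poly" where
  "gcd_mod p f g = (THE h. poly_mod.Mp p h = h \<and> monic h \<and>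
     poly_mod.dvdm p h f \<and> poly_mod.dvdm p h g \<and>
     (\<forall>k. poly_mod.dvdm p k f \<and> poly_mod.dvdm p k g \<longrightarrow> poly_mod.dvdm p k h))"

definition Phi_mod :: "int \<Rightarrow> nat \<Rightarrow> nat pair_pre_digraph \<Rightarrow> int poly" where
  "Phi_mod p n G =
     gcd_mod p (char_poly (skew_adj n G)) (char_poly (skew_adj n G + all_ones_mat n))"

definition monic_irreducible_factors_mod :: "int \<Rightarrow> int poly \<Rightarrow> int poly set" where
  "monic_irreducible_factors_mod p f =
     {q. poly_mod.Mp p q = q \<and> monic q \<and> poly_mod.irreducible_m p q \<and> poly_mod.dvdm p q f}"

definition sfp_mod :: "int \<Rightarrow> int poly \<Rightarrow> int poly" where
  "sfp_mod p f = poly_mod.Mp p (\<Prod>q\<in>monic_irreducible_factors_mod p f. q)"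

end

theory Submission
  imports Defs "Jordan_Normal_Form.Column_Operations"
begin

text \<open>
  Let \<open>S\<close> and \<open>T\<close> be the skew-adjacency matrices of generalized skew cospectral graphs, \<open>\<chi>\<close> their common
  characteristic polynomial and \<open>a = e\<^sup>T adj(x I - S) e = \<chi>(S; x) - \<chi>(S + J; x)\<close>, which is the same for \<open>T\<close>. Then
  \<open>e\<^sup>T f(S) e = e\<^sup>T f(T) e\<close> for all polynomials \<open>f\<close>, so \<open>f(S) e \<mapsto> f(T) e\<close> is a rational isometry which fixes
  \<open>e\<close> and conjugates \<open>S\<close> to \<open>T\<close>. If it is integral, it is a permutation. The standard basis vectors are
  \<open>f(S) e / d\<close> with \<open>d = d\<^sub>n\<close> square-free, so it suffices that \<open>f(S) e \<equiv> 0\<close> implies \<open>f(T) e \<equiv> 0\<close> modulo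
  every prime \<open>p\<close> dividing \<open>d\<close>.

  Modulo \<open>p\<close> let \<open>m\<close> be the monic generator of the annihilator of \<open>e\<close> under \<open>S\<close> and write \<open>\<chi> = k m\<close>. For an
  integral vector \<open>b\<close> put \<open>c = b\<^sup>T adj(x I - T) e\<close>. The conclusion \<open>m(T) e \<equiv> 0\<close> means that \<open>k\<close> divides every
  such \<open>c\<close>, and since the \<open>2 \<times> 2\<close> minors of the adjugate are
  divisible by \<open>\<chi>\<close>, one has \<open>c(x) c(- x) \<equiv> a(- x) q(x)\<close> modulo \<open>\<chi>\<close> for some \<open>q\<close>.

  For odd \<open>p\<close>, the polynomial \<open>\<Phi>\<^sub>p = gcd(\<chi>, a)\<close> is invariant under \<open>x \<mapsto> - x\<close> up to sign, so condition (ii)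
  forces each of its irreducible factors to be invariant. Such factors divide \<open>k\<close> since \<open>p\<^sup>2\<close> does not
  divide \<open>d\<close>, and by (i) the degrees agree, so \<open>k\<close> is the product of these factors, each of which divides
  \<open>c(x) c(- x)\<close> and hence \<open>c\<close>. For \<open>p = 2\<close> the rank condition gives \<open>m = x\<^sup>\<epsilon> k\<close> with \<open>\<epsilon> = n mod 2\<close>, and then
  \<open>k\<^sup>2\<close> divides \<open>\<chi>\<close> and \<open>a\<close>, hence \<open>c\<^sup>2\<close>.
\<close>

section \<open>Integer polynomials modulo a prime\<close>

abbreviation pdvd :: "int \<Rightarrow> int poly \<Rightarrow> int poly \<Rightarrow> bool" where
  "pdvd \<equiv> poly_mod.dvdm"

text \<open>Congruences modulo \<open>p\<close> are handled throughout as divisibility by the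
  constant polynomial \<open>[:p:]\<close>, so that integral polynomials stand for polynomials over
  the prime field without a quotient type.\<close>

lemma Mp_eq_iff: "poly_mod.Mp p f = poly_mod.Mp p g \<longleftrightarrow> [:p:] dvd f - g"
  unfolding poly_eq_iff const_poly_dvd_iff
  by (simp add: poly_mod.Mp_coeff poly_mod.M_def mod_eq_dvd_iff)

lemma const_dvd_diff_Mp: "[:p:] dvd f - poly_mod.Mp p f"
  using Mp_eq_iff[of p f "poly_mod.Mp p f"] by (simp add: poly_mod.Mp_Mp)

lemma pdvd_iff: "pdvd p f g \<longleftrightarrow> (\<exists>q. [:p:] dvd g - f * q)"
  unfolding poly_mod.dvdm_def Mp_eq_iff ..

lemma pdvdI: "[:p:] dvd g - f * q \<Longrightarrow> pdvd p f g"
  unfolding pdvd_iff by blast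

lemma pdvdE:
  assumes "pdvd p f g"
  obtains q where "[:p:] dvd g - f * q"
  using assms unfolding pdvd_iff by blast

lemma dvd_imp_pdvd: "f dvd g \<Longrightarrow> pdvd p f g"
  unfolding pdvd_iff by (metis diff_self dvd_0_right dvd_def)

lemma pdvd_const: "[:p:] dvd g \<Longrightarrow> pdvd p f g"
  by (rule pdvdI[of _ _ _ 0]) simp

lemma pdvd_0_modulus: "pdvd 0 f g \<longleftrightarrow> f dvd g"
  unfolding pdvd_iff by (auto simp: dvd_def)

lemma pdvd_refl [simp]: "pdvd p f f"
  by (simp add: dvd_imp_pdvd)

lemma pdvd_add: "pdvd p f g \<Longrightarrow> pdvd p f h \<Longrightarrow> pdvd p f (g + h)"
proof (elim pdvdE)
  fix q r assume "[:p:] dvd g - f * q" "[:p:] dvd h - f * r"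
  then have "[:p:] dvd (g - f * q) + (h - f * r)" by (rule dvd_add)
  then show ?thesis by (intro pdvdI[of _ _ _ "q + r"]) (simp add: algebra_simps)
qed

lemma pdvd_mult: "pdvd p f g \<Longrightarrow> pdvd p f (h * g)"
proof (elim pdvdE)
  fix q assume "[:p:] dvd g - f * q"
  then have "[:p:] dvd h * (g - f * q)" by simp
  then show ?thesis by (intro pdvdI[of _ _ _ "h * q"]) (simp add: algebra_simps)
qed

lemma pdvd_mult2: "pdvd p f g \<Longrightarrow> pdvd p f (g * h)"
  using pdvd_mult[of p f g h] by (simp add: mult.commute)

lemma pdvd_uminus: "pdvd p f g \<Longrightarrow> pdvd p f (- g)"
  using pdvd_mult[of p f g "-1"] by simp

lemma pdvd_uminus_iff [simp]: "pdvd p f (- g) \<longleftrightarrow> pdvd p f g"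
  using pdvd_uminus[of p f g] pdvd_uminus[of p f "- g"] by auto

lemma pdvd_diff: "pdvd p f g \<Longrightarrow> pdvd p f h \<Longrightarrow> pdvd p f (g - h)"
  using pdvd_add[of p f g "- h"] by simp

lemma pdvd_cong: "[:p:] dvd g - h \<Longrightarrow> pdvd p f g \<longleftrightarrow> pdvd p f h"
  using pdvd_add[of p f h "g - h"] pdvd_diff[of p f g "g - h"] pdvd_const[of p "g - h" f] by auto

lemma pdvd_trans: "pdvd p f g \<Longrightarrow> pdvd p g h \<Longrightarrow> pdvd p f h"
proof -
  assume fg: "pdvd p f g" and "pdvd p g h"
  then obtain q where q: "[:p:] dvd h - g * q" by (elim pdvdE)
  from fg have "pdvd p f (g * q)" by (rule pdvd_mult2)
  with q show ?thesis by (simp add: pdvd_cong)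
qed

lemma pdvd_cong_left: "[:p:] dvd f - g \<Longrightarrow> pdvd p f h \<Longrightarrow> pdvd p g h"
proof -
  assume "[:p:] dvd f - g" and h: "pdvd p f h"
  then have "pdvd p g f" by (intro pdvdI[of _ _ _ 1]) simp
  then show ?thesis using h by (rule pdvd_trans)
qed

lemma pdvd_mult_mono: "pdvd p f g \<Longrightarrow> pdvd p (f * h) (g * h)"
proof (elim pdvdE)
  fix q assume "[:p:] dvd g - f * q"
  then have "[:p:] dvd (g - f * q) * h" by simp
  then show ?thesis by (intro pdvdI[of _ _ _ q]) (simp add: algebra_simps)
qed

text \<open>Pseudo-division scales the dividend by a power of the leading coefficient of the
  divisor, which is 1 here, so it is genuine division over the integers.\<close>

lemma monic_div:
  fixes f g :: "int poly"
  assumes "monic f"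
  obtains q r where "g = f * q + r" "r = 0 \<or> degree r < degree f"
proof -
  obtain q r where qr: "pseudo_divmod g f = (q, r)" by force
  have "f \<noteq> 0" using assms by auto
  from pseudo_divmod[OF this qr] assms show ?thesis using that[of q r] by auto
qed

lemma prime_const_dvd_mult:
  fixes p :: int
  assumes "prime p" "[:p:] dvd f * g"
  shows "[:p:] dvd f \<or> [:p:] dvd g"
  using assms by (meson prime_elem_const_poly_iff prime_elem_dvd_mult_iff prime_imp_prime_elem)

text \<open>The modulus is arbitrary; for \<open>p = 0\<close> this is ordinary divisibility.\<close>

lemma pdvd_monic_small:
  assumes m: "monic m" and dv: "pdvd p m f" and deg: "degree f < degree m"
  shows "[:p:] dvd f"
proof -
  obtain q where q: "[:p:] dvd f - m * q" using dv by (elim pdvdE)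
  \<comment> \<open>The leading coefficient of the reduced quotient is its own residue modulo
    \<open>p\<close>. It reappears, negated, as a coefficient of \<open>f - m * Q\<close>, so it
    must vanish.\<close>
  define Q where "Q = poly_mod.Mp p q"
  have "[:p:] dvd m * (q - Q)" unfolding Q_def using const_dvd_diff_Mp by simp
  then have "[:p:] dvd (f - m * q) + m * (q - Q)" using q by (rule dvd_add[rotated])
  then have Q: "[:p:] dvd f - m * Q" by (simp add: algebra_simps)
  show ?thesis
  proof (cases "Q = 0")
    case True
    then show ?thesis using Q by simp
  next
    case False
    have "degree f < degree m + degree Q" using deg by simp
    then have "coeff (f - m * Q) (degree m + degree Q) = - lead_coeff Q"
      using m by (simp add: coeff_mult_degree_sum coeff_eq_0)
    moreover have "p dvd coeff (f - m * Q) (degree m + degree Q)"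
      using Q unfolding const_poly_dvd_iff by blast
    ultimately have "p dvd lead_coeff Q" by simp
    moreover have "lead_coeff Q = coeff q (degree Q) mod p"
      by (simp add: Q_def poly_mod.Mp_coeff poly_mod.M_def)
    ultimately have "lead_coeff Q = 0" by (metis mod_mod_trivial dvd_imp_mod_0)
    with False show ?thesis by simp
  qed
qed

lemma const_dvd_monic:
  fixes p :: int
  assumes "[:p:] dvd f" "monic f"
  shows "p dvd 1"
proof -
  have "p dvd lead_coeff f" using assms(1) unfolding const_poly_dvd_iff by blast
  then show ?thesis using assms(2) by simp
qed

lemma pdvd_monic_degree_le:
  assumes "monic m" "pdvd p m f" "monic f" "\<not> p dvd 1"
  shows "degree m \<le> degree f"
  using assms pdvd_monic_small[of m p f] const_dvd_monic[of p f] by force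

lemma pdvd_monic_eq:
  assumes m: "monic m" and f: "monic f" and dv: "pdvd p m f" and deg: "degree f = degree m"
  shows "[:p:] dvd f - m"
proof (cases "degree m = 0")
  case True
  then show ?thesis using m f deg by (metis diff_self dvd_0_right monic_degree_0)
next
  case False
  have "degree (f - m) < degree m"
    using m f deg False by (intro degree_lessI) (auto simp: coeff_eq_0 le_less)
  then show ?thesis using pdvd_monic_small[OF m pdvd_diff[OF dv pdvd_refl]] by simp
qed

section \<open>Ideals of integral polynomials modulo a prime\<close>

definition poly_ideal :: "int poly set \<Rightarrow> bool" where
  "poly_ideal I \<longleftrightarrow> (\<forall>f\<in>I. \<forall>g\<in>I. f + g \<in> I) \<and> (\<forall>f\<in>I. \<forall>h. h * f \<in> I)"

lemma degree_Mp_monic: "\<not> p dvd 1 \<Longrightarrow> monic f \<Longrightarrow> degree (poly_mod.Mp p f) = degree f"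
proof -
  assume p: "\<not> p dvd 1" and f: "monic f"
  have "coeff (poly_mod.Mp p f) (degree f) \<noteq> 0"
    using p f by (auto simp: poly_mod.Mp_coeff poly_mod.M_def)
  then show ?thesis by (simp add: le_antisym le_degree poly_mod.degree_m_le)
qed

lemma monic_Mp: "1 < p \<Longrightarrow> monic f \<Longrightarrow> monic (poly_mod.Mp p f)"
  using degree_Mp_monic[of p f] by (auto simp: poly_mod.Mp_coeff poly_mod.M_def)

text \<open>An ideal of integral polynomials containing \<open>p\<close> is the preimage of an ideal
  over the prime field, where every ideal is principal. The generator is the reduction of a monic
  member of least degree; \<open>f0\<close> guarantees that a monic member exists.\<close>

lemma poly_ideal_principal:
  fixes p :: int
  assumes p: "prime p" and I: "poly_ideal I" and pI: "[:p:] \<in> I" and f0: "f0 \<in> I" "monic f0"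
  obtains m where "monic m" "poly_mod.Mp p m = m" "\<And>f. f \<in> I \<longleftrightarrow> pdvd p m f"
proof -
  have p1: "p > 1" using p prime_gt_1_int by blast
  have add: "f + g \<in> I" if "f \<in> I" "g \<in> I" for f g using I that unfolding poly_ideal_def by blast
  have mul: "h * f \<in> I" if "f \<in> I" for f h using I that unfolding poly_ideal_def by blast
  have diff: "f - g \<in> I" if "f \<in> I" "g \<in> I" for f g
    using add[OF that(1) mul[OF that(2), of "-1"]] by simp
  have const: "f \<in> I" if "[:p:] dvd f" for f using that pI mul by (metis dvdE mult.commute)
  have cong: "g \<in> I" if "f \<in> I" "[:p:] dvd f - g" for f g
    using diff[OF that(1) const[OF that(2)]] by simp
  define k where "k = (LEAST k. \<exists>f\<in>I. monic f \<and> degree f = k)"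
  have ex: "\<exists>k. \<exists>f\<in>I. monic f \<and> degree f = k" using f0 by blast
  obtain m0 where m0: "m0 \<in> I" "monic m0" "degree m0 = k"
    using LeastI_ex[OF ex] unfolding k_def by blast
  have least: "k \<le> degree f" if "f \<in> I" "monic f" for f
    unfolding k_def by (rule Least_le) (use that in blast)
  define m where "m = poly_mod.Mp p m0"
  have m: "monic m" "degree m = k" "m \<in> I"
    using monic_Mp[OF p1 m0(2)] degree_Mp_monic[of p m0] p1 m0 cong[OF m0(1) const_dvd_diff_Mp]
    by (auto simp: m_def)
  have "pdvd p m f" if f: "f \<in> I" for f
  proof -
    obtain q r where qr: "f = m * q + r" "r = 0 \<or> degree r < degree m" using monic_div[OF m(1)] .
    have "r = f - q * m" using qr(1) by simp
    then have r: "r \<in> I" using diff[OF f mul[OF m(3)]] by simp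
    have "[:p:] dvd r"
    proof (rule ccontr)
      assume nd: "\<not> [:p:] dvd r"
      \<comment> \<open>Reducing first makes the leading coefficient of the remainder invertible
        modulo \<open>p\<close>. Rescaled by the inverse, the remainder becomes a monic member of
        degree below the minimum.\<close>
      define R where "R = poly_mod.Mp p r"
      have R0: "R \<noteq> 0" using nd const_dvd_diff_Mp[of p r] by (auto simp: R_def)
      define c where "c = lead_coeff R"
      have "c \<noteq> 0" using R0 by (simp add: c_def)
      moreover have "c mod p = c" by (simp add: c_def R_def poly_mod.Mp_coeff poly_mod.M_def)
      ultimately have "\<not> p dvd c" by auto
      then have "coprime c p" using p prime_imp_coprime_int[of p c] by (simp add: ac_simps)
      then obtain x y where "x * c + y * p = 1" using bezout_int[of c p] by auto
      then have cx: "x * c mod p = 1" using p1 by (metis mod_mult_self1 mod_pos_pos_trivial mult.commute zero_le_one)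
      define T where "T = poly_mod.Mp p ([:x:] * R)"
      have "degree T \<le> degree R"
        unfolding T_def using degree_mult_le[of "[:x:]" R] poly_mod.degree_m_le[of p "[:x:] * R"]
        by simp
      moreover have "coeff T (degree R) = 1"
        using cx by (simp add: T_def poly_mod.Mp_coeff poly_mod.M_def c_def)
      ultimately have T: "monic T" "degree T = degree R" using le_degree[of T "degree R"] by auto
      have "R \<in> I" using cong[OF r] const_dvd_diff_Mp by (simp add: R_def)
      then have "[:x:] * R \<in> I" by (rule mul)
      then have "T \<in> I" using cong const_dvd_diff_Mp by (simp add: T_def)
      then have "k \<le> degree R" using least T by metis
      moreover have "degree R \<le> degree r" unfolding R_def by (rule poly_mod.degree_m_le)
      moreover have "r \<noteq> 0" using nd by auto
      ultimately show False using qr(2) m(2) by simp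
    qed
    then show ?thesis by (intro pdvdI[of _ _ _ q]) (simp add: qr(1))
  qed
  moreover have "f \<in> I" if dv: "pdvd p m f" for f
  proof -
    obtain q where "[:p:] dvd f - m * q" using dv by (elim pdvdE)
    then have "q * m + (f - m * q) \<in> I" by (intro add mul m(3) const)
    then show ?thesis by (simp add: mult.commute)
  qed
  ultimately show ?thesis using that[of m] m(1) by (auto simp: m_def poly_mod.Mp_Mp)
qed

text \<open>This is the ideal generated by \<open>f\<close>, \<open>g\<close> and
  \<open>[:p:]\<close>; its monic generator is the gcd modulo \<open>p\<close>, together with Bezout
  coefficients.\<close>

lemma poly_ideal_span: "poly_ideal {h. \<exists>u v. [:p:] dvd h - (u * f + v * g)}"
  unfolding poly_ideal_def
proof (intro conjI ballI allI)
  let ?I = "{h. \<exists>u v. [:p:] dvd h - (u * f + v * g)}"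
  fix a b assume "a \<in> ?I" "b \<in> ?I"
  then obtain u v u' v' where "[:p:] dvd a - (u * f + v * g)" "[:p:] dvd b - (u' * f + v' * g)" by blast
  then have "[:p:] dvd a - (u * f + v * g) + (b - (u' * f + v' * g))" by (rule dvd_add)
  also have "a - (u * f + v * g) + (b - (u' * f + v' * g)) = a + b - ((u + u') * f + (v + v') * g)"
    by (simp add: algebra_simps)
  finally show "a + b \<in> ?I" by blast
next
  let ?I = "{h. \<exists>u v. [:p:] dvd h - (u * f + v * g)}"
  fix a h assume "a \<in> ?I"
  then obtain u v where "[:p:] dvd a - (u * f + v * g)" by blast
  then have "[:p:] dvd h * (a - (u * f + v * g))" by (rule dvd_mult)
  also have "h * (a - (u * f + v * g)) = h * a - ((h * u) * f + (h * v) * g)"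
    by (simp add: algebra_simps)
  finally show "h * a \<in> ?I" by blast
qed

lemma gcd_mod_generator:
  fixes p :: int
  assumes p: "prime p" and f: "monic f"
  obtains h where "monic h" "poly_mod.Mp p h = h" "\<exists>u v. [:p:] dvd h - (u * f + v * g)"
    "pdvd p h f" "pdvd p h g"
proof -
  define I where "I = {h. \<exists>u v. [:p:] dvd h - (u * f + v * g)}"
  have "poly_ideal I" unfolding I_def by (rule poly_ideal_span)
  moreover have "[:p:] \<in> I" unfolding I_def by (rule CollectI, rule exI[of _ 0], rule exI[of _ 0]) simp
  moreover have fI: "f \<in> I"
    unfolding I_def by (rule CollectI, rule exI[of _ 1], rule exI[of _ 0]) simp
  ultimately obtain h where h: "monic h" "poly_mod.Mp p h = h" "\<And>q. q \<in> I \<longleftrightarrow> pdvd p h q"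
    using poly_ideal_principal[OF p, of I f] f by metis
  have gI: "g \<in> I"
    unfolding I_def by (rule CollectI, rule exI[of _ 0], rule exI[of _ 1]) simp
  have "h \<in> I" using h(3) by simp
  then have "\<exists>u v. [:p:] dvd h - (u * f + v * g)" unfolding I_def by blast
  then show ?thesis using that[of h] h fI gI by blast
qed

section \<open>Irreducible polynomials over the prime field\<close>

lemma irreducible_m_bezout:
  fixes p :: int
  assumes p: "prime p" and f: "poly_mod.irreducible_m p f" "monic f" and nd: "\<not> pdvd p f g"
  obtains u v where "[:p:] dvd 1 - (u * f + v * g)"
proof -
  obtain m where mI: "\<exists>u v. [:p:] dvd m - (u * f + v * g)" and mf: "pdvd p m f" and mg: "pdvd p m g"
    using gcd_mod_generator[OF p f(2), of g] by metis
  obtain h where h: "[:p:] dvd f - m * h" using mf by (elim pdvdE)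
  \<comment> \<open>Modulo \<open>p\<close> one has \<open>f = m * h\<close>. If \<open>h\<close>
    were the unit, then \<open>f\<close> would divide \<open>m\<close> and hence
    \<open>g\<close>.\<close>
  then have "pdvd p m 1 \<or> pdvd p h 1"
    using f(1) unfolding poly_mod.irreducible_m_def Mp_eq_iff by blast
  moreover have False if "pdvd p h 1"
  proof -
    have "pdvd p (h * m) (1 * m)" using that by (rule pdvd_mult_mono)
    moreover have "pdvd p f (h * m)"
    proof (rule pdvdI)
      show "[:p:] dvd h * m - f * 1" using h by (metis dvd_minus_iff minus_diff_eq mult.commute mult.right_neutral)
    qed
    ultimately have "pdvd p f m" by (metis mult_1 pdvd_trans)
    then show False using nd mg pdvd_trans by blast
  qed
  ultimately have "pdvd p m 1" by blast
  then obtain q where q: "[:p:] dvd 1 - m * q" by (elim pdvdE)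
  obtain u v where uv: "[:p:] dvd m - (u * f + v * g)" using mI by blast
  have "[:p:] dvd (1 - m * q) + q * (m - (u * f + v * g))" by (intro dvd_add q dvd_mult uv)
  also have "(1 - m * q) + q * (m - (u * f + v * g)) = 1 - (q * u * f + q * v * g)"
    by (simp add: algebra_simps)
  finally show ?thesis by (rule that)
qed

lemma irreducible_m_prime:
  fixes p :: int
  assumes p: "prime p" and f: "poly_mod.irreducible_m p f" "monic f" and dv: "pdvd p f (g * h)"
  shows "pdvd p f g \<or> pdvd p f h"
proof (rule disjCI)
  assume "\<not> pdvd p f h"
  then obtain u v where uv: "[:p:] dvd 1 - (u * f + v * h)" using irreducible_m_bezout[OF p f] by blast
  then have "[:p:] dvd g * (1 - (u * f + v * h))" by simp
  then have *: "[:p:] dvd g - (u * g * f + v * (g * h))" by (simp add: algebra_simps)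
  have "pdvd p f (u * g * f + v * (g * h))"
    by (intro pdvd_add pdvd_mult dv pdvd_refl)
  then show "pdvd p f g" using pdvd_cong[OF *] by simp
qed

lemma irreducible_m_not_pdvd_1: "poly_mod.irreducible_m p f \<Longrightarrow> \<not> pdvd p f 1"
  by (simp add: poly_mod.irreducible_m_def)

text \<open>Associated polynomials that are monic and reduced coincide. Hence different members of a
  set of such irreducible factors do not divide each other.\<close>

lemma irreducible_m_pdvd_eq:
  fixes p :: int
  assumes p: "prime p"
    and f: "poly_mod.irreducible_m p f" "monic f" "poly_mod.Mp p f = f"
    and g: "poly_mod.irreducible_m p g" "monic g" "poly_mod.Mp p g = g"
    and dv: "pdvd p f g"
  shows "f = g"
proof -
  have p1: "\<not> p dvd 1" using p not_prime_unit by blast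
  obtain h where h: "[:p:] dvd g - f * h" using dv by (elim pdvdE)
  then have "pdvd p f 1 \<or> pdvd p h 1"
    using g(1) unfolding poly_mod.irreducible_m_def Mp_eq_iff by blast
  then have "pdvd p h 1" using f(1) irreducible_m_not_pdvd_1 by blast
  then have "pdvd p (h * f) (1 * f)" by (rule pdvd_mult_mono)
  then have gf: "pdvd p g f"
    using h by (metis dvd_minus_iff minus_diff_eq mult.commute mult_1 pdvd_cong_left)
  have "degree f = degree g"
    using pdvd_monic_degree_le[OF f(2) dv g(2) p1] pdvd_monic_degree_le[OF g(2) gf f(2) p1] by simp
  then have "[:p:] dvd f - g" using pdvd_monic_eq[OF g(2) f(2) gf] by simp
  then show ?thesis using f(3) g(3) Mp_eq_iff[of p f g] by simp
qed

lemma irreducible_m_dvd_prod: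
  fixes p :: int
  assumes p: "prime p" and f: "poly_mod.irreducible_m p f" "monic f"
    and dv: "pdvd p f (\<Prod>F)"
  shows "\<exists>g\<in>F. pdvd p f g"
proof -
  have "finite F \<Longrightarrow> pdvd p f (\<Prod>F) \<Longrightarrow> \<exists>g\<in>F. pdvd p f g"
  proof (induction F rule: finite_induct)
    case empty
    then show ?case using irreducible_m_not_pdvd_1[OF f(1)] by simp
  next
    case (insert x F)
    then have "pdvd p f (x * \<Prod>F)" by simp
    then show ?case using irreducible_m_prime[OF p f] insert.IH by blast
  qed
  moreover have "finite F" using dv irreducible_m_not_pdvd_1[OF f(1)] by (cases "finite F") auto
  ultimately show ?thesis using dv by blast
qed

lemma prod_irreducible_pdvd:
  fixes p :: int
  assumes p: "prime p" and fin: "finite F"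
    and F: "\<And>f. f \<in> F \<Longrightarrow> poly_mod.irreducible_m p f \<and> monic f \<and> poly_mod.Mp p f = f \<and> pdvd p f g"
  shows "pdvd p (\<Prod>F) g"
  using fin F
proof (induction F rule: finite_induct)
  case empty
  show ?case by (simp add: dvd_imp_pdvd)
next
  case (insert x F)
  obtain q where q: "[:p:] dvd g - \<Prod>F * q" using insert by (auto elim: pdvdE)
  have x: "poly_mod.irreducible_m p x" "monic x" "poly_mod.Mp p x = x" using insert.prems[of x] by auto
  have "pdvd p x g" using insert.prems by blast
  then have "pdvd p x (\<Prod>F * q)" using pdvd_cong[OF q] by simp
  moreover have "\<not> pdvd p x (\<Prod>F)"
  proof
    assume "pdvd p x (\<Prod>F)"
    then obtain y where "y \<in> F" "pdvd p x y" using irreducible_m_dvd_prod[OF p x(1,2)] by blast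
    then show False using irreducible_m_pdvd_eq[OF p x, of y] insert.prems[of y] insert.hyps by auto
  qed
  ultimately have "pdvd p x q" using irreducible_m_prime[OF p x(1,2)] by blast
  then have "pdvd p (x * \<Prod>F) (q * \<Prod>F)" by (rule pdvd_mult_mono)
  then show ?case using q insert.hyps by (simp add: pdvd_cong mult.commute)
qed

section \<open>Polynomials in a matrix acting on vectors\<close>

text \<open>Horner evaluation of \<open>f(A) v\<close>: only matrix-vector products occur, and the
  matrix \<open>f(A)\<close> is never formed.\<close>

definition pact :: "int mat \<Rightarrow> int poly \<Rightarrow> int vec \<Rightarrow> int vec" where
  "pact A f v = fold_coeffs (\<lambda>a w. a \<cdot>\<^sub>v v + A *\<^sub>v w) f (0\<^sub>v (dim_row A))"

text \<open>For skew \<open>A\<close> the transpose of \<open>f(A)\<close> is \<open>f(- A)\<close>,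
  so this reflection of the variable is the adjoint.\<close>

abbreviation star :: "int poly \<Rightarrow> int poly" where
  "star f \<equiv> pcompose f [:0, -1:]"

definition const_vec :: "int vec \<Rightarrow> int poly vec" where
  "const_vec v = map_vec (\<lambda>a. [:a:]) v"

text \<open>The polynomial \<open>b\<^sup>T adj(x I - A) c\<close>, i.e. \<open>\<chi>(x)\<close> times the generating function of the
  numbers \<open>b\<^sup>T A\<^sup>k c\<close>.\<close>

definition resolvent :: "int mat \<Rightarrow> int vec \<Rightarrow> int vec \<Rightarrow> int poly" where
  "resolvent A b c = const_vec b \<bullet> (adj_mat (char_poly_matrix A) *\<^sub>v const_vec c)"

lemma const_vec_carrier [simp]: "const_vec v \<in> carrier_vec n \<longleftrightarrow> v \<in> carrier_vec n"
  by (simp add: const_vec_def)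

lemma dim_const_vec [simp]: "dim_vec (const_vec v) = dim_vec v"
  by (simp add: const_vec_def)

lemma const_vec_index [simp]: "i < dim_vec v \<Longrightarrow> const_vec v $ i = [:v $ i:]"
  by (simp add: const_vec_def)

lemma sum_const_poly: "(\<Sum>i\<in>I. [:f i:]) = [:\<Sum>i\<in>I. f i:]"
  by (induction I rule: infinite_finite_induct) auto

lemma const_vec_scalar_prod:
  assumes "b \<in> carrier_vec n" "c \<in> carrier_vec n"
  shows "const_vec b \<bullet> const_vec c = [:b \<bullet> c:]"
  using assms by (auto simp: scalar_prod_def sum_const_poly[symmetric] intro!: sum.cong)

lemma const_vec_add:
  "b \<in> carrier_vec n \<Longrightarrow> c \<in> carrier_vec n \<Longrightarrow> const_vec (b + c) = const_vec b + const_vec c"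
  by (intro eq_vecI) auto

lemma const_vec_smult: "const_vec (a \<cdot>\<^sub>v c) = [:a:] \<cdot>\<^sub>v const_vec c"
  by (intro eq_vecI) auto

lemma mult_mat_vec_smult:
  fixes v :: "'a :: comm_ring_1 vec"
  assumes "B \<in> carrier_mat nr nc" "v \<in> carrier_vec nc"
  shows "B *\<^sub>v (k \<cdot>\<^sub>v v) = k \<cdot>\<^sub>v (B *\<^sub>v v)"
  using assms by (intro eq_vecI) (auto simp: scalar_prod_smult_distrib[of _ nc])

lemma dvd_pCons_0: "(f :: int poly) dvd g \<Longrightarrow> f dvd pCons 0 g"
  using dvd_mult[of f g "[:0, 1:]"] by simp

lemma zero_smult_vec: "v \<in> carrier_vec n \<Longrightarrow> (0 :: int) \<cdot>\<^sub>v v = 0\<^sub>v n"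
  by (intro eq_vecI) auto

locale int_matrix =
  fixes n :: nat and A :: "int mat"
  assumes A [simp]: "A \<in> carrier_mat n n"
begin

lemma dim_A [simp]: "dim_row A = n" "dim_col A = n"
  using carrier_matD[OF A] by auto

lemma pact_0 [simp]: "pact A 0 v = 0\<^sub>v n"
  by (simp add: pact_def)

lemma pact_pCons:
  assumes v: "v \<in> carrier_vec n"
  shows "pact A (pCons a f) v = a \<cdot>\<^sub>v v + A *\<^sub>v pact A f v"
proof (cases "a = 0 \<and> f = 0")
  \<comment> \<open>\<open>pCons 0 0\<close> is the zero polynomial and gives
    \<open>fold_coeffs\<close> no coefficient to process, so this case is separate.\<close>
  case True
  have "A *\<^sub>v 0\<^sub>v n = 0\<^sub>v n" by (intro eq_vecI) auto
  then show ?thesis using True v by (simp add: pact_def zero_smult_vec)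
next
  case False
  then show ?thesis by (auto simp: pact_def)
qed

lemma pact_carrier [simp, intro]: "v \<in> carrier_vec n \<Longrightarrow> pact A f v \<in> carrier_vec n"
  by (induction f) (auto simp: pact_pCons intro!: add_carrier_vec mult_mat_vec_carrier)

lemma dim_pact [simp]: "v \<in> carrier_vec n \<Longrightarrow> dim_vec (pact A f v) = n"
  using pact_carrier carrier_vecD by blast

lemma A_carrier [simp]: "v \<in> carrier_vec n \<Longrightarrow> A *\<^sub>v v \<in> carrier_vec n"
  by (rule mult_mat_vec_carrier[OF A])

lemma A_add: "v \<in> carrier_vec n \<Longrightarrow> w \<in> carrier_vec n \<Longrightarrow> A *\<^sub>v (v + w) = A *\<^sub>v v + A *\<^sub>v w"
  by (rule mult_add_distrib_mat_vec[OF A])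

lemma A_smult: "v \<in> carrier_vec n \<Longrightarrow> A *\<^sub>v (a \<cdot>\<^sub>v v) = a \<cdot>\<^sub>v (A *\<^sub>v v)"
  by (rule mult_mat_vec_smult[OF A])

lemma A_zero [simp]: "A *\<^sub>v 0\<^sub>v n = 0\<^sub>v n"
  by (intro eq_vecI) auto

lemma pact_1 [simp]: "v \<in> carrier_vec n \<Longrightarrow> pact A 1 v = v"
  unfolding one_pCons by (subst pact_pCons) auto

lemma pact_const: "v \<in> carrier_vec n \<Longrightarrow> pact A [:a:] v = a \<cdot>\<^sub>v v"
  by (subst pact_pCons) auto

lemma pact_add:
  assumes v: "v \<in> carrier_vec n"
  shows "pact A (f + g) v = pact A f v + pact A g v"
proof (induction f g rule: poly_induct2)
  case 0
  show ?case by simp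
next
  case (pCons a f b g)
  then show ?case using v
    by (intro eq_vecI) (auto simp: pact_pCons A_add algebra_simps)
qed

lemma pact_smult:
  assumes v: "v \<in> carrier_vec n"
  shows "pact A (Polynomial.smult a f) v = a \<cdot>\<^sub>v pact A f v"
proof (induction f)
  case 0
  show ?case by auto
next
  case (pCons b f)
  then show ?case using v
    by (intro eq_vecI) (auto simp: pact_pCons A_smult algebra_simps)
qed

lemma pact_mult:
  assumes v: "v \<in> carrier_vec n"
  shows "pact A (f * g) v = pact A f (pact A g v)"
proof (induction f)
  case 0
  show ?case by simp
next
  case (pCons a f)
  have "pact A (pCons a f * g) v = a \<cdot>\<^sub>v pact A g v + (0 \<cdot>\<^sub>v v + A *\<^sub>v pact A (f * g) v)"
    using v by (simp add: pact_add pact_smult pact_pCons)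
  also have "0 \<cdot>\<^sub>v v + A *\<^sub>v pact A (f * g) v = A *\<^sub>v pact A (f * g) v"
    using v by (intro eq_vecI) auto
  finally show ?case using v pCons by (simp add: pact_pCons)
qed

lemma pact_vec_smult:
  assumes v: "v \<in> carrier_vec n"
  shows "pact A f (a \<cdot>\<^sub>v v) = a \<cdot>\<^sub>v pact A f v"
  using v pact_mult[OF v, of f "[:a:]"] pact_mult[OF v, of "[:a:]" f]
  by (simp add: pact_const mult.commute)

lemma pact_x: "v \<in> carrier_vec n \<Longrightarrow> pact A [:0, 1:] v = A *\<^sub>v v"
  by (simp add: pact_pCons) (intro eq_vecI, auto)

lemma pact_monom:
  assumes v: "v \<in> carrier_vec n"
  shows "pact A (monom 1 k) v = A ^\<^sub>m k *\<^sub>v v"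
  using v
proof (induction k arbitrary: v)
  case 0
  then show ?case by (simp add: monom_0 pact_const)
next
  case (Suc k)
  have "monom 1 (Suc k) = monom 1 k * [:0, 1 :: int:]" by (simp add: monom_Suc)
  then have "pact A (monom 1 (Suc k)) v = A ^\<^sub>m k *\<^sub>v (A *\<^sub>v v)"
    using Suc by (simp only: pact_mult pact_x A_carrier)
  also have "\<dots> = A ^\<^sub>m Suc k *\<^sub>v v"
    using Suc.prems by (simp add: assoc_mult_mat_vec[of _ n n _ n])
  finally show ?case .
qed

section \<open>The characteristic polynomial and the resolvents\<close>

abbreviation \<chi> :: "int poly" where "\<chi> \<equiv> char_poly A"

lemma monic_chi: "monic \<chi>" and degree_chi: "degree \<chi> = n"
  using degree_monic_char_poly[OF A] by auto

lemma adj_carrier [simp]: "adj_mat (char_poly_matrix A) \<in> carrier_mat n n"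
  using adj_mat(1)[of "char_poly_matrix A" n] by simp

lemma dim_adj [simp]:
  "dim_row (adj_mat (char_poly_matrix A)) = n" "dim_col (adj_mat (char_poly_matrix A)) = n"
  using carrier_matD[OF adj_carrier] by auto

lemma adj_const_carrier [simp]:
  "c \<in> carrier_vec n \<Longrightarrow> adj_mat (char_poly_matrix A) *\<^sub>v const_vec c \<in> carrier_vec n"
  by (rule mult_mat_vec_carrier[OF adj_carrier]) simp

lemma char_poly_matrix_const_vec:
  assumes B: "B \<in> carrier_mat n n" and c: "c \<in> carrier_vec n"
  shows "char_poly_matrix B *\<^sub>v const_vec c = [:0, 1:] \<cdot>\<^sub>v const_vec c + [:-1:] \<cdot>\<^sub>v const_vec (B *\<^sub>v c)"
proof (intro eq_vecI)
  fix i assume "i < dim_vec ([:0, 1:] \<cdot>\<^sub>v const_vec c + [:-1:] \<cdot>\<^sub>v const_vec (B *\<^sub>v c))"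
  then have i: "i < n" using B by auto
  have "(char_poly_matrix B *\<^sub>v const_vec c) $ i =
      (\<Sum>j = 0..<n. (if i = j then [:0, 1:] * [:c $ j:] else 0) + [:- (B $$ (i, j) * c $ j):])"
    using i B c by (auto simp: char_poly_matrix_def scalar_prod_def intro!: sum.cong)
  also have "\<dots> = [:0, c $ i:] + [:- (\<Sum>j = 0..<n. B $$ (i, j) * c $ j):]"
    using i by (simp add: sum.distrib sum_const_poly sum_negf)
  also have "(\<Sum>j = 0..<n. B $$ (i, j) * c $ j) = (B *\<^sub>v c) $ i"
    using i B c by (auto simp: scalar_prod_def intro!: sum.cong)
  finally show "(char_poly_matrix B *\<^sub>v const_vec c) $ i =
      ([:0, 1:] \<cdot>\<^sub>v const_vec c + [:-1:] \<cdot>\<^sub>v const_vec (B *\<^sub>v c)) $ i"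
    using i B c by simp
qed (use carrier_matD[OF char_poly_matrix_closed[OF B]] B c in auto)

lemma resolvent_add_right:
  assumes "b \<in> carrier_vec n" "c \<in> carrier_vec n" "d \<in> carrier_vec n"
  shows "resolvent A b (c + d) = resolvent A b c + resolvent A b d"
  using assms unfolding resolvent_def
  by (simp add: const_vec_add mult_add_distrib_mat_vec[of _ n n] scalar_prod_add_distrib[of _ n])

lemma resolvent_smult_right:
  assumes "b \<in> carrier_vec n" "c \<in> carrier_vec n"
  shows "resolvent A b (a \<cdot>\<^sub>v c) = Polynomial.smult a (resolvent A b c)"
  using assms unfolding resolvent_def const_vec_smult
  by (simp add: mult_mat_vec_smult[of _ n n] scalar_prod_smult_distrib[of _ n])

lemma resolvent_add_left:
  assumes "b \<in> carrier_vec n" "c \<in> carrier_vec n" "d \<in> carrier_vec n"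
  shows "resolvent A (b + d) c = resolvent A b c + resolvent A d c"
  using assms unfolding resolvent_def
  by (simp add: const_vec_add add_scalar_prod_distrib[of _ n])

lemma resolvent_smult_left:
  assumes "b \<in> carrier_vec n" "c \<in> carrier_vec n"
  shows "resolvent A (a \<cdot>\<^sub>v b) c = Polynomial.smult a (resolvent A b c)"
  using assms unfolding resolvent_def const_vec_smult
  by (simp add: smult_scalar_prod_distrib[of _ n])

text \<open>From \<open>adj(x I - A) (x I - A) = chi I\<close> applied to \<open>c\<close>: the
  variable acts on the right argument as \<open>A\<close>, up to a multiple of
  \<open>chi\<close>.\<close>

lemma resolvent_right:
  assumes b: "b \<in> carrier_vec n" and c: "c \<in> carrier_vec n"
  shows "[:0, 1:] * resolvent A b c = resolvent A b (A *\<^sub>v c) + Polynomial.smult (b \<bullet> c) \<chi>"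
proof -
  let ?P = "adj_mat (char_poly_matrix A)" and ?M = "char_poly_matrix A"
  have "?P *\<^sub>v (?M *\<^sub>v const_vec c) = (?P * ?M) *\<^sub>v const_vec c"
    using c by (intro assoc_mult_mat_vec[symmetric, of _ n n _ n]) auto
  also have "\<dots> = \<chi> \<cdot>\<^sub>v const_vec c"
    using c unfolding adj_mat(3)[OF char_poly_matrix_closed[OF A]] char_poly_def[symmetric]
    by (intro eq_vecI) (auto simp: scalar_prod_smult_distrib)
  finally have "const_vec b \<bullet> (?P *\<^sub>v (?M *\<^sub>v const_vec c)) = const_vec b \<bullet> (\<chi> \<cdot>\<^sub>v const_vec c)"
    by simp
  also have "\<dots> = Polynomial.smult (b \<bullet> c) \<chi>"
    using b c by (simp add: const_vec_scalar_prod[of _ n] scalar_prod_smult_distrib[of _ n])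
  also have "const_vec b \<bullet> (?P *\<^sub>v (?M *\<^sub>v const_vec c)) =
      [:0, 1:] * resolvent A b c - resolvent A b (A *\<^sub>v c)"
    using b c unfolding char_poly_matrix_const_vec[OF A c] resolvent_def
    by (simp add: mult_add_distrib_mat_vec[of _ n n] mult_mat_vec_smult[of _ n n]
        scalar_prod_smult_distrib[of _ n] scalar_prod_add_distrib[of _ n])
  finally show ?thesis by simp
qed

text \<open>The product in the other order, moved to \<open>b\<close> by transposition, makes the
  variable act on the left argument as the transpose.\<close>

lemma resolvent_left:
  assumes b: "b \<in> carrier_vec n" and c: "c \<in> carrier_vec n"
  shows "[:0, 1:] * resolvent A b c = resolvent A (A\<^sup>T *\<^sub>v b) c + Polynomial.smult (b \<bullet> c) \<chi>"
proof -
  let ?P = "adj_mat (char_poly_matrix A)" and ?M = "char_poly_matrix A"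
  have "?M *\<^sub>v (?P *\<^sub>v const_vec c) = (?M * ?P) *\<^sub>v const_vec c"
    using c by (intro assoc_mult_mat_vec[symmetric, of _ n n _ n]) auto
  also have "\<dots> = \<chi> \<cdot>\<^sub>v const_vec c"
    using c unfolding adj_mat(2)[OF char_poly_matrix_closed[OF A]] char_poly_def[symmetric]
    by (intro eq_vecI) (auto simp: scalar_prod_smult_distrib)
  finally have "const_vec b \<bullet> (?M *\<^sub>v (?P *\<^sub>v const_vec c)) = const_vec b \<bullet> (\<chi> \<cdot>\<^sub>v const_vec c)"
    by simp
  also have "\<dots> = Polynomial.smult (b \<bullet> c) \<chi>"
    using b c by (simp add: const_vec_scalar_prod[of _ n] scalar_prod_smult_distrib[of _ n])
  also have "const_vec b \<bullet> (?M *\<^sub>v (?P *\<^sub>v const_vec c)) = (?M\<^sup>T *\<^sub>v const_vec b) \<bullet> (?P *\<^sub>v const_vec c)"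
    using b c by (intro transpose_vec_mult_scalar[symmetric, of _ n n]) auto
  also have "?M\<^sup>T = char_poly_matrix (A\<^sup>T)"
    by (intro eq_matI) (auto simp: char_poly_matrix_def)
  also have "(char_poly_matrix (A\<^sup>T) *\<^sub>v const_vec b) \<bullet> (?P *\<^sub>v const_vec c) =
      [:0, 1:] * resolvent A b c - resolvent A (A\<^sup>T *\<^sub>v b) c"
    using b c unfolding char_poly_matrix_const_vec[OF transpose_carrier_mat[THEN iffD2, OF A] b] resolvent_def
    by (simp add: add_scalar_prod_distrib[of _ n] smult_scalar_prod_distrib[of _ n]
        mult_mat_vec_carrier[of _ n n])
  finally show ?thesis by simp
qed

text \<open>Up to sign, the entries of the adjugate are minors of size \<open>n - 1\<close> of a
  matrix whose entries have degree at most 1.\<close>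

lemma degree_resolvent_less:
  assumes b: "b \<in> carrier_vec n" and c: "c \<in> carrier_vec n" and n: "0 < n"
  shows "degree (resolvent A b c) < n"
proof -
  let ?P = "adj_mat (char_poly_matrix A)"
  have deg: "degree (?P $$ (i, j)) \<le> n - 1" if "i < n" "j < n" for i j
  proof -
    have entry: "degree (char_poly_matrix A $$ (i', j')) \<le> 1" if "i' < n" "j' < n" for i' j'
    proof -
      have "char_poly_matrix A $$ (i', j') = (if i' = j' then [:- A $$ (i', j'), 1:] else [:- A $$ (i', j'):])"
        using that by (simp add: char_poly_matrix_def)
      then show ?thesis by simp
    qed
    have "degree (det (mat_delete (char_poly_matrix A) j i)) \<le> 1 * (n - 1)"
    proof (rule degree_det_le)
      show "mat_delete (char_poly_matrix A) j i \<in> carrier_mat (n - 1) (n - 1)"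
        by (intro mat_delete_carrier char_poly_matrix_closed A)
      fix i' j' assume "i' < n - 1" "j' < n - 1"
      then show "degree (mat_delete (char_poly_matrix A) j i $$ (i', j')) \<le> 1"
        using that carrier_matD[OF char_poly_matrix_closed[OF A]]
        by (auto simp: mat_delete_def intro!: entry[simplified])
    qed
    moreover have "?P $$ (i, j) = (- 1) ^ (j + i) * det (mat_delete (char_poly_matrix A) j i)"
      using that by (simp add: adj_mat_def cofactor_def char_poly_matrix_def)
    moreover have "(- 1 :: int poly) ^ (j + i) = 1 \<or> (- 1 :: int poly) ^ (j + i) = - 1"
      by (cases "even (j + i)") auto
    ultimately show ?thesis by auto
  qed
  have "degree (resolvent A b c) \<le> n - 1"
    unfolding resolvent_def scalar_prod_def
  proof (rule degree_sum_le, simp)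
    fix i assume "i \<in> {0..<dim_vec (?P *\<^sub>v const_vec c)}"
    then have i: "i < n" by (simp add: adj_mat_def char_poly_matrix_def)
    have "degree ((?P *\<^sub>v const_vec c) $ i) \<le> n - 1"
    proof -
      have "(?P *\<^sub>v const_vec c) $ i = (\<Sum>j = 0..<n. Polynomial.smult (c $ j) (?P $$ (i, j)))"
        using i c by (auto simp: scalar_prod_def mult.commute intro!: sum.cong)
      also have "degree \<dots> \<le> n - 1"
        using i deg by (intro degree_sum_le) (auto intro: order_trans[OF degree_smult_le])
      finally show ?thesis .
    qed
    then show "degree (const_vec b $ i * (?P *\<^sub>v const_vec c) $ i) \<le> n - 1"
      using i b by (auto intro: order_trans[OF degree_smult_le])
  qed
  then show ?thesis using n by simp
qed

text \<open>Compare the coefficients at degree \<open>n\<close> in \<open>resolvent_right\<close>.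
  As resolvents have degree below \<open>n\<close>, knowing one modulo \<open>chi\<close> is enough
  to recover the inner product.\<close>

lemma coeff_resolvent:
  assumes b: "b \<in> carrier_vec n" and c: "c \<in> carrier_vec n" and n: "0 < n"
  shows "coeff (resolvent A b c) (n - 1) = b \<bullet> c"
proof -
  have "coeff ([:0, 1:] * resolvent A b c) n = coeff (resolvent A b c) (n - 1)"
    using n by (cases n) auto
  moreover have "coeff (resolvent A b (A *\<^sub>v c)) n = 0"
    using degree_resolvent_less[OF b _ n, of "A *\<^sub>v c"] c by (simp add: coeff_eq_0)
  moreover have "coeff \<chi> n = 1" using monic_chi degree_chi by simp
  ultimately show ?thesis unfolding resolvent_right[OF b c] by simp
qed

lemma resolvent_pact_right:
  assumes b: "b \<in> carrier_vec n" and c: "c \<in> carrier_vec n"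
  shows "\<chi> dvd f * resolvent A b c - resolvent A b (pact A f c)"
proof (induction f)
  case 0
  have "resolvent A b (0 \<cdot>\<^sub>v c) = 0" using b c by (subst resolvent_smult_right) auto
  moreover have "0 \<cdot>\<^sub>v c = 0\<^sub>v n" using c by auto
  ultimately show ?case by simp
next
  case (pCons a f)
  have "pCons a f * resolvent A b c - resolvent A b (pact A (pCons a f) c) =
      [:0, 1:] * (f * resolvent A b c) - resolvent A b (A *\<^sub>v pact A f c)"
    using b c by (simp add: pact_pCons resolvent_add_right resolvent_smult_right)
  also have "\<dots> = [:0, 1:] * (f * resolvent A b c - resolvent A b (pact A f c))
      + Polynomial.smult (b \<bullet> pact A f c) \<chi>"
    using resolvent_right[OF b, of "pact A f c"] c by (simp add: algebra_simps)
  finally show ?case using pCons by (simp add: dvd_smult dvd_pCons_0)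
qed

text \<open>The correction terms in \<open>resolvent_right\<close> carry the inner products of
  \<open>b\<close> with vectors \<open>g(A) c\<close> as factors. When these vanish modulo
  \<open>p\<close>, multiplication by powers of the variable is exact modulo \<open>p\<close>, with
  no reduction by \<open>chi\<close>.\<close>

lemma resolvent_shift:
  assumes b: "b \<in> carrier_vec n" and c: "c \<in> carrier_vec n"
    and p: "\<And>g. p dvd b \<bullet> pact A g c"
  shows "[:p:] dvd monom 1 k * resolvent A b c - resolvent A b (pact A (monom 1 k) c)"
proof (induction k)
  case 0
  then show ?case using c by simp
next
  case (Suc k)
  let ?v = "pact A (monom 1 k) c"
  have "pact A (monom 1 (Suc k)) c = A *\<^sub>v ?v"
    using c by (simp add: monom_Suc pact_pCons) (intro eq_vecI, auto)
  then have "monom 1 (Suc k) * resolvent A b c - resolvent A b (pact A (monom 1 (Suc k)) c)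
      = [:0, 1:] * (monom 1 k * resolvent A b c - resolvent A b ?v) + Polynomial.smult (b \<bullet> ?v) \<chi>"
    using resolvent_right[OF b, of ?v] c by (simp add: monom_Suc algebra_simps)
  moreover have "[:p:] dvd Polynomial.smult (b \<bullet> ?v) \<chi>"
    using p by (simp add: const_poly_dvd_iff)
  ultimately show ?case using Suc by (simp add: dvd_pCons_0)
qed

text \<open>The case \<open>p = 0\<close> is a statement over the integers and yields the Cayley--Hamilton theorem.\<close>

lemma annihilator_iff:
  assumes b: "b \<in> carrier_vec n" and c: "c \<in> carrier_vec n" and n: "0 < n"
  shows "(\<forall>g. p dvd b \<bullet> pact A (g * f) c) \<longleftrightarrow> pdvd p \<chi> (f * resolvent A b c)"
proof
  assume L: "\<forall>g. p dvd b \<bullet> pact A (g * f) c"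
  define v where "v = pact A f c"
  have v: "v \<in> carrier_vec n" using c by (simp add: v_def)
  have "p dvd b \<bullet> pact A g v" for g using L c by (simp add: v_def pact_mult)
  \<comment> \<open>Modulo \<open>p\<close>, the resolvent of \<open>v\<close> times the
    \<open>n\<close>-th power of the variable is a resolvent again and has degree below
    \<open>n\<close>; so the resolvent of \<open>v\<close> is zero modulo \<open>p\<close>.\<close>
  from resolvent_shift[OF b v this, of n]
  have *: "p dvd coeff (monom 1 n * resolvent A b v - resolvent A b (pact A (monom 1 n) v)) (i + n)" for i
    unfolding const_poly_dvd_iff by blast
  have "coeff (resolvent A b (pact A (monom 1 n) v)) (i + n) = 0" for i
    using degree_resolvent_less[OF b _ n, of "pact A (monom 1 n) v"] v by (simp add: coeff_eq_0)
  then have "p dvd coeff (resolvent A b v) i" for i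
    using *[of i] by (simp add: coeff_monom_mult)
  then have "[:p:] dvd resolvent A b v" by (simp add: const_poly_dvd_iff)
  then have "pdvd p \<chi> (resolvent A b v)" by (rule pdvd_const)
  moreover have "pdvd p \<chi> (f * resolvent A b c - resolvent A b v)"
    unfolding v_def by (rule dvd_imp_pdvd[OF resolvent_pact_right[OF b c]])
  ultimately show "pdvd p \<chi> (f * resolvent A b c)" using pdvd_add by fastforce
next
  assume R: "pdvd p \<chi> (f * resolvent A b c)"
  show "\<forall>g. p dvd b \<bullet> pact A (g * f) c"
  proof
    fix g
    have "pdvd p \<chi> (g * f * resolvent A b c)" using pdvd_mult[OF R] by (simp add: mult.assoc)
    moreover have "pdvd p \<chi> (g * f * resolvent A b c - resolvent A b (pact A (g * f) c))"
      by (rule dvd_imp_pdvd[OF resolvent_pact_right[OF b c]])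
    ultimately have "pdvd p \<chi> (resolvent A b (pact A (g * f) c))" using pdvd_diff by fastforce
    \<comment> \<open>A polynomial of degree below \<open>n\<close> that \<open>chi\<close> divides
      modulo \<open>p\<close> is zero modulo \<open>p\<close>; its coefficient at
      \<open>n - 1\<close> is the inner product in question.\<close>
    then have "[:p:] dvd resolvent A b (pact A (g * f) c)"
      using degree_resolvent_less[OF b pact_carrier[OF c] n] by (intro pdvd_monic_small[OF monic_chi]) (auto simp: degree_chi)
    then have "p dvd coeff (resolvent A b (pact A (g * f) c)) (n - 1)"
      unfolding const_poly_dvd_iff by blast
    then show "p dvd b \<bullet> pact A (g * f) c" using coeff_resolvent[OF b _ n] c by simp
  qed
qed

lemma pact_chi [simp]:
  assumes c: "c \<in> carrier_vec n"
  shows "pact A \<chi> c = 0\<^sub>v n"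
proof (intro eq_vecI)
  fix i assume "i < dim_vec (0\<^sub>v n :: int vec)"
  then have i: "i < n" by simp
  have "pdvd 0 \<chi> (\<chi> * resolvent A (unit_vec n i) c)" by (simp add: pdvd_0_modulus)
  then have "0 dvd unit_vec n i \<bullet> pact A (1 * \<chi>) c"
    using annihilator_iff[of "unit_vec n i" c 0 \<chi>] i c by (metis gr_zeroI not_less_zero unit_vec_carrier)
  then show "pact A \<chi> c $ i = 0\<^sub>v n $ i" using i c by (simp add: scalar_prod_left_unit)
qed (use c in auto)

end

locale skew_matrix = int_matrix +
  assumes skew: "A\<^sup>T = - A"
begin

lemma A_skew:
  assumes "v \<in> carrier_vec n" "w \<in> carrier_vec n"
  shows "(A *\<^sub>v v) \<bullet> w = - (v \<bullet> (A *\<^sub>v w))"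
proof -
  have "v \<bullet> (A *\<^sub>v w) = (A\<^sup>T *\<^sub>v v) \<bullet> w"
    using assms by (intro transpose_vec_mult_scalar[symmetric, of _ n n]) auto
  also have "A\<^sup>T *\<^sub>v v = - (A *\<^sub>v v)" using assms unfolding skew by (subst uminus_mult_mat_vec) auto
  finally show ?thesis using assms by (simp add: scalar_prod_uminus_left)
qed

lemma pact_skew:
  assumes v: "v \<in> carrier_vec n" and w: "w \<in> carrier_vec n"
  shows "pact A f v \<bullet> w = v \<bullet> pact A (star f) w"
  using w
proof (induction f arbitrary: w)
  case 0
  then show ?case using v by simp
next
  case (pCons a f)
  have "star (pCons a f) = [:a:] + Polynomial.smult (-1) ([:0, 1:] * star f)"
    by (simp add: pcompose_pCons)
  then have "pact A (star (pCons a f)) w = a \<cdot>\<^sub>v w + (-1) \<cdot>\<^sub>v pact A (star f) (A *\<^sub>v w)"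
    using pCons.prems by (simp only: pact_add pact_smult pact_const mult.commute[of "[:0, 1:]"] pact_mult pact_x)
  then have "v \<bullet> pact A (star (pCons a f)) w = a * (v \<bullet> w) - v \<bullet> pact A (star f) (A *\<^sub>v w)"
    using v pCons.prems by (simp add: scalar_prod_add_distrib[of _ n] scalar_prod_smult_distrib[of _ n])
  also have "\<dots> = a * (v \<bullet> w) - pact A f v \<bullet> (A *\<^sub>v w)"
    using pCons.IH[of "A *\<^sub>v w"] pCons.prems by simp
  also have "\<dots> = pact A (pCons a f) v \<bullet> w"
    using v pCons.prems A_skew[of "pact A f v" w]
    by (simp add: pact_pCons add_scalar_prod_distrib[of _ n] smult_scalar_prod_distrib[of _ n])
  finally show ?case ..
qed

text \<open>On the left argument the variable acts as the transpose, which is \<open>- A\<close>;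
  this is where \<open>star\<close> enters.\<close>

lemma resolvent_pact_left:
  assumes b: "b \<in> carrier_vec n" and c: "c \<in> carrier_vec n"
  shows "\<chi> dvd star f * resolvent A b c - resolvent A (pact A f b) c"
proof (induction f)
  case 0
  have "resolvent A (0 \<cdot>\<^sub>v b) c = 0" using b c by (subst resolvent_smult_left) auto
  moreover have "0 \<cdot>\<^sub>v b = 0\<^sub>v n" using b by auto
  ultimately show ?case by simp
next
  case (pCons a f)
  let ?w = "pact A f b"
  have w: "?w \<in> carrier_vec n" using b by simp
  have "A\<^sup>T *\<^sub>v ?w = (-1) \<cdot>\<^sub>v (A *\<^sub>v ?w)" using w unfolding skew by (subst uminus_mult_mat_vec) auto
  then have x: "pCons 0 (resolvent A ?w c) = Polynomial.smult (?w \<bullet> c) \<chi> - resolvent A (A *\<^sub>v ?w) c"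
    using resolvent_left[OF w c] w c by (simp add: resolvent_smult_left)
  let ?g = "star f * resolvent A b c"
  have "star (pCons a f) * resolvent A b c - resolvent A (pact A (pCons a f) b) c =
      - pCons 0 ?g - resolvent A (A *\<^sub>v ?w) c"
    using b c by (simp add: pact_pCons resolvent_add_left resolvent_smult_left pcompose_pCons algebra_simps)
  also have "\<dots> = pCons 0 (resolvent A ?w c) - pCons 0 ?g - Polynomial.smult (?w \<bullet> c) \<chi>"
    using x by simp
  also have "\<dots> = - pCons 0 (?g - resolvent A ?w c) - Polynomial.smult (?w \<bullet> c) \<chi>"
    by simp
  finally show ?case
    using dvd_diff[OF dvd_minus_iff[THEN iffD2, OF dvd_pCons_0[OF pCons.IH]] dvd_smult[OF dvd_refl]]
    by metis
qed

end

section \<open>Characteristic polynomials of rank one perturbations\<close>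

text \<open>The matrix determinant lemma in adjugate form: the bordered matrix with blocks
  \<open>M\<close>, \<open>U\<close>, \<open>V\<close>, 1 is made block triangular by column
  operations in two ways, and \<open>det M\<close> is cancelled at the end.\<close>

lemma det_minus_rank_one:
  fixes M :: "'a :: idom mat"
  assumes M: "M \<in> carrier_mat n n" and u: "u \<in> carrier_vec n" and v: "v \<in> carrier_vec n"
    and det0: "det M \<noteq> 0"
  shows "det (M - mat n n (\<lambda>(i, j). u $ i * v $ j)) = det M - v \<bullet> (adj_mat M *\<^sub>v u)"
proof -
  define P where "P = adj_mat M"
  define U where "U = mat n 1 (\<lambda>(i, j). u $ i)"
  define V where "V = mat 1 n (\<lambda>(i, j). v $ j)"
  define W where "W = P * U"
  define \<delta> where "\<delta> = det M"
  have P: "P \<in> carrier_mat n n" and MP: "M * P = \<delta> \<cdot>\<^sub>m 1\<^sub>m n"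
    using adj_mat[OF M] by (auto simp: P_def \<delta>_def)
  have U: "U \<in> carrier_mat n 1" and V: "V \<in> carrier_mat 1 n" by (auto simp: U_def V_def)
  have W: "W \<in> carrier_mat n 1" unfolding W_def using P U by simp
  let ?R = "mat n n (\<lambda>(i, j). u $ i * v $ j)"
  let ?L = "four_block_mat M U V (1\<^sub>m 1)"
  have L: "?L \<in> carrier_mat (n + 1) (n + 1)" using M by (intro four_block_carrier_mat) auto
  have UV: "U * V = ?R" unfolding U_def V_def by (intro eq_matI) (auto simp: scalar_prod_def)
  \<comment> \<open>The first elimination clears the lower left block and leaves the Schur
    complement \<open>M - U * V\<close>.\<close>
  let ?F = "four_block_mat (1\<^sub>m n) (0\<^sub>m n 1) (- V) (1\<^sub>m 1)"
  have F: "?F \<in> carrier_mat (n + 1) (n + 1)" by (intro four_block_carrier_mat) auto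
  have "?L * ?F = four_block_mat (M - ?R) U (0\<^sub>m 1 n) (1\<^sub>m 1)"
  proof -
    have "?L * ?F = four_block_mat (M * 1\<^sub>m n + U * - V) (M * 0\<^sub>m n 1 + U * 1\<^sub>m 1)
        (V * 1\<^sub>m n + 1\<^sub>m 1 * - V) (V * 0\<^sub>m n 1 + 1\<^sub>m 1 * 1\<^sub>m 1)"
      using M U V by (intro mult_four_block_mat) auto
    moreover have "M * 1\<^sub>m n + U * - V = M - ?R" using M U V UV[symmetric] by (simp add: minus_add_uminus_mat[of _ n n])
    moreover have "M * 0\<^sub>m n 1 + U * 1\<^sub>m 1 = U" using M U by simp
    moreover have "V * 1\<^sub>m n + 1\<^sub>m 1 * - V = 0\<^sub>m 1 n" using V by (intro eq_matI) auto
    moreover have "V * 0\<^sub>m n 1 + 1\<^sub>m 1 * 1\<^sub>m 1 = (1\<^sub>m 1 :: 'a mat)" using V by simp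
    ultimately show ?thesis by simp
  qed
  moreover have "det (four_block_mat (M - ?R) U (0\<^sub>m 1 n) (1\<^sub>m 1)) = det (M - ?R) * det (1\<^sub>m 1)"
    by (rule det_four_block_mat_lower_left_zero[OF _ U]) (use M in auto)
  moreover have "det ?F = det (1\<^sub>m n) * det (1\<^sub>m 1)"
    by (rule det_four_block_mat_upper_right_zero) (use V in auto)
  ultimately have 1: "det ?L = det (M - ?R)" using det_mult[OF L F] by simp
  let ?s = "v \<bullet> (P *\<^sub>v u)"
  \<comment> \<open>The second elimination clears the upper right block. The adjugate replaces the
    inverse of \<open>M\<close>, so the last column is scaled by the determinant
    \<open>\<delta>\<close>.\<close>
  let ?G = "four_block_mat (1\<^sub>m n) (- W) (0\<^sub>m 1 n) (\<delta> \<cdot>\<^sub>m 1\<^sub>m 1)"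
  have G: "?G \<in> carrier_mat (n + 1) (n + 1)" by (intro four_block_carrier_mat) auto
  have MW: "M * W = \<delta> \<cdot>\<^sub>m U"
    unfolding W_def using assoc_mult_mat[OF M P U] MP U by (metis left_mult_one_mat mult_smult_assoc_mat one_carrier_mat)
  have VW: "V * W = mat 1 1 (\<lambda>_. ?s)"
    using P u v unfolding W_def U_def V_def
    by (intro eq_matI) (auto simp: scalar_prod_def intro!: sum.cong)
  have "?L * ?G = four_block_mat M (0\<^sub>m n 1) V (mat 1 1 (\<lambda>_. \<delta> - ?s))"
  proof -
    have "?L * ?G = four_block_mat (M * 1\<^sub>m n + U * 0\<^sub>m 1 n) (M * - W + U * (\<delta> \<cdot>\<^sub>m 1\<^sub>m 1))
        (V * 1\<^sub>m n + 1\<^sub>m 1 * 0\<^sub>m 1 n) (V * - W + 1\<^sub>m 1 * (\<delta> \<cdot>\<^sub>m 1\<^sub>m 1))"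
      using M U V W by (intro mult_four_block_mat) auto
    moreover have "M * 1\<^sub>m n + U * 0\<^sub>m 1 n = M" using M U by simp
    moreover have "M * - W + U * (\<delta> \<cdot>\<^sub>m 1\<^sub>m 1) = 0\<^sub>m n 1"
      using M U W MW by (intro eq_matI) (auto simp: mult_smult_distrib[of _ n 1])
    moreover have "V * 1\<^sub>m n + 1\<^sub>m 1 * 0\<^sub>m 1 n = V" using V by simp
    moreover have "V * - W + 1\<^sub>m 1 * (\<delta> \<cdot>\<^sub>m 1\<^sub>m 1) = mat 1 1 (\<lambda>_. \<delta> - ?s)"
      using V W VW by (intro eq_matI) auto
    ultimately show ?thesis by simp
  qed
  moreover have "det (four_block_mat M (0\<^sub>m n 1) V (mat 1 1 (\<lambda>_. \<delta> - ?s))) =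
      det M * det (mat 1 1 (\<lambda>_. \<delta> - ?s))"
    by (rule det_four_block_mat_upper_right_zero) (use M V in auto)
  moreover have "det ?G = det (1\<^sub>m n) * det (\<delta> \<cdot>\<^sub>m 1\<^sub>m 1)"
    by (rule det_four_block_mat_lower_left_zero) (use W in auto)
  ultimately have "det ?L * \<delta> = \<delta> * (\<delta> - ?s)"
    using det_mult[OF L G] det_single[of "mat 1 1 (\<lambda>_. \<delta> - ?s)"] by (auto simp: \<delta>_def)
  then show ?thesis using det0 1 by (simp add: \<delta>_def P_def)
qed

lemma char_poly_add_rank_one:
  assumes A: "A \<in> carrier_mat n n" and u: "u \<in> carrier_vec n" and v: "v \<in> carrier_vec n"
  shows "char_poly (A + mat n n (\<lambda>(i, j). u $ i * v $ j)) = char_poly A - resolvent A v u"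
proof -
  have "char_poly_matrix (A + mat n n (\<lambda>(i, j). u $ i * v $ j)) =
      char_poly_matrix A - mat n n (\<lambda>(i, j). const_vec u $ i * const_vec v $ j)"
    using A u v by (intro eq_matI) (auto simp: char_poly_matrix_def)
  moreover have "det (char_poly_matrix A) \<noteq> 0"
    using degree_monic_char_poly[OF A] by (auto simp: char_poly_def)
  ultimately show ?thesis
    using det_minus_rank_one[of "char_poly_matrix A" n "const_vec u" "const_vec v"] A u v
    by (simp add: char_poly_def resolvent_def)
qed

section \<open>The reflection of the variable\<close>

lemma star_simps [simp]:
  "star (f + g) = star f + star g" "star (f - g) = star f - star g" "star (f * g) = star f * star g"
  "star (- f) = - star f" "star (Polynomial.smult a f) = Polynomial.smult a (star f)"
  "star 1 = 1" "star [:a:] = [:a:]"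
  by (simp_all add: pcompose_add pcompose_diff pcompose_mult pcompose_uminus pcompose_smult pcompose_1)

lemma star_star [simp]: "star (star f) = f"
proof -
  have "pcompose [:0, -1:] [:0, -1 :: int:] = [:0, 1:]" by (simp add: pcompose_pCons)
  then show ?thesis by (simp only: pcompose_assoc[symmetric] pcompose_idR)
qed

lemma star_hom: "comm_ring_hom star"
  by standard auto

lemma star_dvd: "f dvd g \<Longrightarrow> star f dvd star g"
  by (metis dvd_def star_simps(3))

lemma const_dvd_star: "[:p:] dvd f \<Longrightarrow> [:p:] dvd star f"
  using star_dvd[of "[:p:]" f] by simp

lemma pdvd_star: "pdvd p f g \<Longrightarrow> pdvd p (star f) (star g)"
proof (elim pdvdE)
  fix q assume "[:p:] dvd g - f * q"
  then have "[:p:] dvd star (g - f * q)" by (rule const_dvd_star)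
  then show ?thesis by (intro pdvdI[of _ _ _ "star q"]) simp
qed

lemma star_char_poly:
  assumes A: "A \<in> carrier_mat n n"
  shows "star (char_poly A) = (- 1) ^ n * char_poly (- A)"
proof -
  have "map_mat star (char_poly_matrix A) = (- 1) \<cdot>\<^sub>m char_poly_matrix (- A)"
    using A by (intro eq_matI) (auto simp: char_poly_matrix_def pcompose_pCons)
  then have "star (char_poly A) = det ((- 1) \<cdot>\<^sub>m char_poly_matrix (- A))"
    unfolding char_poly_def by (metis comm_ring_hom.hom_det[OF star_hom])
  also have "\<dots> = (- 1) ^ n * char_poly (- A)"
    unfolding char_poly_def det_smult using A by (simp add: char_poly_matrix_def)
  finally show ?thesis .
qed

text \<open>Clears a denominator \<open>D\<close>: for \<open>r\<close> the remainder of
  \<open>g\<close> modulo \<open>f\<close>, the multiple \<open>D r\<close> is divisible by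
  \<open>f\<close> but of smaller degree, hence zero.\<close>

lemma monic_dvd_smult_cancel:
  fixes f :: "int poly"
  assumes f: "monic f" and D: "D \<noteq> 0" and dv: "f dvd Polynomial.smult D g"
  shows "f dvd g"
proof -
  obtain q r where qr: "g = f * q + r" "r = 0 \<or> degree r < degree f" using monic_div[OF f] .
  have "r = 0"
  proof (rule ccontr)
    assume r0: "r \<noteq> 0"
    have "f dvd Polynomial.smult D g - f * Polynomial.smult D q" by (intro dvd_diff dv dvd_triv_left)
    then have "f dvd Polynomial.smult D r" by (simp add: qr(1) smult_add_right)
    moreover have "degree (Polynomial.smult D r) < degree f" using qr(2) r0 D by simp
    ultimately have "[:0:] dvd Polynomial.smult D r"
      using pdvd_monic_small[OF f, of 0 "Polynomial.smult D r"] by (simp only: pdvd_0_modulus)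
    with r0 D show False by simp
  qed
  then show ?thesis using qr(1) by simp
qed

context skew_matrix
begin

lemma uminus_transpose: "- A = A\<^sup>T" by (simp add: skew)

lemma star_chi: "star \<chi> = (- 1) ^ n * \<chi>"
  using star_char_poly[OF A] char_poly_transpose_mat[OF A] by (simp add: uminus_transpose)

lemma star_chi_dvd_iff: "star \<chi> dvd f \<longleftrightarrow> \<chi> dvd f"
  unfolding star_chi by (cases "even n") auto

text \<open>For \<open>J\<close> the outer square of \<open>e\<close>, the matrix
  \<open>- (A + J)\<close> is the transpose of \<open>A - J\<close>. The characteristic polynomials
  of \<open>A + J\<close> and \<open>A - J\<close> are \<open>chi - a\<close> and
  \<open>chi + a\<close>, where \<open>a\<close> is the resolvent of \<open>e\<close> with itself;
  reflecting the first gives the parity of \<open>a\<close>.\<close>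

lemma star_resolvent_self:
  assumes e: "e \<in> carrier_vec n"
  shows "star (resolvent A e e) = - ((- 1) ^ n * resolvent A e e)"
proof -
  let ?J = "mat n n (\<lambda>(i, j). e $ i * e $ j)"
  have plus: "char_poly (A + ?J) = \<chi> - resolvent A e e" by (rule char_poly_add_rank_one[OF A e e])
  have J': "mat n n (\<lambda>(i, j). (- e) $ i * e $ j) = - ?J" using e by (intro eq_matI) auto
  have "char_poly (A + - ?J) = \<chi> - resolvent A e (- e)"
    using char_poly_add_rank_one[OF A uminus_carrier_vec[THEN iffD2, OF e] e] unfolding J' .
  also have "resolvent A e (- e) = - resolvent A e e"
  proof -
    have "- e = (- 1) \<cdot>\<^sub>v e" by (intro eq_vecI) auto
    then show ?thesis using resolvent_smult_right[OF e e, of "- 1"] by simp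
  qed
  finally have minus: "char_poly (A + - ?J) = \<chi> + resolvent A e e" by simp
  have JT: "?J\<^sup>T = ?J" by (intro eq_matI) (auto simp: mult.commute)
  have "star (char_poly (A + ?J)) = (- 1) ^ n * char_poly (- (A + ?J))"
    by (rule star_char_poly) simp
  also have "- (A + ?J) = (A + - ?J)\<^sup>T"
  proof (intro eq_matI)
    fix i j assume "i < dim_row ((A + - ?J)\<^sup>T)" "j < dim_col ((A + - ?J)\<^sup>T)"
    then have ij: "i < n" "j < n" by auto
    have "A\<^sup>T $$ (i, j) = (- A) $$ (i, j)" by (simp add: skew)
    then have "A $$ (j, i) = - A $$ (i, j)" using ij by simp
    then show "(- (A + ?J)) $$ (i, j) = (A + - ?J)\<^sup>T $$ (i, j)" using ij by simp
  qed auto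
  also have "char_poly \<dots> = char_poly (A + - ?J)" by (intro char_poly_transpose_mat[of _ n]) simp
  finally have "star (\<chi> - resolvent A e e) = (- 1) ^ n * (\<chi> + resolvent A e e)"
    by (simp only: plus minus)
  then show ?thesis using star_chi by (simp add: algebra_simps)
qed

text \<open>If \<open>b\<close> is a rational multiple of \<open>g(A) e\<close>, then modulo \<open>\<chi>\<close> all resolvents of \<open>b\<close> and \<open>e\<close> are
  multiples of the resolvent of \<open>e\<close> by \<open>g\<close> and \<open>g\<^sup>*\<close>.\<close>

lemma resolvent_mult_star:
  assumes e: "e \<in> carrier_vec n" and b: "b \<in> carrier_vec n"
    and D: "D \<noteq> 0" and g: "pact A g e = D \<cdot>\<^sub>v b"
  defines "c \<equiv> resolvent A b e"
  shows "\<chi> dvd c * star c - star (resolvent A e e) * resolvent A b b"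
proof -
  let ?a = "resolvent A e e" and ?q = "resolvent A b b" and ?s = "Polynomial.smult D"
  have 1: "\<chi> dvd star g * ?a - ?s c"
    using resolvent_pact_left[OF e e, of g] b e by (simp add: g resolvent_smult_left c_def)
  have b': "D \<cdot>\<^sub>v b \<in> carrier_vec n" using b by simp
  have "\<chi> dvd star g * resolvent A e (D \<cdot>\<^sub>v b) - resolvent A (D \<cdot>\<^sub>v b) (D \<cdot>\<^sub>v b)"
    using resolvent_pact_left[OF e b', of g] unfolding g .
  moreover have "resolvent A (D \<cdot>\<^sub>v b) (D \<cdot>\<^sub>v b) = ?s (?s ?q)"
    using resolvent_smult_left[OF b b'] resolvent_smult_right[OF b b] by simp
  moreover have "\<chi> dvd star g * (g * ?a - resolvent A e (D \<cdot>\<^sub>v b))"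
    using resolvent_pact_right[OF e e, of g] by (simp add: g)
  ultimately have "\<chi> dvd (star g * resolvent A e (D \<cdot>\<^sub>v b) - ?s (?s ?q)) + star g * (g * ?a - resolvent A e (D \<cdot>\<^sub>v b))"
    by (intro dvd_add) simp_all
  then have 2: "\<chi> dvd star g * g * ?a - ?s (?s ?q)" by (simp add: algebra_simps)
  have 3: "\<chi> dvd g * star ?a - ?s (star c)"
    using star_dvd[OF 1] by (simp add: star_chi_dvd_iff)
  \<comment> \<open>Modulo \<open>chi\<close>, the facts 1, 2 and 3 say that \<open>D c\<close>,
    \<open>D^2 q\<close> and \<open>D (star c)\<close> equal \<open>star g * a\<close>,
    \<open>star g * g * a\<close> and \<open>g * star a\<close>. This combination eliminates
    \<open>g\<close>.\<close>
  have "\<chi> dvd (star g * g * ?a - ?s (?s ?q)) * star ?a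
      - (star g * ?a - ?s c) * (g * star ?a)
      - (g * star ?a - ?s (star c)) * ?s c"
    by (intro dvd_diff dvd_mult2 1 2 3)
  also have "(star g * g * ?a - ?s (?s ?q)) * star ?a
      - (star g * ?a - ?s c) * (g * star ?a)
      - (g * star ?a - ?s (star c)) * ?s c = ?s (?s (c * star c - star ?a * ?q))"
    by (simp add: algebra_simps smult_diff_right)
  finally show ?thesis using monic_dvd_smult_cancel[OF monic_chi D] by blast
qed

end

section \<open>Annihilators modulo a prime\<close>

definition vdvd :: "int \<Rightarrow> int vec \<Rightarrow> bool" where
  "vdvd p v \<longleftrightarrow> (\<forall>i<dim_vec v. p dvd v $ i)"

lemma vdvd_scalar_prod: "vdvd p v \<Longrightarrow> p dvd b \<bullet> v"
  unfolding scalar_prod_def vdvd_def by (auto intro!: dvd_sum)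

lemma vdvd_iff_scalar_prod:
  assumes "v \<in> carrier_vec n"
  shows "vdvd p v \<longleftrightarrow> (\<forall>b\<in>carrier_vec n. p dvd b \<bullet> v)"
proof
  assume R: "\<forall>b\<in>carrier_vec n. p dvd b \<bullet> v"
  show "vdvd p v" unfolding vdvd_def
  proof (intro allI impI)
    fix i assume "i < dim_vec v"
    then show "p dvd v $ i" using R[rule_format, of "unit_vec n i"] assms by (simp add: scalar_prod_left_unit)
  qed
qed (use vdvd_scalar_prod in blast)

lemma vdvd_add: "vdvd p v \<Longrightarrow> vdvd p w \<Longrightarrow> dim_vec v = dim_vec w \<Longrightarrow> vdvd p (v + w)"
  unfolding vdvd_def by auto

lemma vdvd_smult: "p dvd a \<Longrightarrow> vdvd p (a \<cdot>\<^sub>v v)"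
  unfolding vdvd_def by auto

lemma vdvdE:
  assumes "vdvd p v" "v \<in> carrier_vec n"
  obtains w where "w \<in> carrier_vec n" "v = p \<cdot>\<^sub>v w"
proof
  show "vec n (\<lambda>i. v $ i div p) \<in> carrier_vec n" by simp
  show "v = p \<cdot>\<^sub>v vec n (\<lambda>i. v $ i div p)"
    using assms by (intro eq_vecI) (auto simp: vdvd_def)
qed

text \<open>The division is carried out over the integers, where comparing leading terms shows that
  the quotient is monic of complementary degree; only the remainder is discarded modulo
  \<open>p\<close>.\<close>

lemma cofactor_mod:
  fixes m f :: "int poly"
  assumes m: "monic m" and f: "monic f" and dv: "pdvd p m f" and p: "\<not> p dvd 1"
  obtains k where "monic k" "degree k + degree m = degree f" "[:p:] dvd f - k * m"
proof -
  obtain k r where kr: "f = m * k + r" "r = 0 \<or> degree r < degree m" using monic_div[OF m] .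
  have "pdvd p m (f - k * m)" by (intro pdvd_diff pdvd_mult dv) simp
  then have r: "[:p:] dvd f - k * m"
    using kr pdvd_monic_small[OF m, of p r] by (cases "r = 0") (auto simp: algebra_simps)
  have le: "degree m \<le> degree f" using pdvd_monic_degree_le[OF m dv f p] .
  have k0: "k \<noteq> 0"
  proof
    assume "k = 0"
    with r have "[:p:] dvd f" by simp
    then show False using const_dvd_monic f p by blast
  qed
  have deg: "degree (m * k) = degree m + degree k" using m k0 by (intro degree_mult_eq) auto
  have "degree f = degree m + degree k \<and> lead_coeff (m * k) = lead_coeff f"
  proof (cases "r = 0")
    case True
    then show ?thesis using kr deg by simp
  next
    case False
    then have "degree r < degree (m * k)" using kr(2) deg by simp
    then show ?thesis unfolding kr(1) using deg by (simp add: degree_add_eq_left coeff_eq_0)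
  qed
  then show ?thesis using that[of k] r m f by (simp add: lead_coeff_mult)
qed

context int_matrix
begin

lemma vdvd_pact:
  assumes v: "v \<in> carrier_vec n" and p: "vdvd p v"
  shows "vdvd p (pact A f v)"
proof -
  obtain w where "w \<in> carrier_vec n" "v = p \<cdot>\<^sub>v w" using p v by (rule vdvdE)
  then show ?thesis by (simp add: pact_vec_smult vdvd_smult)
qed

lemma vdvd_pact_mult:
  assumes v: "v \<in> carrier_vec n" and p: "vdvd p (pact A f v)"
  shows "vdvd p (pact A (g * f) v)"
  using assms by (simp add: pact_mult vdvd_pact)

lemma vdvd_pact_const:
  assumes v: "v \<in> carrier_vec n" and p: "[:p:] dvd f"
  shows "vdvd p (pact A f v)"
proof -
  obtain h where "f = [:p:] * h" using p by blast
  then show ?thesis using v by (simp add: pact_smult vdvd_smult)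
qed

lemma vdvd_pact_add:
  assumes "v \<in> carrier_vec n" "vdvd p (pact A f v)" "vdvd p (pact A g v)"
  shows "vdvd p (pact A (f + g) v)"
  using assms by (simp add: pact_add vdvd_add)

lemma vdvd_pact_cong:
  assumes v: "v \<in> carrier_vec n" and p: "[:p:] dvd f - g" and g: "vdvd p (pact A g v)"
  shows "vdvd p (pact A f v)"
  using vdvd_pact_add[OF v vdvd_pact_const[OF v p] g] by simp

text \<open>By Cayley-Hamilton, \<open>chi\<close> lies in the ideal of polynomials that kill
  \<open>e\<close> modulo \<open>p\<close>. The generator \<open>m\<close> is the minimal polynomial
  of \<open>e\<close>; the degrees of \<open>m\<close> and of the cofactor \<open>k\<close> will be
  the rank and the nullity of the walk matrix.\<close>

lemma annihilator_generator:
  assumes p: "prime p" and e: "e \<in> carrier_vec n"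
  obtains m k where "monic m" "monic k" "degree k + degree m = n" "[:p:] dvd \<chi> - k * m"
    "\<And>f. vdvd p (pact A f e) \<longleftrightarrow> pdvd p m f"
proof -
  let ?I = "{f. vdvd p (pact A f e)}"
  have "poly_ideal ?I"
    unfolding poly_ideal_def using e by (auto intro: vdvd_pact_add vdvd_pact_mult)
  moreover have "[:p:] \<in> ?I" using e by (simp add: vdvd_pact_const)
  moreover have chi: "\<chi> \<in> ?I" using e by (simp add: vdvd_def)
  ultimately obtain m where m: "monic m" "\<And>f. f \<in> ?I \<longleftrightarrow> pdvd p m f"
    using poly_ideal_principal[OF p, of ?I \<chi>] monic_chi by metis
  have "pdvd p m \<chi>" using chi m by blast
  then obtain k where "monic k" "degree k + degree m = n" "[:p:] dvd \<chi> - k * m"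
    using cofactor_mod[OF m(1) monic_chi] p not_prime_unit degree_chi by metis
  then show ?thesis using that[of m k] m by simp
qed

text \<open>If \<open>k\<close> divides the resolvent, then \<open>k * m\<close>, which is
  \<open>chi\<close> modulo \<open>p\<close>, divides \<open>m\<close> times the resolvent, and
  \<open>annihilator_iff\<close> turns this into orthogonality.\<close>

lemma pdvd_resolvent_imp:
  assumes b: "b \<in> carrier_vec n" and e: "e \<in> carrier_vec n" and n: "0 < n"
    and chi: "[:p:] dvd \<chi> - k * m" and k: "pdvd p k (resolvent A b e)"
  shows "p dvd b \<bullet> pact A m e"
proof -
  have "pdvd p (k * m) (resolvent A b e * m)" using k by (rule pdvd_mult_mono)
  then have "pdvd p \<chi> (m * resolvent A b e)"
    using chi pdvd_cong_left[of p "k * m" \<chi>] by (metis dvd_minus_iff minus_diff_eq mult.commute)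
  then have "p dvd b \<bullet> pact A (1 * m) e" using annihilator_iff[OF b e n] by blast
  then show ?thesis by simp
qed

end

section \<open>The cofactor of the annihilator divides all resolvents\<close>

text \<open>\<open>cyclic\<close> is the property of the last invariant factor \<open>d\<close> that
  matters: \<open>d\<close> times any integral vector is an integral combination of walk vectors.
  The polynomials \<open>m\<close> and \<open>k\<close> are those of
  \<open>annihilator_generator\<close>.\<close>

locale skew_walk = skew_matrix +
  fixes e :: "int vec" and d p :: int and m k :: "int poly"
  assumes e [simp]: "e \<in> carrier_vec n" and n: "0 < n"
    and p: "prime p" and p_d: "p dvd d" and p2_d: "\<not> p * p dvd d"
    and cyclic: "\<And>z. z \<in> carrier_vec n \<Longrightarrow> \<exists>g. pact A g e = d \<cdot>\<^sub>v z"
    and m: "monic m" and k: "monic k" and deg_km: "degree k + degree m = n"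
    and chi: "[:p:] dvd \<chi> - k * m"
    and ann: "\<And>f. vdvd p (pact A f e) \<longleftrightarrow> pdvd p m f"
begin

abbreviation a :: "int poly" where "a \<equiv> resolvent A e e"

lemma dvd_cancel_d: "p * p dvd d * x \<Longrightarrow> p dvd x"
proof -
  assume *: "p * p dvd d * x"
  obtain d' where d': "d = p * d'" using p_d by blast
  have "p dvd d' * x" using * p unfolding d' by (simp add: mult.assoc)
  moreover have "\<not> p dvd d'" using p2_d unfolding d' by (simp add: mult_dvd_mono)
  ultimately show "p dvd x" using p prime_dvd_mult_iff by blast
qed

lemma cyclicE:
  assumes z: "z \<in> carrier_vec n"
  obtains g q where "pact A g e = d \<cdot>\<^sub>v z" "[:p:] dvd g - m * q"
proof -
  obtain g where g: "pact A g e = d \<cdot>\<^sub>v z" using cyclic[OF z] by blast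
  then have "pdvd p m g" using ann[of g] p_d by (simp add: vdvd_smult)
  then show ?thesis using that g by (auto elim: pdvdE)
qed

lemma pdvd_km: "pdvd p f \<chi> \<longleftrightarrow> pdvd p f (k * m)"
  by (rule pdvd_cong[OF chi])

text \<open>If \<open>f\<close> does not divide \<open>k\<close>, then \<open>m = f m\<^sub>1\<close>, and \<open>v = (k m\<^sub>1)(A) e\<close> is orthogonal modulo \<open>p\<close> to the walks
  because \<open>f\<close> divides \<open>a\<close>. Since \<open>p\<^sup>2\<close> does not divide \<open>d\<close>, orthogonality forces \<open>k(- A) v = 0\<close>;
  together with \<open>f(A) v = 0\<close> and coprimality of \<open>f\<close> and \<open>k(- x)\<close> this gives \<open>v = 0\<close>.\<close>

lemma self_conj_factor_pdvd_k:
  assumes f: "poly_mod.irreducible_m p f" "monic f"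
    and f_chi: "pdvd p f \<chi>" and f_a: "pdvd p f a" and f_star: "pdvd p f (star f)"
  shows "pdvd p f k"
proof (rule ccontr)
  assume nk: "\<not> pdvd p f k"
  obtain u w where uw: "[:p:] dvd 1 - (u * f + w * k)" using irreducible_m_bezout[OF p f nk] .
  have "pdvd p f m" using irreducible_m_prime[OF p f] f_chi nk pdvd_km by blast
  then obtain m1 where m1: "[:p:] dvd m - f * m1" by (elim pdvdE)
  have star_f: "pdvd p (star f) f" using pdvd_star[OF f_star] by simp
  define v where "v = pact A (k * m1) e"
  have v [simp]: "v \<in> carrier_vec n" by (simp add: v_def)
  have "[:p:] dvd \<chi> - k * m + k * (m - f * m1)" using chi m1 by (intro dvd_add) simp_all
  then have kmf: "[:p:] dvd \<chi> - k * m1 * f" by (simp add: algebra_simps)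
  \<comment> \<open>Modulo \<open>p\<close>, \<open>star f * star (k * m1)\<close> is
    \<open>star \<chi>\<close>, that is \<open>\<chi>\<close> up to sign. As \<open>star f\<close>
    divides \<open>f\<close> and thereby \<open>a\<close>, the product
    \<open>star (k * m1) * a\<close> is divisible by \<open>\<chi>\<close>, and
    \<open>annihilator_iff\<close> applies.\<close>
  have perp: "p dvd v \<bullet> pact A g e" for g
  proof -
    have "pdvd p (star f * star (k * m1)) (a * star (k * m1))"
      by (intro pdvd_mult_mono pdvd_trans[OF star_f f_a])
    moreover have "pdvd p \<chi> (star f * star (k * m1))"
    proof -
      have "[:p:] dvd star \<chi> - star f * star (k * m1)"
        using const_dvd_star[OF kmf] by (simp add: algebra_simps)
      moreover have "pdvd p \<chi> (star \<chi>)"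
        using star_chi_dvd_iff[of "star \<chi>"] by (intro dvd_imp_pdvd) simp
      ultimately show ?thesis using pdvd_cong by blast
    qed
    ultimately have "pdvd p \<chi> (a * star (k * m1))" using pdvd_trans by blast
    then have "pdvd p \<chi> (star (k * m1) * a)" by (simp only: mult.commute)
    then have "p dvd e \<bullet> pact A (g * star (k * m1)) e" using annihilator_iff[OF e e n] by blast
    moreover have "v \<bullet> pact A g e = e \<bullet> pact A (g * star (k * m1)) e"
    proof -
      have "v \<bullet> pact A g e = e \<bullet> pact A (star (k * m1)) (pact A g e)"
        unfolding v_def by (rule pact_skew) simp_all
      then show ?thesis by (simp only: pact_mult[OF e, symmetric] mult.commute)
    qed
    ultimately show ?thesis by simp
  qed
  have fv: "vdvd p (pact A f v)"
  proof -
    have "pdvd p m (f * m1)" using pdvd_cong[OF m1, of m] by simp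
    then have "pdvd p m (k * (f * m1))" by (rule pdvd_mult)
    then show ?thesis unfolding v_def using ann by (simp add: pact_mult[symmetric] mult.left_commute)
  qed
  have kv: "vdvd p (pact A (star k) v)"
  proof (subst vdvd_iff_scalar_prod[of _ n], simp, intro ballI)
    fix z :: "int vec" assume z: "z \<in> carrier_vec n"
    obtain g q where g: "pact A g e = d \<cdot>\<^sub>v z" and q: "[:p:] dvd g - m * q" using cyclicE[OF z] .
    \<comment> \<open>\<open>k * g\<close> is a multiple of \<open>\<chi>\<close> plus
      \<open>p\<close> times some \<open>r\<close>. So the pairing of \<open>d z\<close> with
      \<open>k(- A) v\<close> is \<open>p\<close> times an inner product that \<open>perp\<close>
      makes divisible by \<open>p\<close>.\<close>
    have "[:p:] dvd k * (g - m * q) - (\<chi> - k * m) * q" using q chi by (intro dvd_diff) simp_all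
    then obtain r where "k * (g - m * q) - (\<chi> - k * m) * q = [:p:] * r" by blast
    then have kg: "k * g = q * \<chi> + [:p:] * r" by (simp add: algebra_simps)
    have "d * (z \<bullet> pact A (star k) v) = pact A g e \<bullet> pact A (star k) v"
      using z by (simp add: g)
    also have "\<dots> = pact A (k * g) e \<bullet> v" by (simp add: pact_skew[of "pact A g e" v k] pact_mult)
    also have "pact A (k * g) e = pact A q (pact A \<chi> e) + p \<cdot>\<^sub>v pact A r e"
      unfolding kg by (simp add: pact_add pact_mult pact_smult)
    also have "pact A q (pact A \<chi> e) = 0\<^sub>v n"
      using pact_vec_smult[of "0\<^sub>v n" q 0] by (simp add: zero_smult_vec[of _ n])
    also have "(0\<^sub>v n + p \<cdot>\<^sub>v pact A r e) \<bullet> v = p * (v \<bullet> pact A r e)"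
      by (simp add: smult_scalar_prod_distrib[of _ n] comm_scalar_prod[of v n])
    finally have "d * (z \<bullet> pact A (star k) v) = p * (v \<bullet> pact A r e)" .
    moreover have "p * p dvd p * (v \<bullet> pact A r e)" using perp[of r] by simp
    ultimately show "p dvd z \<bullet> pact A (star k) v" using dvd_cancel_d by simp
  qed
  \<comment> \<open>The reflected Bezout identity is applied to \<open>v\<close>;
    \<open>f(- A) v\<close> vanishes modulo \<open>p\<close> because \<open>star f\<close> is a
    multiple of \<open>f\<close>.\<close>
  have "vdvd p (pact A 1 v)"
  proof (rule vdvd_pact_cong[OF v])
    show "[:p:] dvd 1 - (star u * star f + star w * star k)" using const_dvd_star[OF uw] by simp
    obtain h where h: "[:p:] dvd star f - f * h" using f_star by (elim pdvdE)
    have "vdvd p (pact A (star f) v)"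
      using vdvd_pact_cong[OF v h] vdvd_pact_mult[OF v fv, of h] by (simp only: mult.commute)
    then show "vdvd p (pact A (star u * star f + star w * star k) v)"
      by (intro vdvd_pact_add vdvd_pact_mult kv v)
  qed
  \<comment> \<open>So \<open>m\<close>, which is \<open>f * m1\<close> modulo \<open>p\<close>,
    divides \<open>k * m1\<close>; cancelling \<open>m1\<close> contradicts
    \<open>nk\<close>.\<close>
  then have "pdvd p m (k * m1)" using ann[of "k * m1"] by (simp add: v_def)
  then have "pdvd p (f * m1) (k * m1)" using m1 pdvd_cong_left by blast
  then obtain q where "[:p:] dvd k * m1 - f * m1 * q" by (elim pdvdE)
  then have "[:p:] dvd m1 * (k - f * q)" by (simp add: algebra_simps)
  then consider "[:p:] dvd m1" | "[:p:] dvd k - f * q" using prime_const_dvd_mult[OF p] by blast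
  then show False
  proof cases
    case 1
    then have "[:p:] dvd (m - f * m1) + f * m1" using m1 by (intro dvd_add) simp_all
    then have "[:p:] dvd m" by simp
    then show False using const_dvd_monic m p not_prime_unit by blast
  next
    case 2
    then show False using nk pdvdI by blast
  qed
qed

text \<open>By degrees, the product of \<open>F\<close> is \<open>k\<close> modulo \<open>p\<close>.
  Each member divides \<open>\<chi>\<close> and \<open>star a\<close>, hence
  \<open>c * star c\<close>; being irreducible and equal to its reflection up to a unit, it divides
  \<open>c\<close>.\<close>

lemma k_pdvd_of_self_conj_factors:
  assumes fin: "finite F"
    and F: "\<And>f. f \<in> F \<Longrightarrow> poly_mod.irreducible_m p f \<and> monic f \<and> poly_mod.Mp p f = f
      \<and> pdvd p f \<chi> \<and> pdvd p f a \<and> pdvd p f (star f)"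
    and deg: "degree (\<Prod>F) = degree k"
    and c: "pdvd p \<chi> (c * star c - star a * q)"
  shows "pdvd p k c"
proof -
  have "pdvd p (\<Prod>F) k"
    using F self_conj_factor_pdvd_k by (intro prod_irreducible_pdvd[OF p fin]) blast
  moreover have "monic (\<Prod>F)" using F by (intro monic_prod) blast
  ultimately have Fk: "[:p:] dvd k - \<Prod>F" using pdvd_monic_eq k deg by metis
  have "pdvd p f c" if f: "f \<in> F" for f
  proof -
    note F = F[OF f]
    have star_f: "pdvd p (star f) h \<Longrightarrow> pdvd p f h" for h using F pdvd_trans by blast
    have "pdvd p f (star a)" using F pdvd_star star_f by blast
    then have "pdvd p f (star a * q)" by (rule pdvd_mult2)
    moreover have "pdvd p f (c * star c - star a * q)" using F c pdvd_trans by blast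
    ultimately have "pdvd p f (c * star c)" using pdvd_add by fastforce
    then consider "pdvd p f c" | "pdvd p f (star c)" using irreducible_m_prime[OF p] F by blast
    then show ?thesis
    proof cases
      case 2
      then show ?thesis using pdvd_star[of p f "star c"] star_f by simp
    qed
  qed
  then have "pdvd p (\<Prod>F) c" using F by (intro prod_irreducible_pdvd[OF p fin]) blast
  moreover have "[:p:] dvd - (k - \<Prod>F)" using Fk by (simp only: dvd_minus_iff)
  then have "[:p:] dvd \<Prod>F - k" by simp
  ultimately show ?thesis using pdvd_cong_left by blast
qed

end

section \<open>The prime 2\<close>

lemma star_mod_2: "[:2:] dvd star f - f"
proof (induction f)
  case 0
  show ?case by simp
next
  case (pCons a f)
  have "star (pCons a f) - pCons a f = - ([:0, 1:] * (star f - f)) - [:2:] * ([:0, 1:] * f)"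
    by (simp add: pcompose_pCons poly_eq_iff coeff_pCons split: nat.split)
  then show ?case using pCons by (metis dvd_diff dvd_minus_iff dvd_mult dvd_triv_left)
qed

text \<open>In characteristic 2 the polynomials \<open>f\<close> with \<open>k\<^sup>2\<close> dividing \<open>f\<^sup>2\<close> form an ideal.\<close>

lemma pdvd_2_square_root:
  assumes k: "monic k" and c: "pdvd 2 (k * k) (c * c)"
  shows "pdvd 2 k c"
proof -
  let ?I = "{f. pdvd 2 (k * k) (f * f)}"
  have "poly_ideal ?I" unfolding poly_ideal_def
  proof (intro conjI ballI allI)
    fix f g assume "f \<in> ?I" "g \<in> ?I"
    then have "pdvd 2 (k * k) (f * f + g * g + [:2:] * (f * g))"
      by (intro pdvd_add pdvd_const[OF dvd_triv_left]) simp_all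
    also have "f * f + g * g + [:2:] * (f * g) = (f + g) * (f + g)"
    proof -
      have "[:2:] * (f * g) = f * g + f * g" by (simp add: numeral_poly)
      then show ?thesis by (simp add: algebra_simps)
    qed
    finally show "f + g \<in> ?I" by simp
  next
    fix f h assume "f \<in> ?I"
    then have "pdvd 2 (k * k) (f * f)" by simp
    then have "pdvd 2 (k * k) ((h * h) * (f * f))" by (rule pdvd_mult)
    then show "h * f \<in> ?I" by (simp add: algebra_simps)
  qed
  moreover have "[:2:] \<in> ?I" by (simp add: pdvd_const)
  moreover have kI: "k \<in> ?I" by simp
  moreover have "prime (2 :: int)" by simp
  ultimately obtain g where g: "monic g" "\<And>f. f \<in> ?I \<longleftrightarrow> pdvd 2 g f"
    using poly_ideal_principal[of 2 ?I k] k by metis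
  have gk: "pdvd 2 g k" using kI g by blast
  \<comment> \<open>The generator lies in its own ideal, so its degree is at least that of
    \<open>k\<close>; as it also divides \<open>k\<close>, the two agree modulo 2.\<close>
  have "pdvd 2 (k * k) (g * g)" using g(2)[of g] by simp
  then have "degree (k * k) \<le> degree (g * g)"
    using k g(1) by (intro pdvd_monic_degree_le[of _ 2]) (auto simp: monic_mult)
  moreover have "k \<noteq> 0" "g \<noteq> 0" using k g(1) by auto
  ultimately have "degree k \<le> degree g" by (simp add: degree_mult_eq)
  moreover have "degree g \<le> degree k" using pdvd_monic_degree_le[OF g(1) gk k] by simp
  ultimately have "[:2:] dvd k - g" using pdvd_monic_eq[OF g(1) k gk] by simp
  then have "[:2:] dvd - (k - g)" by (simp only: dvd_minus_iff)
  then have "[:2:] dvd g - k" by simp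
  moreover have "pdvd 2 g c" using g(2) c by blast
  ultimately show ?thesis using pdvd_cong_left by blast
qed

lemma even_sum_squares:
  fixes v :: "int vec"
  assumes "v \<in> carrier_vec n"
  shows "even (v \<bullet> v - vec n (\<lambda>_. 1) \<bullet> v)"
proof -
  have "v \<bullet> v - vec n (\<lambda>_. 1) \<bullet> v = (\<Sum>i = 0..<n. v $ i * v $ i - v $ i)"
    using assms by (simp add: scalar_prod_def sum_subtractf)
  also have "even \<dots>" by (intro dvd_sum) auto
  finally show ?thesis .
qed

context skew_matrix
begin

text \<open>For odd \<open>j\<close> the form is skew, so the value is its own negative. For
  \<open>j = 2 i\<close> it is, up to sign, the squared length of \<open>A^i u\<close>, which has
  the parity of the coordinate sum of \<open>A^i u\<close>, and induction applies to
  \<open>i\<close>.\<close>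

lemma even_walk:
  fixes j :: nat
  assumes j: "0 < j"
  defines "u \<equiv> vec n (\<lambda>_. 1)"
  shows "even (u \<bullet> pact A (monom 1 j) u)"
  using j
proof (induction j rule: less_induct)
  case (less j)
  have u [simp]: "u \<in> carrier_vec n" by (simp add: u_def)
  show ?case
  proof (cases "even j")
    case False
    have "star (monom 1 j) = - monom 1 j"
      using False by (intro poly_eqI) (auto simp: coeff_pcompose_linear)
    then have "u \<bullet> pact A (monom 1 j) u = u \<bullet> pact A (- monom 1 j) u"
      using pact_skew[of u u "monom 1 j"] comm_scalar_prod[of u n "pact A (monom 1 j) u"] by simp
    also have "\<dots> = - (u \<bullet> pact A (monom 1 j) u)"
      using pact_smult[of u "- 1" "monom 1 j"] by simp
    finally show ?thesis by simp
  next
    case True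
    then obtain i where i: "j = 2 * i" by blast
    let ?v = "pact A (monom 1 i) u"
    have "star (monom 1 i) = monom ((- 1) ^ i) i"
      by (intro poly_eqI) (auto simp: coeff_pcompose_linear)
    then have "star (monom 1 i) * monom 1 i = monom ((- 1) ^ i) j"
      by (simp add: i mult_monom flip: mult_2)
    then have "?v \<bullet> ?v = u \<bullet> pact A (monom ((- 1) ^ i) j) u"
      by (simp add: pact_skew pact_mult[symmetric])
    also have "monom ((- 1) ^ i) j = Polynomial.smult ((- 1) ^ i) (monom 1 j :: int poly)"
      by (simp add: smult_monom)
    also have "u \<bullet> pact A \<dots> u = (- 1) ^ i * (u \<bullet> pact A (monom 1 j) u)" by (simp add: pact_smult)
    finally have "even (?v \<bullet> ?v) \<longleftrightarrow> even (u \<bullet> pact A (monom 1 j) u)" by simp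
    moreover have "even (?v \<bullet> ?v - u \<bullet> ?v)" using even_sum_squares[of ?v n] by (simp add: u_def)
    moreover have "even (u \<bullet> ?v)" using less i by simp
    ultimately show ?thesis by simp
  qed
qed

text \<open>Positive powers contribute even numbers by \<open>even_walk\<close>; the constant term
  contributes \<open>coeff h 0\<close> times \<open>n\<close>.\<close>

lemma even_walk_poly:
  assumes h: "even n \<or> coeff h 0 = 0"
  defines "u \<equiv> vec n (\<lambda>_. 1)"
  shows "even (u \<bullet> pact A h u)"
proof -
  have u [simp]: "u \<in> carrier_vec n" by (simp add: u_def)
  have *: "even (u \<bullet> pact A (monom 1 j * f) u)" if "0 < j" for f j
    using that
  proof (induction f arbitrary: j)
    case 0
    then show ?case by simp
  next
    case (pCons a f)
    have "monom 1 j * pCons a f = Polynomial.smult a (monom 1 j) + monom 1 (Suc j) * f"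
      by (simp add: monom_Suc)
    then have "u \<bullet> pact A (monom 1 j * pCons a f) u =
        a * (u \<bullet> pact A (monom 1 j) u) + u \<bullet> pact A (monom 1 (Suc j) * f) u"
      by (simp only: pact_add[OF u] pact_smult[OF u])
        (simp add: scalar_prod_add_distrib[of _ n])
    moreover have "even (u \<bullet> pact A (monom 1 j) u)" using even_walk[OF pCons.prems] by (simp add: u_def)
    ultimately show ?case using pCons.IH[of "Suc j"] by simp
  qed
  obtain b f where hf: "h = pCons b f" by (cases h)
  have "h = [:b:] + monom 1 1 * f" by (simp add: hf monom_Suc monom_0)
  then have "u \<bullet> pact A h u = b * (u \<bullet> u) + u \<bullet> pact A (monom 1 1 * f) u"
    by (simp add: pact_add pact_const scalar_prod_add_distrib[of _ n])
  moreover have "u \<bullet> u = int n" by (simp add: u_def scalar_prod_def)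
  ultimately show ?thesis using *[of 1 f] h hf by auto
qed

end

text \<open>The degree of \<open>m\<close> is the rank of the walk matrix modulo 2, so
  \<open>deg_m\<close> is the rank condition of the theorem.\<close>

locale skew_walk_2 = skew_walk +
  assumes p_2: "p = 2" and ones: "e = vec n (\<lambda>_. 1)" and deg_m: "degree m = (n + 1) div 2"
begin

lemma k_pdvd_2:
  assumes c: "pdvd p \<chi> (c * star c - star a * q)"
  shows "pdvd p k c"
proof -
  \<comment> \<open>The degrees of \<open>m\<close> and \<open>k\<close> differ by
    \<open>n mod 2\<close>, so \<open>X * k\<close> is monic of the degree of \<open>m\<close>. Once
    it is seen to annihilate \<open>e\<close> modulo 2, it equals \<open>m\<close> modulo 2.\<close>
  define X :: "int poly" where "X = monom 1 (n mod 2)"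
  define f where "f = X * k"
  have X: "monic X" "degree X = n mod 2" by (simp_all add: X_def degree_monom_eq)
  have f: "monic f" "degree f = degree m"
  proof -
    have "X \<noteq> 0" "k \<noteq> 0" using X k by auto
    then have "degree f = n mod 2 + degree k" by (simp add: f_def degree_mult_eq X)
    also have "\<dots> = degree m" using deg_m deg_km by (cases "even n") (auto elim!: evenE oddE)
    finally show "degree f = degree m" .
    show "monic f" using X(1) k unfolding f_def by (rule monic_mult)
  qed
  have X0: "even n \<or> coeff X 0 = 0" by (auto simp: X_def)
  have walk: "even (e \<bullet> pact A h e)" if "even n \<or> coeff h 0 = 0" for h
    using even_walk_poly[OF that] by (simp add: ones)
  have "vdvd 2 (pact A f e)"
  proof (subst vdvd_iff_scalar_prod[of _ n], simp, intro ballI)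
    fix z :: "int vec" assume z: "z \<in> carrier_vec n"
    obtain g q where g: "pact A g e = d \<cdot>\<^sub>v z" and q: "[:2:] dvd g - m * q"
      using cyclicE[OF z] p_2 by metis
    obtain r where r: "g - m * q = [:2:] * r" using q by blast
    obtain s where s: "star f - f = [:2:] * s" using star_mod_2[of f] by blast
    obtain t where t: "\<chi> - k * m = [:2:] * t" using chi p_2 by blast
    \<comment> \<open>Modulo 2, \<open>star f * g\<close> is
      \<open>f * m * q = X * q * (k * m)\<close>, hence a multiple of \<open>\<chi>\<close>;
      \<open>h\<close> is half of the error, collected from \<open>s\<close>, \<open>r\<close> and
      \<open>t\<close>.\<close>
    define h where "h = s * m * q + star f * r - X * t * q"
    have g': "g = m * q + [:2:] * r" and s': "star f = f + [:2:] * s" and t': "k * m = \<chi> - [:2:] * t"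
      using r s t by (simp_all add: algebra_simps)
    have "star f * g = f * m * q + [:2:] * (s * m * q + star f * r)"
    proof -
      have "star f * g = star f * (m * q) + [:2:] * (star f * r)"
        unfolding g' by (simp only: distrib_left mult.left_commute)
      also have "star f * (m * q) = f * m * q + [:2:] * (s * m * q)"
        by (subst s') (simp only: distrib_right mult.assoc)
      finally show ?thesis by (simp only: distrib_left add.assoc)
    qed
    also have "f * m * q = X * q * (k * m)" by (simp add: f_def algebra_simps)
    also have "\<dots> = X * q * \<chi> - [:2:] * (X * t * q)"
      unfolding t' by (simp only: right_diff_distrib) (simp add: algebra_simps)
    also have "\<dots> + [:2:] * (s * m * q + star f * r) = X * q * \<chi> + [:2:] * h"
      unfolding h_def by (simp only: right_diff_distrib distrib_left)
    finally have sg: "star f * g = X * q * \<chi> + [:2:] * h" .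
    have "d * (z \<bullet> pact A f e) = pact A f e \<bullet> pact A g e"
      using z by (simp add: g comm_scalar_prod[of z n])
    also have "\<dots> = e \<bullet> pact A (star f * g) e" by (simp add: pact_skew pact_mult)
    also have "\<dots> = e \<bullet> (pact A (X * q) (pact A \<chi> e) + 2 \<cdot>\<^sub>v pact A h e)"
      unfolding sg by (simp add: pact_add pact_mult pact_smult)
    also have "pact A (X * q) (pact A \<chi> e) = 0\<^sub>v n"
      using pact_vec_smult[of "0\<^sub>v n" "X * q" 0] by (simp add: zero_smult_vec[of _ n])
    also have "e \<bullet> (0\<^sub>v n + 2 \<cdot>\<^sub>v pact A h e) = 2 * (e \<bullet> pact A h e)" by simp
    finally have eq: "d * (z \<bullet> pact A f e) = 2 * (e \<bullet> pact A h e)" .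
    \<comment> \<open>For odd \<open>n\<close> the walk number of the constant polynomial 1 is odd,
      so \<open>h\<close> must have no constant term; its three summands inherit this from
      \<open>s\<close>, \<open>star f\<close> and \<open>X\<close>.\<close>
    have "even n \<or> coeff h 0 = 0"
    proof (cases "even n")
      case False
      then have "coeff X 0 = 0" using X0 by simp
      then have "coeff f 0 = 0" by (simp add: f_def coeff_mult)
      then have "poly (star f) 0 = 0" by (simp add: poly_pcompose poly_0_coeff_0)
      then have sf: "coeff (star f) 0 = 0" by (simp add: poly_0_coeff_0)
      have "coeff (star f - f) 0 = 2 * coeff s 0" unfolding s by simp
      then have "coeff s 0 = 0" using sf \<open>coeff f 0 = 0\<close> by simp
      then show ?thesis using sf \<open>coeff X 0 = 0\<close> by (simp add: h_def coeff_mult)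
    qed simp
    from walk[OF this] have "2 * 2 dvd 2 * (e \<bullet> pact A h e)" by (rule mult_dvd_mono[OF dvd_refl])
    then show "2 dvd z \<bullet> pact A f e" using dvd_cancel_d[of "z \<bullet> pact A f e"] eq p_2 by simp
  qed
  then have "pdvd 2 m f" using ann p_2 by blast
  then have fm: "[:2:] dvd f - m" using pdvd_monic_eq[OF m f(1)] f(2) by simp
  have chi_X: "[:2:] dvd \<chi> - X * (k * k)"
  proof -
    have "[:2:] dvd (\<chi> - k * m) - k * (f - m)" 
      using chi p_2 by (intro dvd_diff[OF _ dvd_mult[OF fm]]) simp
    then show ?thesis by (simp add: f_def algebra_simps)
  qed
  \<comment> \<open>The parity of walks enters a second time, through
    \<open>annihilator_iff\<close>. With \<open>\<chi>\<close> equal to \<open>X * (k * k)\<close>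
    modulo 2, cancelling \<open>X\<close> shows that \<open>k * k\<close> divides
    \<open>a\<close>.\<close>
  have "pdvd 2 \<chi> (X * a)"
  proof -
    have "2 dvd e \<bullet> pact A (g * X) e" for g using X0 by (intro walk) (auto simp: coeff_mult)
    then show ?thesis using annihilator_iff[OF e e n, of 2 X] by blast
  qed
  then have "pdvd 2 (X * (k * k)) (X * a)" using chi_X pdvd_cong_left by blast
  then obtain r where "[:2:] dvd X * a - X * (k * k) * r" by (elim pdvdE)
  then have "[:2:] dvd X * (a - k * k * r)" by (simp add: algebra_simps)
  moreover have "\<not> [:2:] dvd X" using const_dvd_monic[of 2 X] X by auto
  ultimately have "[:2:] dvd a - k * k * r" 
    using prime_const_dvd_mult[of 2 X "a - k * k * r"] by simp
  then have ka: "pdvd 2 (k * k) a" by (rule pdvdI)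
  have kchi: "pdvd 2 (k * k) \<chi>"
    using pdvd_cong[OF chi_X] pdvd_mult[of 2 "k * k" "k * k" X] by simp
  have "pdvd 2 (k * k) (star a)" using pdvd_cong[OF star_mod_2[of a]] ka by blast
  then have "pdvd 2 (k * k) (star a * q)" by (rule pdvd_mult2)
  moreover have "pdvd 2 (k * k) (c * star c - star a * q)" using kchi c p_2 pdvd_trans by blast
  ultimately have "pdvd 2 (k * k) (c * star c)" using pdvd_add by fastforce
  moreover have "[:2:] dvd c * star c - c * c"
    using star_mod_2[of c] by (metis dvd_mult right_diff_distrib)
  ultimately have "pdvd 2 (k * k) (c * c)" using pdvd_cong by blast
  then show ?thesis using pdvd_2_square_root[OF k] p_2 by blast
qed

end

section \<open>Rank and nullity of walk matrices modulo a prime\<close>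

text \<open>Pigeonhole: there are more coefficient vectors with entries from \<open>0\<close> to
  \<open>p - 1\<close> than possible residues of the \<open>K\<close> sums, so two vectors collide
  and their difference is a solution.\<close>

lemma homogeneous_system_mod:
  fixes p :: int and C :: "nat \<Rightarrow> nat \<Rightarrow> int"
  assumes p: "1 < p" and KL: "K < L"
  obtains c where "\<exists>j<L. \<not> p dvd c j" "\<And>k. k < K \<Longrightarrow> p dvd (\<Sum>j<L. c j * C j k)"
proof -
  define D where "D = {..<L} \<rightarrow>\<^sub>E {0..<p}"
  define R where "R = {..<K} \<rightarrow>\<^sub>E {0..<p}"
  define \<Phi> where "\<Phi> = (\<lambda>c. \<lambda>k\<in>{..<K}. (\<Sum>j<L. c j * C j k) mod p)"
  have "\<Phi> c \<in> R" for c unfolding \<Phi>_def R_def using p by (intro restrict_PiE_iff[THEN iffD2]) simp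
  then have "\<Phi> ` D \<subseteq> R" by blast
  moreover have "finite R" unfolding R_def by (rule finite_PiE) simp_all
  ultimately have "card (\<Phi> ` D) \<le> card R" by (rule card_mono[rotated])
  also have "card R = nat p ^ K" unfolding R_def by (simp add: card_PiE)
  also have "nat p ^ K < nat p ^ L" using p KL by (intro power_strict_increasing) auto
  also have "nat p ^ L = card D" unfolding D_def by (simp add: card_PiE)
  finally have "\<not> inj_on \<Phi> D" by (rule pigeonhole)
  then obtain c c' where c: "c \<in> D" "c' \<in> D" "c \<noteq> c'" "\<Phi> c = \<Phi> c'" unfolding inj_on_def by blast
  have "\<exists>j<L. c j \<noteq> c' j"
  proof (rule ccontr)
    assume "\<not> (\<exists>j<L. c j \<noteq> c' j)"
    then have "c = c'" by (intro PiE_ext[OF c(1,2)[unfolded D_def]]) simp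
    with c(3) show False by simp
  qed
  then obtain j where j: "j < L" "c j \<noteq> c' j" by blast
  have "\<not> p dvd c j - c' j"
  proof
    assume "p dvd c j - c' j"
    then have "c j mod p = c' j mod p" by (simp add: mod_eq_dvd_iff)
    moreover have "c j \<in> {0..<p}" "c' j \<in> {0..<p}" 
      using PiE_mem[OF c(1)[unfolded D_def], of j] PiE_mem[OF c(2)[unfolded D_def], of j] j(1) by simp_all
    ultimately show False using j(2) by simp
  qed
  moreover have "p dvd (\<Sum>j<L. (c j - c' j) * C j k)" if "k < K" for k
  proof -
    have "\<Phi> c k = \<Phi> c' k" using c(4) by simp
    then have "(\<Sum>j<L. c j * C j k) mod p = (\<Sum>j<L. c' j * C j k) mod p" using that by (simp add: \<Phi>_def)
    then show ?thesis by (simp add: mod_eq_dvd_iff left_diff_distrib sum_subtractf)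
  qed
  ultimately show ?thesis using that[of "\<lambda>j. c j - c' j"] j(1) by blast
qed

text \<open>A longer list of vectors in the span satisfies a nontrivial relation, since its
  coordinates give a homogeneous system with fewer equations than unknowns.\<close>

lemma dim_mod_eq_length:
  assumes p: "prime p" and bV: "set bs \<subseteq> V" and ind: "lin_indep_mod p n bs"
    and span: "\<And>v. v \<in> V \<Longrightarrow> \<exists>c. \<forall>i<n. p dvd v $ i - (\<Sum>k<length bs. c k * (bs ! k) $ i)"
  shows "dim_mod p n V = length bs"
proof -
  have p1: "1 < p" using p prime_gt_1_int by blast
  have le: "length vs \<le> length bs" if vs: "set vs \<subseteq> V" "lin_indep_mod p n vs" for vs
  proof (rule ccontr)
    assume "\<not> length vs \<le> length bs"
    then have lt: "length bs < length vs" by simp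
    have "\<forall>j\<in>{..<length vs}. \<exists>c. \<forall>i<n. p dvd (vs ! j) $ i - (\<Sum>k<length bs. c k * (bs ! k) $ i)"
      using vs(1) by (intro ballI span) (auto simp: set_conv_nth)
    from bchoice[OF this] obtain C where C: "\<forall>j\<in>{..<length vs}. \<forall>i<n.
        p dvd (vs ! j) $ i - (\<Sum>k<length bs. C j k * (bs ! k) $ i)" by blast
    obtain c where c: "\<exists>j<length vs. \<not> p dvd c j"
      "\<And>k. k < length bs \<Longrightarrow> p dvd (\<Sum>j<length vs. c j * C j k)"
      by (rule homogeneous_system_mod[OF p1 lt, of C]) blast
    have "p dvd (\<Sum>j<length vs. c j * (vs ! j) $ i)" if i: "i < n" for i
    proof -
      have "p dvd (\<Sum>j<length vs. c j * ((vs ! j) $ i - (\<Sum>k<length bs. C j k * (bs ! k) $ i)))"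
        using C i by (intro dvd_sum) simp
      also have "\<dots> = (\<Sum>j<length vs. c j * (vs ! j) $ i)
          - (\<Sum>k<length bs. (\<Sum>j<length vs. c j * C j k) * (bs ! k) $ i)"
        by (simp add: right_diff_distrib sum_subtractf sum_distrib_left sum_distrib_right mult.assoc)
          (rule sum.swap)
      finally have *: "p dvd \<dots>" .
      have "p dvd (\<Sum>k<length bs. (\<Sum>j<length vs. c j * C j k) * (bs ! k) $ i)"
        using c(2) by (intro dvd_sum) simp
      from dvd_add[OF * this] show ?thesis by simp
    qed
    then show False using vs(2) c(1) unfolding lin_indep_mod_def by blast
  qed
  \<comment> \<open>\<open>Max\<close> in \<open>dim_mod\<close> is meaningful only for a finite set
    of lengths.\<close>
  have fin: "finite {length vs | vs. set vs \<subseteq> V \<and> lin_indep_mod p n vs}"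
  proof (rule finite_subset)
    show "{length vs | vs. set vs \<subseteq> V \<and> lin_indep_mod p n vs} \<subseteq> {..length bs}" using le by blast
  qed simp
  show ?thesis unfolding dim_mod_def
  proof (rule Max_eqI[OF fin])
    show "y \<le> length bs" if "y \<in> {length vs | vs. set vs \<subseteq> V \<and> lin_indep_mod p n vs}" for y
      using that le by blast
    show "length bs \<in> {length vs | vs. set vs \<subseteq> V \<and> lin_indep_mod p n vs}" using bV ind by blast
  qed
qed

text \<open>Reads a coordinate vector as a polynomial of degree below \<open>n\<close>; by
  \<open>walk_mult\<close>, the walk matrix then acts as evaluation at \<open>A\<close> followed by
  application to \<open>e\<close>.\<close>

definition vpoly :: "nat \<Rightarrow> int vec \<Rightarrow> int poly" where
  "vpoly n x = (\<Sum>k<n. monom (x $ k) k)"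

lemma coeff_vpoly: "coeff (vpoly n x) k = (if k < n then x $ k else 0)"
  by (simp add: vpoly_def coeff_sum coeff_monom)

lemma degree_vpoly: "0 < n \<Longrightarrow> degree (vpoly n x) < n"
  by (intro degree_lessI) (auto simp: coeff_vpoly)

lemma vpoly_coeff: "degree f < n \<Longrightarrow> vpoly n (vec n (coeff f)) = f"
  by (intro poly_eqI) (auto simp: coeff_vpoly coeff_eq_0)

context int_matrix
begin

abbreviation walk :: "int vec \<Rightarrow> int mat" where
  "walk e \<equiv> mat_of_cols n (map (\<lambda>k. (A ^\<^sub>m k) *\<^sub>v e) [0..<n])"

lemma walk_carrier [simp]: "walk e \<in> carrier_mat n n"
  using mat_of_cols_carrier(1)[of n "map (\<lambda>k. (A ^\<^sub>m k) *\<^sub>v e) [0..<n]"] by simp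

lemma pact_sum_monom:
  assumes e: "e \<in> carrier_vec n" and i: "i < n"
  shows "pact A (\<Sum>k<N. monom (c k) k) e $ i = (\<Sum>k<N. c k * (A ^\<^sub>m k *\<^sub>v e) $ i)"
proof (induction N)
  case 0
  then show ?case using i by simp
next
  case (Suc N)
  have "monom (c N) N = Polynomial.smult (c N) (monom 1 N)" by (simp add: smult_monom)
  then show ?case using Suc e i by (simp add: pact_add pact_smult pact_monom)
qed

lemma walk_mult:
  assumes e: "e \<in> carrier_vec n" and x: "x \<in> carrier_vec n"
  shows "walk e *\<^sub>v x = pact A (vpoly n x) e"
proof (intro eq_vecI)
  fix i assume "i < dim_vec (pact A (vpoly n x) e)"
  then have i: "i < n" using e by simp
  have "(walk e *\<^sub>v x) $ i = (\<Sum>k<n. (A ^\<^sub>m k *\<^sub>v e) $ i * x $ k)"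
    using i x by (simp add: scalar_prod_def mat_of_cols_def lessThan_atLeast0)
  then show "(walk e *\<^sub>v x) $ i = pact A (vpoly n x) e $ i"
    using e i by (simp add: vpoly_def pact_sum_monom mult.commute)
qed (use e in simp)

context
  fixes p :: int and e :: "int vec" and m k :: "int poly"
  assumes p: "prime p" and e [simp]: "e \<in> carrier_vec n"
    and m: "monic m" and deg: "degree k + degree m = n"
    and ann: "\<And>f. vdvd p (pact A f e) \<longleftrightarrow> pdvd p m f"
begin

text \<open>The first \<open>degree m\<close> walk vectors form a basis modulo \<open>p\<close>:
  they are independent because \<open>m\<close> generates the annihilator, and they span by division
  with remainder by \<open>m\<close>.\<close>

lemma rank_mod_walk: "rank_mod p (walk e) = degree m"
proof -
  let ?bs = "map (\<lambda>k. (A ^\<^sub>m k) *\<^sub>v e) [0..<degree m]"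
  have "dim_mod p n {walk e *\<^sub>v x | x. x \<in> carrier_vec n} = length ?bs"
  proof (rule dim_mod_eq_length[OF p])
    show "set ?bs \<subseteq> {walk e *\<^sub>v x | x. x \<in> carrier_vec n}"
    proof
      fix v assume "v \<in> set ?bs"
      then obtain j where j: "j < degree m" "v = A ^\<^sub>m j *\<^sub>v e" by auto
      have "vpoly n (unit_vec n j) = monom 1 j"
        using j(1) deg by (intro poly_eqI) (auto simp: coeff_vpoly)
      then have "v = walk e *\<^sub>v unit_vec n j" using j(2) by (simp add: walk_mult pact_monom)
      then show "v \<in> {walk e *\<^sub>v x | x. x \<in> carrier_vec n}" by auto
    qed
    show "lin_indep_mod p n ?bs"
      unfolding lin_indep_mod_def
    proof (intro allI impI)
      fix c :: "nat \<Rightarrow> int" and j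
      assume *: "\<forall>i<n. p dvd (\<Sum>k<length ?bs. c k * (?bs ! k) $ i)" and j: "j < length ?bs"
      define f where "f = (\<Sum>k<degree m. monom (c k) k)"
      have "vdvd p (pact A f e)"
        unfolding vdvd_def f_def using * by (auto simp: pact_sum_monom)
      then have "pdvd p m f" using ann by blast
      moreover have "degree f < degree m"
        using j by (intro degree_lessI) (auto simp: f_def coeff_sum coeff_monom)
      ultimately have "[:p:] dvd f" using pdvd_monic_small[OF m] by blast
      then have "p dvd coeff f j" unfolding const_poly_dvd_iff by blast
      then show "p dvd c j" using j by (simp add: f_def coeff_sum coeff_monom)
    qed
    fix v assume "v \<in> {walk e *\<^sub>v x | x. x \<in> carrier_vec n}"
    then obtain f where v: "v = pact A f e" by (auto simp: walk_mult)
    obtain q r where f: "f = m * q + r" "r = 0 \<or> degree r < degree m" using monic_div[OF m] .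
    have r: "r = (\<Sum>k<degree m. monom (coeff r k) k)"
      using f(2) by (intro poly_eqI) (auto simp: coeff_sum coeff_monom coeff_eq_0)
    have "vdvd p (pact A (m * q) e)" using ann by (simp add: pdvd_mult2)
    moreover have "v = pact A (m * q) e + pact A r e" by (simp add: v f(1) pact_add)
    ultimately have "p dvd v $ i - pact A r e $ i" if "i < n" for i
      using that by (simp add: vdvd_def)
    moreover have "pact A r e $ i = (\<Sum>k<length ?bs. coeff r k * (?bs ! k) $ i)" if "i < n" for i
      using that arg_cong[OF r, of "\<lambda>r. pact A r e $ i"] by (simp add: pact_sum_monom)
    ultimately show "\<exists>c. \<forall>i<n. p dvd v $ i - (\<Sum>k<length ?bs. c k * (?bs ! k) $ i)"
      by (intro exI[of _ "coeff r"]) simp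
  qed
  then show ?thesis by (simp add: rank_mod_def)
qed

text \<open>The kernel modulo \<open>p\<close> consists of the multiples of \<open>m\<close> of
  degree below \<open>n\<close>; a basis is given by \<open>m\<close> times the monomials of degree
  below that of \<open>k\<close>.\<close>

lemma nullity_mod_walk:
  assumes n: "0 < n"
  shows "nullity_mod p (walk e) = degree k"
proof -
  let ?V = "{x \<in> carrier_vec n. \<forall>i<n. p dvd (walk e *\<^sub>v x) $ i}"
  let ?bs = "map (\<lambda>j. vec n (coeff (monom 1 j * m))) [0..<degree k]"
  have V: "x \<in> ?V \<longleftrightarrow> x \<in> carrier_vec n \<and> pdvd p m (vpoly n x)" for x
    using ann[of "vpoly n x"] by (auto simp: walk_mult vdvd_def simp del: index_mult_mat_vec)
  have sum: "(\<Sum>j<degree k. c j * coeff (monom 1 j * m) i) = coeff ((\<Sum>j<degree k. monom (c j) j) * m) i" for c i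
    by (auto simp: sum_distrib_right coeff_sum coeff_monom_mult intro!: sum.cong)
  have "dim_mod p n ?V = length ?bs"
  proof (rule dim_mod_eq_length[OF p])
    show "set ?bs \<subseteq> ?V"
    proof
      fix v assume "v \<in> set ?bs"
      then obtain j where j: "j < degree k" "v = vec n (coeff (monom 1 j * m))" by auto
      have "degree (monom 1 j * m) \<le> j + degree m"
        using degree_mult_le[of "monom 1 j" m] by (simp add: degree_monom_eq)
      then have "degree (monom 1 j * m) < n" using j(1) deg by simp
      then have "vpoly n v = monom 1 j * m" unfolding j(2) by (rule vpoly_coeff)
      moreover have "v \<in> carrier_vec n" by (simp add: j(2))
      ultimately show "v \<in> ?V" unfolding V by (simp add: pdvd_mult)
    qed
    show "lin_indep_mod p n ?bs"
      unfolding lin_indep_mod_def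
    proof (intro allI impI)
      fix c :: "nat \<Rightarrow> int" and j
      assume *: "\<forall>i<n. p dvd (\<Sum>k<length ?bs. c k * (?bs ! k) $ i)" and j: "j < length ?bs"
      define g where "g = (\<Sum>j<degree k. monom (c j) j)"
      have "degree g < degree k"
        using j by (intro degree_lessI) (auto simp: g_def coeff_sum coeff_monom)
      then have "degree (g * m) < n" using degree_mult_le[of g m] deg by simp
      then have large: "coeff (g * m) i = 0" if "\<not> i < n" for i
        using that by (intro coeff_eq_0) simp
      have small: "p dvd coeff (g * m) i" if "i < n" for i
      proof -
        have "(\<Sum>k<length ?bs. c k * (?bs ! k) $ i) = (\<Sum>j<degree k. c j * coeff (monom 1 j * m) i)"
          using that by simp
        also have "\<dots> = coeff (g * m) i" unfolding g_def by (rule sum)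
        finally have eq: "(\<Sum>k<length ?bs. c k * (?bs ! k) $ i) = coeff (g * m) i" .
        show ?thesis using *[rule_format, OF that] unfolding eq .
      qed
      have "p dvd coeff (g * m) i" for i using large[of i] small[of i] by (cases "i < n") simp_all
      then have "[:p:] dvd g * m" by (simp add: const_poly_dvd_iff)
      then have "[:p:] dvd g" using prime_const_dvd_mult[OF p] const_dvd_monic m p not_prime_unit by blast
      then have "p dvd coeff g j" unfolding const_poly_dvd_iff by blast
      then show "p dvd c j" using j by (simp add: g_def coeff_sum coeff_monom)
    qed
    fix x assume "x \<in> ?V"
    then have x: "x \<in> carrier_vec n" "pdvd p m (vpoly n x)" using V by auto
    obtain q r where qr: "vpoly n x = m * q + r" "r = 0 \<or> degree r < degree m" using monic_div[OF m] .
    have "pdvd p m (vpoly n x - m * q)" by (intro pdvd_diff x dvd_imp_pdvd) simp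
    then have r: "[:p:] dvd r" using qr pdvd_monic_small[OF m, of p r] by (cases "r = 0") auto
    have q: "q = (\<Sum>j<degree k. monom (coeff q j) j)"
    proof (cases "q = 0")
      case False
      have "degree r < n" using qr(2) deg n by auto
      then have "degree (vpoly n x - r) < n" using degree_vpoly[OF n] degree_diff_less by blast
      moreover have "degree (m * q) = degree m + degree q" using False m by (intro degree_mult_eq) auto
      ultimately have "degree q < degree k" using qr(1) deg by simp
      then show ?thesis by (intro poly_eqI) (auto simp: coeff_sum coeff_monom coeff_eq_0)
    qed simp
    have "x $ i - (\<Sum>k<length ?bs. coeff q k * (?bs ! k) $ i) = coeff r i" if i: "i < n" for i
    proof -
      have "(\<Sum>k<length ?bs. coeff q k * (?bs ! k) $ i) = coeff (q * m) i"
        using i arg_cong[OF q, of "\<lambda>q. coeff (q * m) i"] by (simp add: sum[symmetric])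
      moreover have "x $ i = coeff (m * q + r) i" using i by (simp add: coeff_vpoly flip: qr(1))
      ultimately show ?thesis by (simp add: mult.commute)
    qed
    then show "\<exists>c. \<forall>i<n. p dvd x $ i - (\<Sum>k<length ?bs. c k * (?bs ! k) $ i)"
      using r by (intro exI[of _ "coeff q"]) (simp add: const_poly_dvd_iff)
  qed
  then show ?thesis by (simp add: nullity_mod_def)
qed

end

end

section \<open>Smith normal form\<close>

lemma index_mult_mat_sum:
  fixes A B :: "int mat"
  assumes "A \<in> carrier_mat n m" "B \<in> carrier_mat m l" "i < n" "j < l"
  shows "(A * B) $$ (i, j) = (\<Sum>k = 0..<m. A $$ (i, k) * B $$ (k, j))"
  using assms by (auto simp: scalar_prod_def intro!: sum.cong)

lemma det_mult_dvd_1: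
  fixes P Q :: "int mat"
  assumes "P \<in> carrier_mat n n" "Q \<in> carrier_mat n n" "det P dvd 1" "det Q dvd 1"
  shows "det (P * Q) dvd 1"
  unfolding det_mult[OF assms(1,2)] using mult_dvd_mono[OF assms(3,4)] by (simp only: mult_1)

lemma invertible_int_mat_iff:
  fixes P :: "int mat"
  assumes P: "P \<in> carrier_mat n n"
  shows "invertible_mat P \<longleftrightarrow> det P dvd 1"
proof
  assume "invertible_mat P"
  then obtain R where PR: "P * R = 1\<^sub>m (dim_row P)" and RP: "R * P = 1\<^sub>m (dim_row R)"
    unfolding invertible_mat_def inverts_mat_def by blast
  have "dim_col R = n" using arg_cong[OF PR, of dim_col] P by simp
  moreover have "dim_row R = n" using arg_cong[OF RP, of dim_col] P by simp
  ultimately have "R \<in> carrier_mat n n" by auto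
  then have "det P * det R = 1" using PR P by (metis carrier_matD(1) det_mult det_one)
  then show "det P dvd 1" by (metis dvd_triv_left)
next
  assume "det P dvd 1"
  then obtain u where u: "u * det P = 1" by (metis dvdE mult.commute)
  let ?R = "u \<cdot>\<^sub>m adj_mat P"
  note adj = adj_mat[OF P]
  have uI: "u \<cdot>\<^sub>m (det P \<cdot>\<^sub>m 1\<^sub>m n) = 1\<^sub>m n" using u by (intro eq_matI) auto
  have "P * ?R = 1\<^sub>m n" using mult_smult_distrib[OF P adj(1), of u] adj(2) uI by simp
  moreover have "?R * P = 1\<^sub>m n" using mult_smult_assoc_mat[OF adj(1) P, of u] adj(3) uI by simp
  ultimately show "invertible_mat P"
    unfolding invertible_mat_def inverts_mat_def using P adj(1) by (intro conjI exI[of _ ?R]) auto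
qed

lemma invertible_int_matE:
  fixes P :: "int mat"
  assumes "invertible_mat P" "P \<in> carrier_mat n n"
  obtains R where "R \<in> carrier_mat n n" "P * R = 1\<^sub>m n" "R * P = 1\<^sub>m n" "det R dvd 1"
proof -
  obtain R where PR: "P * R = 1\<^sub>m (dim_row P)" and RP: "R * P = 1\<^sub>m (dim_row R)"
    using assms(1) unfolding invertible_mat_def inverts_mat_def by blast
  have "dim_col R = n" using arg_cong[OF PR, of dim_col] assms(2) by simp
  moreover have "dim_row R = n" using arg_cong[OF RP, of dim_col] assms(2) by simp
  ultimately have R: "R \<in> carrier_mat n n" by auto
  then have "det P * det R = 1" using PR assms(2) by (metis carrier_matD(1) det_mult det_one)
  then have "det R dvd 1" by (metis dvd_triv_right)
  then show ?thesis using that[OF R] PR RP R assms(2) by auto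
qed

text \<open>Integral equivalence, with unimodularity expressed by determinants so that it passes to
  products at once.\<close>

definition equiv_mat :: "nat \<Rightarrow> int mat \<Rightarrow> int mat \<Rightarrow> bool" where
  "equiv_mat n M N \<longleftrightarrow> (\<exists>P\<in>carrier_mat n n. \<exists>Q\<in>carrier_mat n n.
     det P dvd 1 \<and> det Q dvd 1 \<and> N = P * M * Q)"

lemma equiv_mat_refl: "M \<in> carrier_mat n n \<Longrightarrow> equiv_mat n M M"
  unfolding equiv_mat_def by (intro bexI[of _ "1\<^sub>m n"]) auto

lemma equiv_mat_carrier: "M \<in> carrier_mat n n \<Longrightarrow> equiv_mat n M N \<Longrightarrow> N \<in> carrier_mat n n"
  unfolding equiv_mat_def by auto

lemma equiv_mat_left:
  assumes M: "M \<in> carrier_mat n n" and MN: "equiv_mat n M N"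
    and P: "P \<in> carrier_mat n n" "det P dvd 1"
  shows "equiv_mat n M (P * N)"
proof -
  obtain P' Q where Q: "P' \<in> carrier_mat n n" "Q \<in> carrier_mat n n" "det P' dvd 1" "det Q dvd 1"
    "N = P' * M * Q" using MN unfolding equiv_mat_def by blast
  have "P * N = (P * P') * M * Q"
    unfolding Q(5) using M P(1) Q(1,2) by (simp add: assoc_mult_mat[of _ n n _ n _ n])
  moreover have "det (P * P') dvd 1" using P Q(1,3) by (intro det_mult_dvd_1)
  ultimately show ?thesis
    unfolding equiv_mat_def using P(1) Q by (intro bexI[of _ "P * P'"] bexI[of _ Q]) auto
qed

lemma equiv_mat_right:
  assumes M: "M \<in> carrier_mat n n" and MN: "equiv_mat n M N"
    and P: "P \<in> carrier_mat n n" "det P dvd 1"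
  shows "equiv_mat n M (N * P)"
proof -
  obtain P' Q where Q: "P' \<in> carrier_mat n n" "Q \<in> carrier_mat n n" "det P' dvd 1" "det Q dvd 1"
    "N = P' * M * Q" using MN unfolding equiv_mat_def by blast
  have "N * P = P' * M * (Q * P)"
    unfolding Q(5) using M P(1) Q(1,2) by (simp add: assoc_mult_mat[of _ n n _ n _ n])
  moreover have "det (Q * P) dvd 1" using P Q(2,4) by (intro det_mult_dvd_1)
  ultimately show ?thesis
    unfolding equiv_mat_def using P(1) Q by (intro bexI[of _ P'] bexI[of _ "Q * P"]) auto
qed

lemma equiv_mat_uminus:
  assumes M: "M \<in> carrier_mat n n" and MN: "equiv_mat n M N"
  shows "equiv_mat n M (- N)"
proof -
  have N: "N \<in> carrier_mat n n" using equiv_mat_carrier[OF M MN] .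
  have "det ((- 1 :: int) \<cdot>\<^sub>m 1\<^sub>m n) = (- 1) ^ n" unfolding det_smult by simp
  also have "(- 1 :: int) ^ n dvd 1" by (cases "even n") auto
  finally have "equiv_mat n M (((- 1) \<cdot>\<^sub>m 1\<^sub>m n) * N)" by (intro equiv_mat_left[OF M MN]) auto
  moreover have "((- 1) \<cdot>\<^sub>m 1\<^sub>m n) * N = - N"
    using N by (simp add: mult_smult_assoc_mat[of _ n n]) (intro eq_matI, auto)
  ultimately show ?thesis by simp
qed

lemma equiv_mat_addrow:
  assumes "M \<in> carrier_mat n n" "equiv_mat n M N" "k \<noteq> l" "l < n"
  shows "equiv_mat n M (addrow a k l N)"
  using equiv_mat_left[OF assms(1,2) addrow_mat_carrier, of a k l] assms equiv_mat_carrier[OF assms(1,2)]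
  by (simp add: addrow_mat[of N n n] det_addrow_mat)

lemma equiv_mat_addcol:
  assumes "M \<in> carrier_mat n n" "equiv_mat n M N" "k \<noteq> l" "k < n"
  shows "equiv_mat n M (addcol a l k N)"
  using equiv_mat_right[OF assms(1,2) addrow_mat_carrier, of a k l] assms equiv_mat_carrier[OF assms(1,2)]
  by (simp add: addcol_mat[of N n n] det_addrow_mat)

lemma det_swaprows_mat_unit: "k < n \<Longrightarrow> l < n \<Longrightarrow> det (swaprows_mat n k l :: int mat) dvd 1"
proof (cases "k = l")
  case True
  then have "swaprows_mat n k l = (1\<^sub>m n :: int mat)" by (intro eq_matI) auto
  then show ?thesis by simp
qed (simp add: det_swaprows_mat)

lemma equiv_mat_move_to_front:
  assumes M: "M \<in> carrier_mat n n" and MN: "equiv_mat n M N" and ij: "i < n" "j < n"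
  obtains N' where "equiv_mat n M N'" "N' $$ (0, 0) = N $$ (i, j)"
proof -
  have n: "0 < n" using ij by simp
  have N: "N \<in> carrier_mat n n" using equiv_mat_carrier[OF M MN] .
  let ?N = "swaprows_mat n 0 i * N"
  have eq: "equiv_mat n M (?N * swaprows_mat n 0 j)"
    using n ij by (intro equiv_mat_right equiv_mat_left M MN det_swaprows_mat_unit) auto
  have "?N * swaprows_mat n 0 j = swapcols 0 j (swaprows 0 i N)"
    using swaprows_mat[OF N n ij(1)] swapcols_mat[OF mult_carrier_mat[OF swaprows_mat_carrier N] n ij(2)] by simp
  moreover have "swapcols 0 j (swaprows 0 i N) $$ (0, 0) = N $$ (i, j)" using N n ij by auto
  ultimately show ?thesis using that eq by metis
qed

text \<open>One stage of the Smith algorithm, with minimality instead of iteration: \<open>d\<close>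
  is the least positive entry of any matrix equivalent to \<open>M\<close>.\<close>

lemma smith_step:
  fixes M :: "int mat"
  assumes M: "M \<in> carrier_mat (Suc n) (Suc n)" and det: "det M \<noteq> 0"
  obtains d E where "0 < d" "E \<in> carrier_mat n n"
    "equiv_mat (Suc n) M (four_block_mat (mat 1 1 (\<lambda>_. d)) (0\<^sub>m 1 n) (0\<^sub>m n 1) E)"
    "\<And>i j. i < n \<Longrightarrow> j < n \<Longrightarrow> d dvd E $$ (i, j)"
proof -
  let ?N = "Suc n"
  let ?S = "\<lambda>k. 0 < k \<and> (\<exists>N i j. equiv_mat ?N M N \<and> i < ?N \<and> j < ?N \<and> N $$ (i, j) = int k)"
  have "\<exists>k. ?S k"
  proof -
    have "M \<noteq> 0\<^sub>m ?N ?N" using det by auto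
    then obtain i j where ij: "i < ?N" "j < ?N" "M $$ (i, j) \<noteq> 0" using M by (auto simp: mat_eq_iff)
    show ?thesis
    proof (cases "M $$ (i, j) > 0")
      case True
      then show ?thesis using ij equiv_mat_refl[OF M] by (intro exI[of _ "nat (M $$ (i, j))"]) auto
    next
      case False
      then have "(- M) $$ (i, j) = int (nat (- M $$ (i, j)))" "0 < nat (- M $$ (i, j))" using ij M by auto
      then show ?thesis using ij equiv_mat_uminus[OF M equiv_mat_refl[OF M]] by blast
    qed
  qed
  define k where "k = (LEAST k. ?S k)"
  have "?S k" unfolding k_def by (rule LeastI_ex) fact
  then obtain N0 i0 j0 where N0: "0 < k" "equiv_mat ?N M N0" "i0 < ?N" "j0 < ?N" "N0 $$ (i0, j0) = int k" by blast
  define d where "d = int k"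
  have d: "0 < d" using N0(1) by (simp add: d_def)
  have least: "d \<le> N $$ (i, j)" if "equiv_mat ?N M N" "i < ?N" "j < ?N" "0 < N $$ (i, j)" for N i j
  proof -
    have "k \<le> nat (N $$ (i, j))" unfolding k_def by (rule Least_le) (use that in auto)
    then show ?thesis using that(4) by (simp add: d_def)
  qed
  have rows: "d dvd N $$ (i, 0)" if N: "equiv_mat ?N M N" "N $$ (0, 0) = d" and i: "i < ?N" for N i
  proof (cases "i = 0")
    case False
    let ?q = "N $$ (i, 0) div d"
    \<comment> \<open>Subtracting a multiple of the top row turns the entry into its remainder
      modulo \<open>d\<close>, which must vanish by minimality of \<open>d\<close>.\<close>
    have "addrow (- ?q) i 0 N $$ (i, 0) = N $$ (i, 0) mod d"
      using N(2) i equiv_mat_carrier[OF M N(1)] by (simp add: minus_div_mult_eq_mod[symmetric])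
    moreover have "equiv_mat ?N M (addrow (- ?q) i 0 N)" using equiv_mat_addrow[OF M N(1) False] by simp
    ultimately have "0 < N $$ (i, 0) mod d \<Longrightarrow> d \<le> N $$ (i, 0) mod d" using least i by (metis zero_less_Suc)
    then have "N $$ (i, 0) mod d = 0" using pos_mod_sign[OF d] pos_mod_bound[OF d] by (smt (verit))
    then show ?thesis by (simp add: dvd_eq_mod_eq_0)
  qed (use N in simp)
  have cols: "d dvd N $$ (0, j)" if N: "equiv_mat ?N M N" "N $$ (0, 0) = d" and j: "j < ?N" for N j
  proof (cases "j = 0")
    case False
    let ?q = "N $$ (0, j) div d"
    have "addcol (- ?q) j 0 N $$ (0, j) = N $$ (0, j) mod d"
      using N(2) j equiv_mat_carrier[OF M N(1)] by (simp add: minus_div_mult_eq_mod[symmetric])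
    moreover have "equiv_mat ?N M (addcol (- ?q) j 0 N)" using equiv_mat_addcol[OF M N(1), of 0 j] False by simp
    ultimately have "0 < N $$ (0, j) mod d \<Longrightarrow> d \<le> N $$ (0, j) mod d" using least j by (metis zero_less_Suc)
    then have "N $$ (0, j) mod d = 0" using pos_mod_sign[OF d] pos_mod_bound[OF d] by (smt (verit))
    then show ?thesis by (simp add: dvd_eq_mod_eq_0)
  qed (use N in simp)
  obtain N where N: "equiv_mat ?N M N" "N $$ (0, 0) = d"
    using equiv_mat_move_to_front[OF M N0(2-4)] N0(5) by (metis d_def)
  have NC: "N \<in> carrier_mat ?N ?N" using equiv_mat_carrier[OF M N(1)] .
  \<comment> \<open>As \<open>d\<close> divides its row and column, \<open>N\<close> has the blocks
    \<open>dm\<close>, \<open>dm * B\<close>, \<open>C * dm\<close>, \<open>F\<close>, and integral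
    block elimination leaves the Schur complement \<open>E\<close>.\<close>
  define dm where "dm = mat 1 1 (\<lambda>_. d)"
  define B where "B = mat 1 n (\<lambda>(_, j). N $$ (0, Suc j) div d)"
  define C where "C = mat n 1 (\<lambda>(i, _). N $$ (Suc i, 0) div d)"
  define F where "F = mat n n (\<lambda>(i, j). N $$ (Suc i, Suc j))"
  define E where "E = F - C * (dm * B)"
  have car: "dm \<in> carrier_mat 1 1" "B \<in> carrier_mat 1 n" "C \<in> carrier_mat n 1" "F \<in> carrier_mat n n"
    "E \<in> carrier_mat n n" by (auto simp: dm_def B_def C_def F_def E_def)
  have N_block: "N = four_block_mat dm (dm * B) (C * dm) F"
  proof (intro eq_matI)
    fix i j assume "i < dim_row (four_block_mat dm (dm * B) (C * dm) F)"
      "j < dim_col (four_block_mat dm (dm * B) (C * dm) F)"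
    then have ij: "i < ?N" "j < ?N" using car by auto
    show "N $$ (i, j) = four_block_mat dm (dm * B) (C * dm) F $$ (i, j)"
      using ij car rows[OF N ij(1)] cols[OF N ij(2)] N(2)
      by (cases i; cases j) (auto simp: dm_def B_def C_def F_def scalar_prod_def)
  qed (use NC car in auto)
  let ?P = "four_block_mat (1\<^sub>m 1) (0\<^sub>m 1 n) (- C) (1\<^sub>m n)"
  let ?Q = "four_block_mat (1\<^sub>m 1) (- B) (0\<^sub>m n 1) (1\<^sub>m n)"
  have P: "?P \<in> carrier_mat ?N ?N" "det ?P dvd 1"
    using det_four_block_mat_upper_right_zero[OF one_carrier_mat refl, of "- C" n 1 "1\<^sub>m n"] car by auto
  have Q: "?Q \<in> carrier_mat ?N ?N" "det ?Q dvd 1"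
    using det_four_block_mat_lower_left_zero[OF one_carrier_mat _ refl, of "- B" 1 n "1\<^sub>m n"] car by auto
  let ?D = "four_block_mat dm (0\<^sub>m 1 n) (0\<^sub>m n 1) E"
  have "?P * N = four_block_mat dm (dm * B) (0\<^sub>m n 1) E"
  proof -
    have "?P * N = four_block_mat (1\<^sub>m 1 * dm + 0\<^sub>m 1 n * (C * dm)) (1\<^sub>m 1 * (dm * B) + 0\<^sub>m 1 n * F)
        (- C * dm + 1\<^sub>m n * (C * dm)) (- C * (dm * B) + 1\<^sub>m n * F)"
      unfolding N_block using car by (intro mult_four_block_mat) auto
    moreover have "1\<^sub>m 1 * dm + 0\<^sub>m 1 n * (C * dm) = dm" using car by simp
    moreover have "1\<^sub>m 1 * (dm * B) + 0\<^sub>m 1 n * F = dm * B" using car by simp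
    moreover have "- C * dm + 1\<^sub>m n * (C * dm) = 0\<^sub>m n 1" using car by (intro eq_matI) auto
    moreover have "- C * (dm * B) + 1\<^sub>m n * F = E" using car unfolding E_def by (intro eq_matI) auto
    ultimately show ?thesis by simp
  qed
  moreover have "four_block_mat dm (dm * B) (0\<^sub>m n 1) E * ?Q = ?D"
  proof -
    have "four_block_mat dm (dm * B) (0\<^sub>m n 1) E * ?Q =
        four_block_mat (dm * 1\<^sub>m 1 + (dm * B) * 0\<^sub>m n 1) (dm * - B + (dm * B) * 1\<^sub>m n)
          (0\<^sub>m n 1 * 1\<^sub>m 1 + E * 0\<^sub>m n 1) (0\<^sub>m n 1 * - B + E * 1\<^sub>m n)"
      using car by (intro mult_four_block_mat) auto
    moreover have "dm * 1\<^sub>m 1 + (dm * B) * 0\<^sub>m n 1 = dm" using car by simp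
    moreover have "dm * - B + (dm * B) * 1\<^sub>m n = 0\<^sub>m 1 n" using car by (intro eq_matI) auto
    moreover have "0\<^sub>m n 1 * 1\<^sub>m 1 + E * 0\<^sub>m n 1 = 0\<^sub>m n 1" using car by simp
    moreover have "0\<^sub>m n 1 * - B + E * 1\<^sub>m n = E" using car by (intro eq_matI) auto
    ultimately show ?thesis by simp
  qed
  ultimately have D: "equiv_mat ?N M ?D"
    using equiv_mat_right[OF M equiv_mat_left[OF M N(1) P] Q] by simp
  have "d dvd E $$ (i, j)" if ij: "i < n" "j < n" for i j
  proof -
    \<comment> \<open>Adding a lower row to the top row keeps \<open>d\<close> in the corner and
      moves entries of \<open>E\<close> into the top row, where \<open>cols\<close> applies.\<close>
    let ?A = "addrow 1 0 (Suc i) ?D"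
    have A: "equiv_mat ?N M ?A" using ij by (intro equiv_mat_addrow M D) auto
    have "?A $$ (0, 0) = d" using car ij by (simp add: dm_def)
    then have "d dvd ?A $$ (0, Suc j)" using cols[OF A] ij by simp
    then show ?thesis using car ij by simp
  qed
  then show ?thesis using that[OF d car(5)] D by (simp add: dm_def)
qed

lemma entries_dvd_mult:
  fixes M :: "int mat"
  assumes M: "M \<in> carrier_mat n n" and P: "P \<in> carrier_mat n n" and Q: "Q \<in> carrier_mat n n"
    and dvd: "\<And>i j. i < n \<Longrightarrow> j < n \<Longrightarrow> d dvd M $$ (i, j)" and ij: "i < n" "j < n"
  shows "d dvd (P * M * Q) $$ (i, j)"
proof -
  have "d dvd (P * M) $$ (i, k)" if "k < n" for k
    unfolding index_mult_mat_sum[OF P M ij(1) that] using that dvd by (intro dvd_sum dvd_mult) simp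
  then show ?thesis
    unfolding index_mult_mat_sum[OF mult_carrier_mat[OF P M] Q ij] by (intro dvd_sum dvd_mult2) simp
qed

lemma smith_normal_form_exists:
  fixes M :: "int mat"
  assumes "M \<in> carrier_mat n n" "det M \<noteq> 0"
  shows "\<exists>D. is_smith_normal_form M D"
  using assms
proof (induction n arbitrary: M)
  case 0
  have "invertible_mat (1\<^sub>m 0 :: int mat)" by (simp add: invertible_int_mat_iff[of _ 0])
  moreover have "M = 1\<^sub>m 0 * M * 1\<^sub>m 0" using 0 by simp
  ultimately have "is_smith_normal_form M M"
    using 0 unfolding is_smith_normal_form_def Let_def diagonal_mat_def
    by (intro conjI bexI[of _ "1\<^sub>m 0"]) auto
  then show ?case by blast
next
  case (Suc n)
  obtain d E where d: "0 < d" and E: "E \<in> carrier_mat n n"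
    and eq: "equiv_mat (Suc n) M (four_block_mat (mat 1 1 (\<lambda>_. d)) (0\<^sub>m 1 n) (0\<^sub>m n 1) E)"
    and dvd: "\<And>i j. i < n \<Longrightarrow> j < n \<Longrightarrow> d dvd E $$ (i, j)"
    by (rule smith_step[OF Suc.prems]) blast
  let ?dm = "mat 1 1 (\<lambda>_. d)"
  let ?B = "four_block_mat ?dm (0\<^sub>m 1 n) (0\<^sub>m n 1) E"
  obtain P Q where PQ: "P \<in> carrier_mat (Suc n) (Suc n)" "Q \<in> carrier_mat (Suc n) (Suc n)"
    "det P dvd 1" "det Q dvd 1" "?B = P * M * Q" using eq unfolding equiv_mat_def by blast
  have "det ?B = det ?dm * det E"
    by (rule det_four_block_mat_upper_right_zero) (use E in auto)
  moreover have "det ?B \<noteq> 0"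
  proof -
    have "det ?B = det P * det M * det Q"
      unfolding PQ(5) using PQ(1,2) Suc.prems by (simp add: det_mult[of _ "Suc n"])
    then show ?thesis using PQ(3,4) Suc.prems(2) by auto
  qed
  ultimately have "det E \<noteq> 0" by auto
  then obtain D where "is_smith_normal_form E D" using Suc.IH[OF E] by blast
  then obtain P' Q' where D: "D \<in> carrier_mat n n" "diagonal_mat D" "\<forall>i<n. 0 < D $$ (i, i)"
      "\<forall>i. Suc i < n \<longrightarrow> D $$ (i, i) dvd D $$ (Suc i, Suc i)"
    and PQ': "P' \<in> carrier_mat n n" "Q' \<in> carrier_mat n n" "invertible_mat P'" "invertible_mat Q'" "D = P' * E * Q'"
    unfolding is_smith_normal_form_def Let_def carrier_matD(1)[OF E] by blast
  have det_PQ': "det P' dvd 1" "det Q' dvd 1"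
    using invertible_int_mat_iff[OF PQ'(1)] invertible_int_mat_iff[OF PQ'(2)] PQ'(3,4) by simp_all
  \<comment> \<open>The entries of the diagonal form of \<open>E\<close> are combinations of entries
    of \<open>E\<close>, so \<open>d\<close> divides them and can head the divisibility
    chain.\<close>
  have dD: "d dvd D $$ (i, i)" if "i < n" for i
    unfolding PQ'(5) using entries_dvd_mult[OF E PQ'(1,2) dvd] that by blast
  let ?D = "four_block_mat ?dm (0\<^sub>m 1 n) (0\<^sub>m n 1) D"
  let ?P = "four_block_mat (1\<^sub>m 1) (0\<^sub>m 1 n) (0\<^sub>m n 1) P'"
  let ?Q = "four_block_mat (1\<^sub>m 1) (0\<^sub>m 1 n) (0\<^sub>m n 1) Q'"
  have P: "?P \<in> carrier_mat (Suc n) (Suc n)" "det ?P dvd 1"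
    using det_four_block_mat_upper_right_zero[OF one_carrier_mat refl, of "0\<^sub>m n 1" n 1 P'] PQ'(1) det_PQ' by auto
  have Q: "?Q \<in> carrier_mat (Suc n) (Suc n)" "det ?Q dvd 1"
    using det_four_block_mat_upper_right_zero[OF one_carrier_mat refl, of "0\<^sub>m n 1" n 1 Q'] PQ'(2) det_PQ' by auto
  have "?P * ?B * ?Q = ?D"
  proof -
    have zeros: "1\<^sub>m 1 * ?dm + 0\<^sub>m 1 n * 0\<^sub>m n 1 = ?dm" "?dm * 1\<^sub>m 1 + 0\<^sub>m 1 n * 0\<^sub>m n 1 = ?dm"
      by (intro eq_matI; simp)+
    have E1: "1\<^sub>m 1 * 0\<^sub>m 1 n + 0\<^sub>m 1 n * E = 0\<^sub>m 1 n" "0\<^sub>m n 1 * ?dm + P' * 0\<^sub>m n 1 = 0\<^sub>m n 1"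
      "0\<^sub>m n 1 * 0\<^sub>m 1 n + P' * E = P' * E"
      using PQ'(1) E by simp_all
    have D1: "?dm * 0\<^sub>m 1 n + 0\<^sub>m 1 n * Q' = 0\<^sub>m 1 n" "0\<^sub>m n 1 * 1\<^sub>m 1 + P' * E * 0\<^sub>m n 1 = 0\<^sub>m n 1"
      "0\<^sub>m n 1 * 0\<^sub>m 1 n + P' * E * Q' = P' * E * Q'"
      using PQ'(1,2) E by simp_all
    have "?P * ?B = four_block_mat (1\<^sub>m 1 * ?dm + 0\<^sub>m 1 n * 0\<^sub>m n 1) (1\<^sub>m 1 * 0\<^sub>m 1 n + 0\<^sub>m 1 n * E)
        (0\<^sub>m n 1 * ?dm + P' * 0\<^sub>m n 1) (0\<^sub>m n 1 * 0\<^sub>m 1 n + P' * E)"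
      by (rule mult_four_block_mat) (use PQ'(1) E in auto)
    then have PB: "?P * ?B = four_block_mat ?dm (0\<^sub>m 1 n) (0\<^sub>m n 1) (P' * E)" unfolding zeros E1 .
    have "four_block_mat ?dm (0\<^sub>m 1 n) (0\<^sub>m n 1) (P' * E) * ?Q =
        four_block_mat (?dm * 1\<^sub>m 1 + 0\<^sub>m 1 n * 0\<^sub>m n 1) (?dm * 0\<^sub>m 1 n + 0\<^sub>m 1 n * Q')
        (0\<^sub>m n 1 * 1\<^sub>m 1 + P' * E * 0\<^sub>m n 1) (0\<^sub>m n 1 * 0\<^sub>m 1 n + P' * E * Q')"
      by (rule mult_four_block_mat) (use PQ'(1,2) E in auto)
    then show ?thesis unfolding PB zeros D1 PQ'(5) .
  qed
  then have "equiv_mat (Suc n) M ?D"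
    using equiv_mat_right[OF Suc.prems(1) equiv_mat_left[OF Suc.prems(1) eq P] Q] by simp
  then obtain P2 Q2 where PQ2: "P2 \<in> carrier_mat (Suc n) (Suc n)" "Q2 \<in> carrier_mat (Suc n) (Suc n)"
    "det P2 dvd 1" "det Q2 dvd 1" "?D = P2 * M * Q2"
    unfolding equiv_mat_def by blast
  have "is_smith_normal_form M ?D"
    unfolding is_smith_normal_form_def Let_def
  proof (intro conjI allI impI)
    show "M \<in> carrier_mat (dim_row M) (dim_row M)" "?D \<in> carrier_mat (dim_row M) (dim_row M)"
      using Suc.prems(1) D(1) by auto
    show "diagonal_mat ?D"
      unfolding diagonal_mat_def
    proof (intro allI impI)
      fix i j assume "i < dim_row ?D" "j < dim_col ?D" "i \<noteq> j"
      then show "?D $$ (i, j) = 0"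
        using D(1,2) by (cases i; cases j) (auto simp: diagonal_mat_def)
    qed
    show "0 < ?D $$ (i, i)" if "i < dim_row M" for i
      using that Suc.prems(1) D(1,3) d by (cases i) auto
    show "?D $$ (i, i) dvd ?D $$ (Suc i, Suc i)" if "Suc i < dim_row M" for i
      using that Suc.prems(1) D(1,4) dD by (cases i) auto
    show "\<exists>P\<in>carrier_mat (dim_row M) (dim_row M). \<exists>Q\<in>carrier_mat (dim_row M) (dim_row M).
        invertible_mat P \<and> invertible_mat Q \<and> ?D = P * M * Q"
      unfolding carrier_matD(1)[OF Suc.prems(1)]
      using PQ2 invertible_int_mat_iff[OF PQ2(1)] invertible_int_mat_iff[OF PQ2(2)] by blast
  qed
  then show ?case by blast
qed

section \<open>Uniqueness of the Smith normal form\<close>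

text \<open>The block has \<open>(n - i) + (i + 1) > n\<close> rows and columns, so it meets every permutation.\<close>

lemma det_zero_block_dvd:
  fixes M :: "int mat"
  assumes M: "M \<in> carrier_mat n n" and i: "i < n"
    and dvd: "\<And>a b. i \<le> a \<Longrightarrow> a < n \<Longrightarrow> b \<le> i \<Longrightarrow> t dvd M $$ (a, b)"
  shows "t dvd det M"
  unfolding det_def'[OF M]
proof (intro dvd_sum dvd_mult)
  fix \<pi> assume "\<pi> \<in> {\<pi>. \<pi> permutes {0..<n}}"
  then have \<pi>: "\<pi> permutes {0..<n}" by simp
  have "\<exists>a\<in>{i..<n}. \<pi> a \<le> i"
  proof (rule ccontr)
    assume "\<not> ?thesis"
    then have "\<pi> ` {i..<n} \<subseteq> {Suc i..<n}" using permutes_in_image[OF \<pi>] by force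
    moreover have "inj_on \<pi> {i..<n}" using permutes_inj[OF \<pi>] by (rule inj_on_subset) simp
    ultimately have "card {i..<n} \<le> card {Suc i..<n}" using card_inj_on_le by blast
    then show False using i by simp
  qed
  then obtain a where a: "i \<le> a" "a < n" "\<pi> a \<le> i" by auto
  have "M $$ (a, \<pi> a) dvd (\<Prod>a = 0..<n. M $$ (a, \<pi> a))" using a by (intro dvd_prodI) auto
  then show "t dvd (\<Prod>a = 0..<n. M $$ (a, \<pi> a))" using dvd[OF a] dvd_trans by blast
qed

lemma smith_chain:
  fixes D :: "int mat"
  assumes chain: "\<forall>i. Suc i < n \<longrightarrow> D $$ (i, i) dvd D $$ (Suc i, Suc i)"
  shows "b \<le> i \<Longrightarrow> i < n \<Longrightarrow> D $$ (b, b) dvd D $$ (i, i)"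
proof (induction i rule: dec_induct)
  case (step i)
  then show ?case using chain by (meson Suc_lessD dvd_trans)
qed simp

text \<open>Let \<open>t\<close> be the entry of \<open>D'\<close> divided by its gcd with the entry
  of \<open>D\<close>. Comparing entries of \<open>D' * C = A * D\<close>, \<open>t\<close> divides
  a block of \<open>A\<close> large enough to force \<open>t\<close> to divide \<open>det A\<close>,
  so \<open>t\<close> is a unit.\<close>

lemma smith_diag_dvd:
  fixes D D' :: "int mat"
  assumes D: "D \<in> carrier_mat n n" "diagonal_mat D" "\<forall>i<n. 0 < D $$ (i, i)"
      "\<forall>i. Suc i < n \<longrightarrow> D $$ (i, i) dvd D $$ (Suc i, Suc i)"
    and D': "D' \<in> carrier_mat n n" "diagonal_mat D'"
      "\<forall>i. Suc i < n \<longrightarrow> D' $$ (i, i) dvd D' $$ (Suc i, Suc i)"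
    and A: "A \<in> carrier_mat n n" "det A dvd 1" and C: "C \<in> carrier_mat n n"
    and eq: "D' * C = A * D" and i: "i < n"
  shows "D' $$ (i, i) dvd D $$ (i, i)"
proof -
  let ?d = "D $$ (i, i)" and ?d' = "D' $$ (i, i)"
  define g where "g = gcd ?d' ?d"
  define d where "d = ?d div g"
  define t where "t = ?d' div g"
  have dt: "?d = g * d" "?d' = g * t" by (simp_all add: g_def d_def t_def)
  have g0: "g \<noteq> 0" using D(3) i unfolding g_def by (metis gcd_eq_0_iff less_irrefl)
  have cop: "algebraic_semidom_class.coprime t d"
    unfolding t_def d_def g_def by (rule div_gcd_coprime) (use D(3) i in auto)
  have entry: "D' $$ (a, a) * C $$ (a, b) = A $$ (a, b) * D $$ (b, b)" if ab: "a < n" "b < n" for a b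
  proof -
    have "(D' * C) $$ (a, b) = (\<Sum>k = 0..<n. D' $$ (a, k) * C $$ (k, b))"
      by (rule index_mult_mat_sum[OF D'(1) C ab])
    also have "\<dots> = D' $$ (a, a) * C $$ (a, b)"
      using ab D'(1,2) by (subst sum.remove[of _ a]) (auto simp: diagonal_mat_def intro!: sum.neutral)
    finally have 1: "(D' * C) $$ (a, b) = D' $$ (a, a) * C $$ (a, b)" .
    have "(A * D) $$ (a, b) = (\<Sum>k = 0..<n. A $$ (a, k) * D $$ (k, b))"
      by (rule index_mult_mat_sum[OF A(1) D(1) ab])
    also have "\<dots> = A $$ (a, b) * D $$ (b, b)"
      using ab D(1,2) by (subst sum.remove[of _ b]) (auto simp: diagonal_mat_def intro!: sum.neutral)
    finally show ?thesis using 1 eq by simp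
  qed
  have "t dvd A $$ (a, b)" if ab: "i \<le> a" "a < n" "b \<le> i" for a b
  proof -
    obtain w where w: "?d = D $$ (b, b) * w" using smith_chain[OF D(4) ab(3) i] by blast
    obtain u where u: "D' $$ (a, a) = ?d' * u" using smith_chain[OF D'(3) ab(1,2)] by blast
    have "A $$ (a, b) * ?d = D' $$ (a, a) * C $$ (a, b) * w"
      using entry[of a b] ab i by (simp add: w)
    also have "\<dots> = ?d' * (u * C $$ (a, b) * w)" by (simp add: u)
    finally have "g * (A $$ (a, b) * d) = g * (t * (u * C $$ (a, b) * w))"
      by (simp only: dt mult.left_commute mult.assoc)
    then have "A $$ (a, b) * d = t * (u * C $$ (a, b) * w)" using g0 by simp
    then have "t dvd A $$ (a, b) * d" by (metis dvd_triv_left)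
    then show ?thesis using cop by (simp add: coprime_dvd_mult_left_iff)
  qed
  then have "t dvd det A" using det_zero_block_dvd[OF A(1) i] by blast
  then have "t dvd 1" using A(2) dvd_trans by blast
  then have "g * t dvd g * 1" by (intro mult_dvd_mono dvd_refl)
  then have "?d' dvd g" by (simp only: dt(2) mult_1_right)
  also have "g dvd ?d" by (simp add: g_def)
  finally show ?thesis .
qed

lemma smith_normal_form_dvd:
  assumes D: "is_smith_normal_form M D" and D': "is_smith_normal_form M D'" and i: "i < dim_row M"
  shows "D' $$ (i, i) dvd D $$ (i, i)"
proof -
  define n where "n = dim_row M"
  obtain P Q where M: "M \<in> carrier_mat n n"
    and DD: "D \<in> carrier_mat n n" "diagonal_mat D" "\<forall>i<n. 0 < D $$ (i, i)"
      "\<forall>i. Suc i < n \<longrightarrow> D $$ (i, i) dvd D $$ (Suc i, Suc i)"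
    and PQ: "P \<in> carrier_mat n n" "Q \<in> carrier_mat n n" "invertible_mat P" "invertible_mat Q" "D = P * M * Q"
    using D unfolding is_smith_normal_form_def Let_def n_def by blast
  obtain P' Q' where
    DD': "D' \<in> carrier_mat n n" "diagonal_mat D'"
      "\<forall>i. Suc i < n \<longrightarrow> D' $$ (i, i) dvd D' $$ (Suc i, Suc i)"
    and PQ': "P' \<in> carrier_mat n n" "Q' \<in> carrier_mat n n" "invertible_mat P'" "invertible_mat Q'" "D' = P' * M * Q'"
    using D' unfolding is_smith_normal_form_def Let_def n_def by blast
  obtain R where R: "R \<in> carrier_mat n n" "R * P = 1\<^sub>m n" "det R dvd 1"
    using invertible_int_matE[OF PQ(3,1)] .
  obtain S where S: "S \<in> carrier_mat n n" "Q' * S = 1\<^sub>m n" using invertible_int_matE[OF PQ'(4,2)] .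
  have "D' * (S * Q) = P' * M * (Q' * S) * Q"
    unfolding PQ'(5) using M PQ PQ' S(1) by (simp add: assoc_mult_mat[of _ n n _ n _ n])
  also have "\<dots> = P' * (R * P) * M * Q" using M PQ PQ' unfolding S(2) R(2) by simp
  also have "\<dots> = (P' * R) * D"
    unfolding PQ(5) using M PQ PQ' R(1) by (simp add: assoc_mult_mat[of _ n n _ n _ n])
  finally have eq: "D' * (S * Q) = (P' * R) * D" .
  have "det (P' * R) dvd 1"
    using PQ'(1,3) R(1,3) invertible_int_mat_iff by (intro det_mult_dvd_1) auto
  then show ?thesis
    using smith_diag_dvd[OF DD DD' _ _ _ eq] PQ PQ' R(1) S(1) i by (simp add: n_def)
qed

lemma smith_normal_form_unique:
  assumes D: "is_smith_normal_form M D" and D': "is_smith_normal_form M D'"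
  shows "D = D'"
proof (intro eq_matI)
  have car: "D \<in> carrier_mat (dim_row M) (dim_row M)" "D' \<in> carrier_mat (dim_row M) (dim_row M)"
    "diagonal_mat D" "diagonal_mat D'" "\<forall>i<dim_row M. 0 < D $$ (i, i)" "\<forall>i<dim_row M. 0 < D' $$ (i, i)"
    using D D' unfolding is_smith_normal_form_def Let_def by blast+
  show "dim_row D = dim_row D'" "dim_col D = dim_col D'" using car by auto
  fix i j assume "i < dim_row D'" "j < dim_col D'"
  then have ij: "i < dim_row M" "j < dim_row M" using car by auto
  show "D $$ (i, j) = D' $$ (i, j)"
  proof (cases "i = j")
    case True
    then show ?thesis
      using zdvd_antisym_nonneg[OF _ _ smith_normal_form_dvd[OF D' D ij(1)] smith_normal_form_dvd[OF D D' ij(1)]]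
        car(5,6) ij by (simp add: less_imp_le)
  next
    case False
    then show ?thesis using car(1-4) ij unfolding diagonal_mat_def by (metis carrier_matD)
  qed
qed

text \<open>All invariant factors divide the last one, so its product with the inverse of the
  diagonal form is integral; undoing the unimodular factors gives \<open>X\<close>. This is the
  source of \<open>cyclic\<close>.\<close>

lemma last_invariant_factor_inverse:
  fixes M :: "int mat"
  assumes M: "M \<in> carrier_mat n n" and det: "det M \<noteq> 0" and n: "0 < n"
  obtains X where "0 < last_invariant_factor M" "X \<in> carrier_mat n n"
    "M * X = last_invariant_factor M \<cdot>\<^sub>m 1\<^sub>m n"
proof -
  obtain D where D: "is_smith_normal_form M D" using smith_normal_form_exists[OF M det] by blast
  have "(THE D. is_smith_normal_form M D) = D"
    using D smith_normal_form_unique by (intro the_equality) blast+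
  then have lif: "last_invariant_factor M = D $$ (n - 1, n - 1)"
    using M by (simp add: last_invariant_factor_def)
  define d where "d = last_invariant_factor M"
  obtain P Q where DD: "D \<in> carrier_mat n n" "diagonal_mat D" "\<forall>i<n. 0 < D $$ (i, i)"
      "\<forall>i. Suc i < n \<longrightarrow> D $$ (i, i) dvd D $$ (Suc i, Suc i)"
    and PQ: "P \<in> carrier_mat n n" "Q \<in> carrier_mat n n" "invertible_mat P" "D = P * M * Q"
    using D M unfolding is_smith_normal_form_def Let_def by auto
  have d: "0 < d" using DD(3) n by (simp add: d_def lif)
  have d_dvd: "D $$ (i, i) dvd d" if "i < n" for i
    using smith_chain[OF DD(4), of i "n - 1"] that by (simp add: d_def lif)
  obtain R where R: "R \<in> carrier_mat n n" "R * P = 1\<^sub>m n" using invertible_int_matE[OF PQ(3,1)] .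
  define Z where "Z = mat n n (\<lambda>(i, j). if i = j then d div D $$ (i, i) else 0)"
  have Z: "Z \<in> carrier_mat n n" by (simp add: Z_def)
  have DZ: "D * Z = d \<cdot>\<^sub>m 1\<^sub>m n"
  proof (intro eq_matI)
    fix i j assume "i < dim_row (d \<cdot>\<^sub>m 1\<^sub>m n)" "j < dim_col (d \<cdot>\<^sub>m 1\<^sub>m n)"
    then have ij: "i < n" "j < n" by auto
    have "(D * Z) $$ (i, j) = (\<Sum>k = 0..<n. D $$ (i, k) * (if k = j then d div D $$ (k, k) else 0))"
      using ij DD(1) by (auto simp: Z_def scalar_prod_def intro!: sum.cong)
    also have "\<dots> = D $$ (i, j) * (d div D $$ (j, j))" using ij by (simp add: if_distrib cong: if_cong)
    also have "\<dots> = (d \<cdot>\<^sub>m 1\<^sub>m n) $$ (i, j)" using ij DD(1,2) d_dvd[of j] by (auto simp: diagonal_mat_def)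
    finally show "(D * Z) $$ (i, j) = (d \<cdot>\<^sub>m 1\<^sub>m n) $$ (i, j)" .
  qed (use DD(1) Z in auto)
  have "M * (Q * Z * P) = (R * P) * M * (Q * Z * P)" unfolding R(2) using M by simp
  also have "\<dots> = R * (D * Z) * P"
    unfolding PQ(4) using M PQ R(1) Z by (simp add: assoc_mult_mat[of _ n n _ n _ n])
  also have "\<dots> = d \<cdot>\<^sub>m (R * P)"
  proof -
    have "R * (d \<cdot>\<^sub>m 1\<^sub>m n) = d \<cdot>\<^sub>m R" using mult_smult_distrib[OF R(1) one_carrier_mat, of d] R(1) by simp
    then show ?thesis unfolding DZ by (simp only: mult_smult_assoc_mat[OF R(1) PQ(1)])
  qed
  finally have "M * (Q * Z * P) = d \<cdot>\<^sub>m 1\<^sub>m n" using R(2) by simp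
  then show ?thesis using that[of "Q * Z * P"] d PQ(1,2) Z by (simp add: d_def)
qed

section \<open>Common factors modulo a prime\<close>

text \<open>Two candidates for the definite description in \<open>gcd_mod\<close> divide each other
  and, being monic and reduced, coincide.\<close>

lemma gcd_mod_props:
  fixes p :: int and f g :: "int poly"
  assumes p: "prime p" and f: "monic f"
  defines "h \<equiv> gcd_mod p f g"
  shows "monic h" "pdvd p q h \<longleftrightarrow> pdvd p q f \<and> pdvd p q g"
proof -
  have p1: "\<not> p dvd 1" using p not_prime_unit by blast
  let ?P = "\<lambda>h. poly_mod.Mp p h = h \<and> monic h \<and> pdvd p h f \<and> pdvd p h g \<and>
     (\<forall>k. pdvd p k f \<and> pdvd p k g \<longrightarrow> pdvd p k h)"
  obtain h0 u v where h0: "monic h0" "poly_mod.Mp p h0 = h0" "pdvd p h0 f" "pdvd p h0 g"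
    and uv: "[:p:] dvd h0 - (u * f + v * g)"
    using gcd_mod_generator[OF p f, of g] by metis
  have "pdvd p k h0" if "pdvd p k f" "pdvd p k g" for k
    using pdvd_cong[OF uv] that by (simp add: pdvd_add pdvd_mult)
  then have P0: "?P h0" using h0 by blast
  moreover have "x = h0" if x: "?P x" for x
  proof -
    have xm: "monic x" "poly_mod.Mp p x = x" and hx: "pdvd p h0 x" "pdvd p x h0" using x P0 by blast+
    have "degree x = degree h0"
      using pdvd_monic_degree_le[OF h0(1) hx(1) xm(1) p1] pdvd_monic_degree_le[OF xm(1) hx(2) h0(1) p1]
      by (rule le_antisym[rotated])
    then have "[:p:] dvd x - h0" by (rule pdvd_monic_eq[OF h0(1) xm(1) hx(1)])
    then show ?thesis using Mp_eq_iff[of p x h0] xm(2) h0(2) by simp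
  qed
  ultimately have "h = h0" unfolding h_def gcd_mod_def by (rule the_equality)
  then show "monic h" "pdvd p q h \<longleftrightarrow> pdvd p q f \<and> pdvd p q g" using P0 pdvd_trans by blast+
qed

lemma finite_monic_irreducible_factors_mod:
  fixes p :: int
  assumes p: "prime p" and f: "monic f"
  shows "finite (monic_irreducible_factors_mod p f)"
proof (rule finite_subset)
  let ?L = "{xs. set xs \<subseteq> {0..<p} \<and> length xs = Suc (degree f)}"
  show "finite (Poly ` ?L)" by (intro finite_imageI finite_lists_length_eq) simp
  show "monic_irreducible_factors_mod p f \<subseteq> Poly ` ?L"
  proof
    fix q assume "q \<in> monic_irreducible_factors_mod p f"
    then have q: "poly_mod.Mp p q = q" "monic q" "pdvd p q f"
      unfolding monic_irreducible_factors_mod_def by auto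
    have deg: "degree q \<le> degree f"
      using pdvd_monic_degree_le[OF q(2,3) f] p not_prime_unit by blast
    have "coeff q i \<in> {0..<p}" for i
    proof -
      have "coeff q i = coeff q i mod p"
        using arg_cong[OF q(1), of "\<lambda>q. coeff q i"] by (simp add: poly_mod.Mp_coeff poly_mod.M_def)
      then show ?thesis using prime_gt_0_int[OF p] by (metis atLeastLessThan_iff pos_mod_bound pos_mod_sign)
    qed
    then have "map (coeff q) [0..<Suc (degree f)] \<in> ?L" by auto
    moreover have "q = Poly (map (coeff q) [0..<Suc (degree f)])"
      using deg by (intro poly_eqI) (auto simp: nth_default_def coeff_eq_0 simp del: upt_Suc)
    ultimately show "q \<in> Poly ` ?L" by blast
  qed
qed

lemma pdvd_prod_member: "finite F \<Longrightarrow> f \<in> F \<Longrightarrow> pdvd p f (\<Prod>F)"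
  by (intro dvd_imp_pdvd dvd_prodI[of F f "\<lambda>x. x", simplified])

lemma monic_star:
  assumes "monic f"
  shows "monic ((- 1) ^ degree f * star f)" "degree ((- 1) ^ degree f * star f) = degree f"
proof -
  have eq: "(- 1) ^ degree f * star f = Polynomial.smult ((- 1) ^ degree f) (star f)"
    by (cases "even (degree f)") auto
  show deg: "degree ((- 1) ^ degree f * star f) = degree f" unfolding eq by simp
  show "monic ((- 1) ^ degree f * star f)"
    unfolding deg unfolding eq using assms by (simp add: coeff_pcompose_linear flip: power_mult_distrib)
qed

lemma pdvd_neg_one_power [simp]:
  "pdvd p ((- 1) ^ j * f) g \<longleftrightarrow> pdvd p f g" "pdvd p g ((- 1) ^ j * f) \<longleftrightarrow> pdvd p g f"
proof -
  have "pdvd p (- f) g \<longleftrightarrow> pdvd p f g"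
  proof -
    have "pdvd p f (- f)" "pdvd p (- f) f" using pdvd_uminus_iff[of p f f] pdvd_uminus_iff[of p "- f" f] by auto
    then show ?thesis using pdvd_trans by blast
  qed
  then show "pdvd p ((- 1) ^ j * f) g \<longleftrightarrow> pdvd p f g" by (cases "even j") auto
  show "pdvd p g ((- 1) ^ j * f) \<longleftrightarrow> pdvd p g f" by (cases "even j") auto
qed

lemma irreducible_m_star:
  assumes f: "poly_mod.irreducible_m p f"
  shows "poly_mod.irreducible_m p ((- 1) ^ j * star f)"
  unfolding poly_mod.irreducible_m_def Mp_eq_iff
proof (intro conjI allI impI)
  have star1: "pdvd p (star h) 1 \<Longrightarrow> pdvd p h 1" for h using pdvd_star[of p "star h" 1] by simp
  have sgn: "[:p:] dvd (- 1) ^ j * h \<longleftrightarrow> [:p:] dvd h" for h by (cases "even j") auto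
  show "\<not> [:p:] dvd (- 1) ^ j * star f - 0"
  proof
    assume "[:p:] dvd (- 1) ^ j * star f - 0"
    then have "[:p:] dvd star f" by (simp add: sgn)
    then have "[:p:] dvd f" using const_dvd_star[of p "star f"] by simp
    then show False using f unfolding poly_mod.irreducible_m_def Mp_eq_iff by simp
  qed
  show "\<not> pdvd p ((- 1) ^ j * star f) 1"
    using f star1 by (auto simp: poly_mod.irreducible_m_def)
  fix a b assume "[:p:] dvd (- 1) ^ j * star f - a * b"
  then have "[:p:] dvd (- 1) ^ j * ((- 1) ^ j * star f - a * b)" by (rule dvd_mult)
  also have "(- 1) ^ j * ((- 1) ^ j * star f - a * b) = star f - (- 1) ^ j * (a * b)"
    by (cases "even j") auto
  finally have "[:p:] dvd star (star f - (- 1) ^ j * (a * b))" by (rule const_dvd_star)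
  also have "star (star f - (- 1) ^ j * (a * b)) = f - ((- 1) ^ j * star a) * star b"
    by (cases "even j") auto
  finally have "pdvd p ((- 1) ^ j * star a) 1 \<or> pdvd p (star b) 1"
    using f unfolding poly_mod.irreducible_m_def Mp_eq_iff by blast
  then show "pdvd p a 1 \<or> pdvd p b 1" using star1 by auto
qed

section \<open>Reduction modulo the primes dividing the last invariant factor\<close>

lemma walk_cyclic:
  assumes "int_matrix n A" and e: "e \<in> carrier_vec n"
    and X: "X \<in> carrier_mat n n"
    and WX: "mat_of_cols n (map (\<lambda>k. (A ^\<^sub>m k) *\<^sub>v e) [0..<n]) * X = d \<cdot>\<^sub>m 1\<^sub>m n"
    and z: "z \<in> carrier_vec n"
  shows "pact A (vpoly n (X *\<^sub>v z)) e = d \<cdot>\<^sub>v z"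
proof -
  interpret int_matrix n A by fact
  have "pact A (vpoly n (X *\<^sub>v z)) e = walk e *\<^sub>v (X *\<^sub>v z)"
    using e X z by (intro walk_mult[symmetric] mult_mat_vec_carrier) auto
  also have "\<dots> = (walk e * X) *\<^sub>v z" using X z by (intro assoc_mult_mat_vec[symmetric]) auto
  also have "\<dots> = d \<cdot>\<^sub>v z" unfolding WX using z by (intro eq_vecI) (auto simp: scalar_prod_smult_distrib)
  finally show ?thesis .
qed

text \<open>\<open>res_eq\<close> encodes the second spectral condition, by
  \<open>char_poly_add_rank_one\<close>.\<close>

locale cospectral_pair = S: skew_matrix n S + T: skew_matrix n T for n S T +
  fixes e :: "int vec"
  assumes n: "0 < n" and e [simp]: "e \<in> carrier_vec n"
    and chi_eq: "char_poly S = char_poly T" and res_eq: "resolvent S e e = resolvent T e e"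
    and det_S: "det (S.walk e) \<noteq> 0"
begin

text \<open>The resolvent of \<open>e\<close> and \<open>f(S) e\<close> is the remainder modulo
  \<open>chi\<close> of \<open>f\<close> times the resolvent of \<open>e\<close> with itself. This
  is the same for \<open>T\<close>, and its coefficient at \<open>n - 1\<close> is the walk
  number.\<close>

lemma walk_numbers_eq: "e \<bullet> pact S f e = e \<bullet> pact T f e"
proof -
  have "S.\<chi> dvd (f * resolvent S e e - resolvent T e (pact T f e)) - (f * resolvent S e e - resolvent S e (pact S f e))"
    using T.resolvent_pact_right[OF e e, of f] S.resolvent_pact_right[OF e e, of f]
    unfolding chi_eq res_eq by (rule dvd_diff)
  then have "S.\<chi> dvd resolvent S e (pact S f e) - resolvent T e (pact T f e)" by simp
  moreover have "degree (resolvent S e (pact S f e) - resolvent T e (pact T f e)) < degree S.\<chi>"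
    using S.degree_resolvent_less[of e "pact S f e"] T.degree_resolvent_less[of e "pact T f e"] n
    by (simp add: S.degree_chi degree_diff_less)
  ultimately have "[:0:] dvd resolvent S e (pact S f e) - resolvent T e (pact T f e)"
    using pdvd_monic_small[OF S.monic_chi, of 0] by (simp only: pdvd_0_modulus)
  then have "coeff (resolvent S e (pact S f e)) (n - 1) = coeff (resolvent T e (pact T f e)) (n - 1)"
    by simp
  then show ?thesis using S.coeff_resolvent[of e "pact S f e"] T.coeff_resolvent[of e "pact T f e"] n by simp
qed

text \<open>This is the isometry property: skewness moves \<open>f\<close> across the product,
  leaving only walk numbers.\<close>

lemma gram_eq: "pact S f e \<bullet> pact S g e = pact T f e \<bullet> pact T g e"
proof -
  have "pact S f e \<bullet> pact S g e = e \<bullet> pact S (star f * g) e" by (simp add: S.pact_skew S.pact_mult)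
  also have "\<dots> = e \<bullet> pact T (star f * g) e" by (rule walk_numbers_eq)
  also have "\<dots> = pact T f e \<bullet> pact T g e" by (simp add: T.pact_skew T.pact_mult)
  finally show ?thesis .
qed

text \<open>The Gram matrices of the walk vectors agree, and their determinants are the squares of
  those of the walk matrices.\<close>

lemma det_T: "det (T.walk e) \<noteq> 0"
proof -
  have gram: "((S.walk e)\<^sup>T * S.walk e) = ((T.walk e)\<^sup>T * T.walk e)"
  proof (intro eq_matI)
    fix i j assume "i < dim_row ((T.walk e)\<^sup>T * T.walk e)" "j < dim_col ((T.walk e)\<^sup>T * T.walk e)"
    then have ij: "i < n" "j < n" by auto
    have col: "col (S.walk e) i = pact S (monom 1 i) e" "col (T.walk e) i = pact T (monom 1 i) e" if "i < n" for i
    proof -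
      have "S ^\<^sub>m i *\<^sub>v e \<in> carrier_vec n" "T ^\<^sub>m i *\<^sub>v e \<in> carrier_vec n"
        using S.pact_carrier[OF e, of "monom 1 i"] T.pact_carrier[OF e, of "monom 1 i"]
        by (simp_all add: S.pact_monom T.pact_monom)
      then show "col (S.walk e) i = pact S (monom 1 i) e" "col (T.walk e) i = pact T (monom 1 i) e"
        using that by (simp_all add: S.pact_monom T.pact_monom)
    qed
    show "((S.walk e)\<^sup>T * S.walk e) $$ (i, j) = ((T.walk e)\<^sup>T * T.walk e) $$ (i, j)"
      using ij col gram_eq by simp
  qed auto
  have "det ((S.walk e)\<^sup>T * S.walk e) = det (S.walk e) * det (S.walk e)"
    by (simp add: det_mult[of _ n] det_transpose[OF S.walk_carrier])
  moreover have "det ((T.walk e)\<^sup>T * T.walk e) = det (T.walk e) * det (T.walk e)"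
    by (simp add: det_mult[of _ n] det_transpose[OF T.walk_carrier])
  ultimately show ?thesis using gram det_S by auto
qed

lemma resolvent_mult_star_T:
  assumes b: "b \<in> carrier_vec n"
  shows "S.\<chi> dvd resolvent T b e * star (resolvent T b e) - star (resolvent S e e) * resolvent T b b"
proof -
  \<comment> \<open>The adjugate of the walk matrix supplies an integral polynomial that takes
    \<open>e\<close> to a nonzero multiple of \<open>b\<close>.\<close>
  have "pact T (vpoly n (adj_mat (T.walk e) *\<^sub>v b)) e = det (T.walk e) \<cdot>\<^sub>v b"
    using adj_mat[OF T.walk_carrier[of e]] b by (intro walk_cyclic T.int_matrix_axioms) auto
  from T.resolvent_mult_star[OF e b det_T this] show ?thesis by (simp add: chi_eq res_eq)
qed

text \<open>It is enough to treat \<open>m\<close>, and \<open>m(T) e\<close> vanishes modulo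
  \<open>p\<close> once \<open>k\<close> divides the resolvents of \<open>T\<close>. About these
  only the relation of \<open>resolvent_mult_star_T\<close> is known, whence the form of the third
  hypothesis.\<close>

lemma vdvd_transfer:
  assumes chi: "[:p:] dvd S.\<chi> - k * m"
    and ann: "\<And>f. vdvd p (pact S f e) \<longleftrightarrow> pdvd p m f"
    and k: "\<And>c q. pdvd p S.\<chi> (c * star c - star (resolvent S e e) * q) \<Longrightarrow> pdvd p k c"
    and f: "vdvd p (pact S f e)"
  shows "vdvd p (pact T f e)"
proof -
  have m: "vdvd p (pact T m e)"
  proof (subst vdvd_iff_scalar_prod[of _ n], simp, intro ballI)
    fix b :: "int vec" assume b: "b \<in> carrier_vec n"
    have "pdvd p k (resolvent T b e)" by (rule k[OF dvd_imp_pdvd[OF resolvent_mult_star_T[OF b]]])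
    then show "p dvd b \<bullet> pact T m e"
      using chi by (intro T.pdvd_resolvent_imp[OF b e n]) (simp_all add: chi_eq)
  qed
  obtain q where q: "[:p:] dvd f - m * q" using f ann by (auto elim: pdvdE)
  show ?thesis
    using T.vdvd_pact_cong[OF e q] T.vdvd_pact_mult[OF e m, of q] by (simp only: mult.commute)
qed

lemma permutation_similar:
  assumes cyc: "\<And>z. z \<in> carrier_vec n \<Longrightarrow> \<exists>g. pact S g e = d \<cdot>\<^sub>v z" and d: "d \<noteq> 0"
    and e1: "e = vec n (\<lambda>_. 1)"
    and transfer: "\<And>f. vdvd d (pact S f e) \<Longrightarrow> vdvd d (pact T f e)"
  shows "\<exists>\<sigma>. bij_betw \<sigma> {..<n} {..<n} \<and> (\<forall>i<n. \<forall>j<n. S $$ (i, j) = T $$ (\<sigma> i, \<sigma> j))"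
proof -
  \<comment> \<open>The \<open>V i\<close> are the columns of an integral orthogonal matrix with column sums 1, hence unit vectors.\<close>
  have "\<forall>i. \<exists>g V. i < n \<longrightarrow> pact S g e = d \<cdot>\<^sub>v unit_vec n i \<and> V \<in> carrier_vec n \<and> pact T g e = d \<cdot>\<^sub>v V"
  proof
    fix i
    obtain g where g: "pact S g e = d \<cdot>\<^sub>v unit_vec n i" using cyc[of "unit_vec n i"] by auto
    have "vdvd d (pact T g e)" by (rule transfer) (simp add: g vdvd_smult)
    then obtain V where "V \<in> carrier_vec n" "pact T g e = d \<cdot>\<^sub>v V" using vdvdE T.pact_carrier[OF e] by metis
    then show "\<exists>g V. i < n \<longrightarrow> pact S g e = d \<cdot>\<^sub>v unit_vec n i \<and> V \<in> carrier_vec n \<and> pact T g e = d \<cdot>\<^sub>v V"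
      using g by blast
  qed
  then obtain g V where gV: "\<And>i. i < n \<Longrightarrow> pact S (g i) e = d \<cdot>\<^sub>v unit_vec n i"
    "\<And>i. i < n \<Longrightarrow> V i \<in> carrier_vec n" "\<And>i. i < n \<Longrightarrow> pact T (g i) e = d \<cdot>\<^sub>v V i"
    by metis
  \<comment> \<open>\<open>[:0, 1:] * g j\<close> represents \<open>S\<close> applied to a scaled
    basis vector, so the isometry carries the entries of \<open>S\<close> to
    \<open>T\<close>.\<close>
  have form: "V i \<bullet> (T *\<^sub>v V j) = unit_vec n i \<bullet> (S *\<^sub>v unit_vec n j)" if ij: "i < n" "j < n" for i j
  proof -
    have "pact T (g i) e \<bullet> pact T ([:0, 1:] * g j) e = pact S (g i) e \<bullet> pact S ([:0, 1:] * g j) e"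
      by (rule gram_eq[symmetric])
    then have "(d \<cdot>\<^sub>v V i) \<bullet> (T *\<^sub>v (d \<cdot>\<^sub>v V j)) = (d \<cdot>\<^sub>v unit_vec n i) \<bullet> (S *\<^sub>v (d \<cdot>\<^sub>v unit_vec n j))"
      using ij gV(2) by (simp only: T.pact_mult[OF e] S.pact_mult[OF e] gV(1,3) T.pact_x S.pact_x
          smult_carrier_vec unit_vec_carrier)
    then have "d * (d * (V i \<bullet> (T *\<^sub>v V j))) = d * (d * (unit_vec n i \<bullet> (S *\<^sub>v unit_vec n j)))"
      using ij gV(2) by (simp only: T.A_smult S.A_smult unit_vec_carrier smult_scalar_prod_distrib[of _ n]
          scalar_prod_smult_distrib[of _ n] T.A_carrier S.A_carrier smult_carrier_vec)
    then show ?thesis using d by simp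
  qed
  have orth: "V i \<bullet> V j = (if i = j then 1 else 0)" if ij: "i < n" "j < n" for i j
  proof -
    have "pact T (g i) e \<bullet> pact T (g j) e = pact S (g i) e \<bullet> pact S (g j) e"
      by (rule gram_eq[symmetric])
    then have "d * (d * (V i \<bullet> V j)) = d * (d * (unit_vec n i \<bullet> unit_vec n j))"
      using ij gV by (simp only: unit_vec_carrier smult_scalar_prod_distrib[of _ n]
          scalar_prod_smult_distrib[of _ n] smult_carrier_vec)
    then have "V i \<bullet> V j = unit_vec n i \<bullet> unit_vec n j" using d by simp
    then show ?thesis using ij by (simp add: scalar_prod_left_unit)
  qed
  have sum1: "V i \<bullet> e = 1" if i: "i < n" for i
  proof -
    have "pact T (g i) e \<bullet> pact T 1 e = pact S (g i) e \<bullet> pact S 1 e" by (rule gram_eq[symmetric])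
    then have "d * (V i \<bullet> e) = d * (unit_vec n i \<bullet> e)"
      using i gV by (simp only: unit_vec_carrier smult_scalar_prod_distrib[of _ n] e T.pact_1 S.pact_1)
    then have "V i \<bullet> e = unit_vec n i \<bullet> e" using d by simp
    then show ?thesis using i by (simp add: scalar_prod_left_unit e1)
  qed
  have "\<exists>k<n. V i = unit_vec n k" if i: "i < n" for i
  proof -
    \<comment> \<open>Squared length and coordinate sum are both 1, so the nonnegative integers
      \<open>x * x - x\<close> add up to zero and every coordinate is 0 or 1.\<close>
    have "(\<Sum>k = 0..<n. V i $ k * V i $ k - V i $ k) = V i \<bullet> V i - V i \<bullet> e"
      using gV(2)[OF i] by (simp add: scalar_prod_def e1 sum_subtractf)
    also have "\<dots> = 0" using orth[OF i i] sum1[OF i] by simp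
    finally have s0: "(\<Sum>k = 0..<n. V i $ k * V i $ k - V i $ k) = 0" .
    have nonneg: "0 \<le> x * x - x" for x :: int
    proof -
      have "x \<le> 0 \<or> 1 \<le> x" by linarith
      then have "0 \<le> x * (x - 1)" by (auto intro: mult_nonpos_nonpos)
      then show ?thesis by (simp add: right_diff_distrib)
    qed
    have zero: "V i $ k * V i $ k - V i $ k = 0" if "k < n" for k
      using s0 nonneg that by (subst (asm) sum_nonneg_eq_0_iff) auto
    have entry: "V i $ k = 0 \<or> V i $ k = 1" if "k < n" for k
      using zero[OF that] by simp
    have s1: "(\<Sum>k = 0..<n. V i $ k) = 1"
      using sum1[OF i] gV(2)[OF i] by (simp add: scalar_prod_def e1)
    then obtain k where k: "k < n" "V i $ k = 1" using entry by (metis atLeastLessThan_iff sum.neutral zero_neq_one)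
    have "V i $ l = 0" if l: "l < n" "l \<noteq> k" for l
    proof (rule ccontr)
      assume "V i $ l \<noteq> 0"
      then have "V i $ l = 1" using entry[OF l(1)] by simp
      moreover have "(\<Sum>j\<in>{k, l}. V i $ j) \<le> (\<Sum>k = 0..<n. V i $ k)"
        using k l entry by (intro sum_mono2) fastforce+
      ultimately show False using k l s1 by simp
    qed
    then have "V i = unit_vec n k" using k gV(2)[OF i] by (intro eq_vecI) auto
    then show ?thesis using k(1) by blast
  qed
  then obtain \<sigma> where \<sigma>: "\<And>i. i < n \<Longrightarrow> \<sigma> i < n \<and> V i = unit_vec n (\<sigma> i)" by metis
  have inj: "inj_on \<sigma> {..<n}"
  proof (rule inj_onI)
    fix i j assume ij: "i \<in> {..<n}" "j \<in> {..<n}" "\<sigma> i = \<sigma> j"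
    then have "V i \<bullet> V j = 1" using \<sigma>[of i] \<sigma>[of j] by (simp add: scalar_prod_left_unit)
    then show "i = j" using orth[of i j] ij by (simp split: if_splits)
  qed
  moreover have "\<sigma> ` {..<n} \<subseteq> {..<n}" using \<sigma> by auto
  ultimately have "bij_betw \<sigma> {..<n} {..<n}"
    by (simp add: bij_betw_def endo_inj_surj)
  moreover have "S $$ (i, j) = T $$ (\<sigma> i, \<sigma> j)" if ij: "i < n" "j < n" for i j
    using form[OF ij] \<sigma>[OF ij(1)] \<sigma>[OF ij(2)] ij 
    by (simp add: scalar_prod_left_unit scalar_prod_right_unit)
  ultimately show ?thesis by blast
qed

end

text \<open>A prime divisor of the quotient of \<open>d\<close> by \<open>gcd d z\<close> would
  divide the gcd too, so its square would divide \<open>d\<close>.\<close>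

lemma squarefree_dvdI:
  fixes d z :: int
  assumes d: "squarefree d" "d \<noteq> 0" and p: "\<And>p. prime p \<Longrightarrow> p dvd d \<Longrightarrow> p dvd z"
  shows "d dvd z"
proof -
  obtain t where t: "d = gcd d z * t" using gcd_dvd1 by (metis dvdE)
  have "t dvd 1"
  proof (rule ccontr)
    assume "\<not> t dvd 1"
    moreover have "t \<noteq> 0" using t d(2) by auto
    ultimately obtain q where q: "prime q" "q dvd t" using prime_divisor_exists[of t] by auto
    have "q dvd d" using q(2) t by (metis dvd_mult)
    then have "q dvd gcd d z" using p q(1) by simp
    then have "q * q dvd gcd d z * t" using q(2) by (rule mult_dvd_mono)
    then have "q ^ 2 dvd d" using t by (simp add: power2_eq_square)
    then have "q dvd 1" using d(1) by (simp add: squarefree_def)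
    then show False using q(1) not_prime_unit by blast
  qed
  then have "gcd d z * t dvd gcd d z * 1" by (intro mult_dvd_mono dvd_refl)
  then have "d dvd gcd d z" using t by (simp only: mult_1_right)
  then show ?thesis by (rule dvd_trans) simp
qed

section \<open>Oriented graphs\<close>

lemma skew_adj_carrier: "skew_adj n G \<in> carrier_mat n n"
  by (simp add: skew_adj_def)

lemma skew_adj_skew:
  assumes "oriented_graph n G"
  shows "(skew_adj n G)\<^sup>T = - skew_adj n G"
proof (intro eq_matI)
  fix i j assume "i < dim_row (- skew_adj n G)" "j < dim_col (- skew_adj n G)"
  then have ij: "i < n" "j < n" by (auto simp: skew_adj_def)
  have "\<not> ((i, j) \<in> parcs G \<and> (j, i) \<in> parcs G)"
    using assms unfolding oriented_graph_def by (auto dest: asymD)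
  then show "(skew_adj n G)\<^sup>T $$ (i, j) = (- skew_adj n G) $$ (i, j)"
    using ij by (auto simp: skew_adj_def)
qed (auto simp: skew_adj_def)

lemma skew_adj_skew_matrix: "oriented_graph n G \<Longrightarrow> skew_matrix n (skew_adj n G)"
  using skew_adj_carrier skew_adj_skew by unfold_locales auto

lemma skew_adj_eq_1_iff: "i < n \<Longrightarrow> j < n \<Longrightarrow> skew_adj n G $$ (i, j) = 1 \<longleftrightarrow> (i, j) \<in> parcs G"
  by (simp add: skew_adj_def)

lemma char_poly_skew_adj_plus_ones:
  "char_poly (skew_adj n G + all_ones_mat n) =
     char_poly (skew_adj n G) - resolvent (skew_adj n G) (all_ones_vec n) (all_ones_vec n)"
proof -
  have "all_ones_mat n = mat n n (\<lambda>(i, j). all_ones_vec n $ i * all_ones_vec n $ j)"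
    by (intro eq_matI) (auto simp: all_ones_mat_def all_ones_vec_def)
  then show ?thesis
    using char_poly_add_rank_one[OF skew_adj_carrier[of n G], of "all_ones_vec n" "all_ones_vec n"]
    by (simp add: all_ones_vec_def)
qed

lemma digraph_iso_of_skew_adj:
  assumes G: "oriented_graph n G" and H: "oriented_graph n H"
    and \<sigma>: "bij_betw \<sigma> {..<n} {..<n}"
    and eq: "\<And>i j. i < n \<Longrightarrow> j < n \<Longrightarrow> skew_adj n G $$ (i, j) = skew_adj n H $$ (\<sigma> i, \<sigma> j)"
  shows "digraph_iso (with_proj H) (with_proj G)"
proof -
  \<comment> \<open>The isomorphism has to go from \<open>H\<close> to \<open>G\<close>, against the
    direction of \<open>\<sigma>\<close>.\<close>
  define \<tau> where "\<tau> = the_inv_into {..<n} \<sigma>"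
  have \<tau>: "bij_betw \<tau> {..<n} {..<n}" unfolding \<tau>_def by (rule bij_betw_the_inv_into[OF \<sigma>])
  have \<tau>\<sigma>: "\<tau> (\<sigma> i) = i" if "i < n" for i
    using \<sigma> that by (simp add: \<tau>_def the_inv_into_f_f bij_betw_def)
  have \<sigma>\<tau>: "\<sigma> (\<tau> i) = i" if "i < n" for i
    using \<sigma> that by (simp add: \<tau>_def f_the_inv_into_f_bij_betw[OF \<sigma>])
  have \<sigma>n: "\<sigma> i < n" if "i < n" for i using \<sigma> that by (auto dest: bij_betwE)
  have \<tau>n: "\<tau> i < n" if "i < n" for i using \<tau> that by (auto dest: bij_betwE)
  interpret H: pair_digraph H using H by (simp add: oriented_graph_def)
  interpret G: pair_digraph G using G by (simp add: oriented_graph_def)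
  have vG: "pverts G = {..<n}" and vH: "pverts H = {..<n}" using G H by (auto simp: oriented_graph_def)
  have aG: "i < n \<and> j < n" if "(i, j) \<in> parcs G" for i j using G.wellformed'[OF that] vG by auto
  have aH: "i < n \<and> j < n" if "(i, j) \<in> parcs H" for i j using H.wellformed'[OF that] vH by auto
  have arcs: "(i, j) \<in> parcs G \<longleftrightarrow> (\<sigma> i, \<sigma> j) \<in> parcs H" if "i < n" "j < n" for i j
    using eq[OF that] skew_adj_eq_1_iff[OF that, of G] skew_adj_eq_1_iff[of "\<sigma> i" n "\<sigma> j" H] \<sigma>n that by simp
  define f where "f = \<lparr>iso_verts = \<tau>, iso_arcs = map_prod \<tau> \<tau>, iso_head = snd, iso_tail = fst\<rparr>"
  have "map_prod \<tau> \<tau> ` parcs H = parcs G"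
  proof (intro equalityI subsetI)
    fix x assume "x \<in> map_prod \<tau> \<tau> ` parcs H"
    then obtain i j where ij: "(i, j) \<in> parcs H" "x = (\<tau> i, \<tau> j)" by auto
    then show "x \<in> parcs G" using arcs[of "\<tau> i" "\<tau> j"] aH[OF ij(1)] \<sigma>\<tau> \<tau>n by simp
  next
    fix x assume x: "x \<in> parcs G"
    obtain i j where ij: "x = (i, j)" by (cases x)
    then have "(\<sigma> i, \<sigma> j) \<in> parcs H" "x = map_prod \<tau> \<tau> (\<sigma> i, \<sigma> j)"
      using x arcs[of i j] aG[of i j] \<tau>\<sigma> by auto
    then show "x \<in> map_prod \<tau> \<tau> ` parcs H" by blast
  qed
  moreover have "\<tau> ` {..<n} = {..<n}" using \<tau> by (simp add: bij_betw_def)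
  ultimately have "with_proj G = app_iso f (with_proj H)"
    using vG vH by (intro pre_digraph.equality) (simp_all add: f_def)
  moreover have "pre_digraph.digraph_isomorphism (with_proj H) f"
    unfolding pre_digraph.digraph_isomorphism_def
  proof (intro conjI)
    show "wf_digraph (with_proj H)" by (rule H.wf_digraph_axioms)
    have inj: "inj_on \<tau> {..<n}" using \<tau> by (simp add: bij_betw_def)
    then show "inj_on (iso_verts f) (verts (with_proj H))" by (simp add: f_def vH)
    have "inj_on (map_prod \<tau> \<tau>) ({..<n} \<times> {..<n})" using inj by (rule map_prod_inj_on) fact
    moreover have "parcs H \<subseteq> {..<n} \<times> {..<n}" using aH by auto
    ultimately show "inj_on (iso_arcs f) (arcs (with_proj H))"
      by (simp add: f_def) (rule inj_on_subset)
  qed (auto simp: f_def)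
  ultimately show ?thesis unfolding digraph_iso_def by blast
qed

lemma controllable_det_nonzero:
  assumes "controllable n G"
  shows "det (skew_walk_mat n G) \<noteq> 0"
proof
  let ?W = "skew_walk_mat n G"
  have W: "?W \<in> carrier_mat n n"
    using int_matrix.walk_carrier[of n "skew_adj n G" "all_ones_vec n"] skew_adj_carrier
    by (simp add: skew_walk_mat_def int_matrix_def)
  assume "det ?W = 0"
  then have d0: "det (map_mat rat_of_int ?W) = 0" by simp
  let ?R = "map_mat rat_of_int ?W"
  obtain B where B: "?R * B = 1\<^sub>m (dim_row ?R)" "B * ?R = 1\<^sub>m (dim_row B)"
    using assms unfolding controllable_def invertible_mat_def inverts_mat_def by blast
  have "dim_col B = n" using arg_cong[OF B(1), of dim_col] W by simp
  moreover have "dim_row B = n" using arg_cong[OF B(2), of dim_col] W by simp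
  ultimately have BC: "B \<in> carrier_mat n n" by auto
  have "det ?R * det B = 1" using det_mult[of ?R n B] B(1) BC W by simp
  then show False using d0 by simp
qed

text \<open>The reflection of \<open>f\<close>, made monic and reduced, is again an irreducible
  factor \<open>g\<close> of \<open>\<Phi>\<close>, because \<open>chi\<close> and \<open>a\<close>
  are invariant up to sign. If \<open>g\<close> differed from \<open>f\<close>, condition (ii) would
  make \<open>f\<close> coprime to \<open>star g\<close>, which is \<open>f\<close> up to
  sign.\<close>

lemma self_conj_factors:
  fixes p :: int and chi a :: "int poly"
  assumes p: "prime p" and chi: "monic chi" and \<Phi>: "\<Phi> = gcd_mod p chi (chi - a)"
    and star_chi: "star chi = (- 1) ^ n * chi" and star_a: "star a = - ((- 1) ^ n * a)"
    and conj: "\<And>\<phi> \<psi>. \<lbrakk>\<phi> \<in> monic_irreducible_factors_mod p (sfp_mod p \<Phi>);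
      \<psi> \<in> monic_irreducible_factors_mod p (sfp_mod p \<Phi>); \<phi> \<noteq> \<psi>\<rbrakk> \<Longrightarrow> poly_mod.coprime_m p \<phi> (star \<psi>)"
    and f: "f \<in> monic_irreducible_factors_mod p \<Phi>"
  shows "pdvd p f chi" "pdvd p f a" "pdvd p f (star f)"
proof -
  have p1: "1 < p" using p prime_gt_1_int by blast
  have gcd: "monic \<Phi>" "pdvd p q \<Phi> \<longleftrightarrow> pdvd p q chi \<and> pdvd p q a" for q
  proof -
    show "monic \<Phi>" unfolding \<Phi> by (rule gcd_mod_props(1)[OF p chi])
    have "pdvd p q (chi - a) \<longleftrightarrow> pdvd p q a" if "pdvd p q chi"
      using pdvd_diff[OF that, of a] pdvd_diff[OF that, of "chi - a"] by auto
    then show "pdvd p q \<Phi> \<longleftrightarrow> pdvd p q chi \<and> pdvd p q a"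
      unfolding \<Phi> gcd_mod_props(2)[OF p chi] by blast
  qed
  let ?F = "monic_irreducible_factors_mod p \<Phi>"
  have fin: "finite ?F" by (rule finite_monic_irreducible_factors_mod[OF p gcd(1)])
  \<comment> \<open>Condition (ii) speaks of the factors of the square-free part; the irreducible
    factors of \<open>\<Phi>\<close> divide that part as well.\<close>
  have sub: "q \<in> monic_irreducible_factors_mod p (sfp_mod p \<Phi>)" if "q \<in> ?F" for q
    using that pdvd_prod_member[OF fin that]
    by (simp add: monic_irreducible_factors_mod_def sfp_mod_def poly_mod.dvdm_Mp)
  have fF: "poly_mod.Mp p f = f" "monic f" "poly_mod.irreducible_m p f" "pdvd p f \<Phi>"
    using f unfolding monic_irreducible_factors_mod_def by auto
  then show f_chi: "pdvd p f chi" and f_a: "pdvd p f a" using gcd(2) by blast+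
  define h where "h = (- 1) ^ degree f * star f"
  define g where "g = poly_mod.Mp p h"
  have hg: "[:p:] dvd h - g" unfolding g_def by (rule const_dvd_diff_Mp)
  have "monic h" using monic_star(1)[OF fF(2)] by (simp add: h_def)
  then have "monic g" unfolding g_def by (rule monic_Mp[OF p1])
  moreover have "poly_mod.irreducible_m p g"
    unfolding g_def poly_mod.irreducible_m_Mp h_def by (rule irreducible_m_star[OF fF(3)])
  moreover have "pdvd p g \<Phi>"
  proof -
    have "pdvd p (star f) chi" using pdvd_star[OF f_chi] by (simp add: star_chi)
    moreover have "pdvd p (star f) a" using pdvd_star[OF f_a] by (simp add: star_a)
    ultimately have "pdvd p h \<Phi>" unfolding gcd(2) h_def by simp
    then show ?thesis using hg pdvd_cong_left by blast
  qed
  ultimately have g: "g \<in> ?F" unfolding monic_irreducible_factors_mod_def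
    by (simp add: g_def poly_mod.Mp_Mp)
  have "f = g"
  proof (rule ccontr)
    assume "f \<noteq> g"
    then have "poly_mod.coprime_m p f (star g)" using conj sub f g by blast
    moreover have "pdvd p f (star g)"
    proof -
      have "[:p:] dvd star (h - g)" using hg by (rule const_dvd_star)
      then have "pdvd p f (star g) \<longleftrightarrow> pdvd p f (star h)" using pdvd_cong[of p "star h" "star g" f] by simp
      moreover have "star h = (- 1) ^ degree f * f" unfolding h_def by (cases "even (degree f)") simp_all
      ultimately show ?thesis by simp
    qed
    ultimately have "pdvd p f 1" unfolding poly_mod.coprime_m_def using pdvd_refl by blast
    then show False using irreducible_m_not_pdvd_1[OF fF(3)] by blast
  qed
  then have "[:p:] dvd h - f" using hg by simp
  then have "pdvd p f h" using pdvd_cong pdvd_refl by blast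
  then show "pdvd p f (star f)" by (simp add: h_def)
qed

theorem theorem3:
  fixes n :: nat and \<Sigma> :: "nat pair_pre_digraph"
  assumes "oriented_graph n \<Sigma>"
    and "controllable n \<Sigma>"
    and "squarefree (last_invariant_factor (skew_walk_mat n \<Sigma>))"
    and "int (rank_mod 2 (skew_walk_mat n \<Sigma>)) = \<lceil>real n / 2\<rceil>"
    and "\<And>p :: int. \<lbrakk>prime p; odd p; p dvd last_invariant_factor (skew_walk_mat n \<Sigma>)\<rbrakk> \<Longrightarrow>
           degree (sfp_mod p (Phi_mod p n \<Sigma>)) = nullity_mod p (skew_walk_mat n \<Sigma>)"
    and "\<And>(p :: int) \<phi> \<psi>.
           \<lbrakk>prime p; odd p; p dvd last_invariant_factor (skew_walk_mat n \<Sigma>);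
            \<phi> \<in> monic_irreducible_factors_mod p (sfp_mod p (Phi_mod p n \<Sigma>));
            \<psi> \<in> monic_irreducible_factors_mod p (sfp_mod p (Phi_mod p n \<Sigma>)); \<phi> \<noteq> \<psi>\<rbrakk> \<Longrightarrow>
           poly_mod.coprime_m p \<phi> (pcompose \<psi> [:0, -1:])"
  shows "determined_by_gen_skew_spectrum n \<Sigma>"
  unfolding determined_by_gen_skew_spectrum_def
proof (intro allI impI)
  fix n' H assume H': "oriented_graph n' H" and cosp: "gen_skew_cospectral n \<Sigma> n' H"
  \<comment> \<open>The number of vertices is the degree of the characteristic polynomial.\<close>
  have "n' = n"
    using cosp degree_monic_char_poly[OF skew_adj_carrier[of n \<Sigma>]] degree_monic_char_poly[OF skew_adj_carrier[of n' H]]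
    by (simp add: gen_skew_cospectral_def)
  with H' cosp have H: "oriented_graph n H" and cosp: "gen_skew_cospectral n \<Sigma> n H" by auto
  define S where "S = skew_adj n \<Sigma>"
  define T where "T = skew_adj n H"
  define e where "e = all_ones_vec n"
  define d where "d = last_invariant_factor (skew_walk_mat n \<Sigma>)"
  interpret S: skew_matrix n S unfolding S_def by (rule skew_adj_skew_matrix[OF assms(1)])
  interpret T: skew_matrix n T unfolding T_def by (rule skew_adj_skew_matrix[OF H])
  have e: "e \<in> carrier_vec n" and ones: "e = vec n (\<lambda>_. 1)" by (simp_all add: e_def all_ones_vec_def)
  have W: "skew_walk_mat n \<Sigma> = S.walk e" by (simp add: skew_walk_mat_def S_def e_def)
  have det: "det (S.walk e) \<noteq> 0" using controllable_det_nonzero[OF assms(2)] by (simp add: W)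
  have chi_plus: "char_poly (S + all_ones_mat n) = S.\<chi> - resolvent S e e"
    unfolding S_def e_def by (rule char_poly_skew_adj_plus_ones)
  have "\<exists>\<sigma>. bij_betw \<sigma> {..<n} {..<n} \<and> (\<forall>i<n. \<forall>j<n. S $$ (i, j) = T $$ (\<sigma> i, \<sigma> j))"
  proof (cases "n = 0")
    case True
    then show ?thesis by (intro exI[of _ id]) simp
  next
    case False
    then have n: "0 < n" by simp
    have "char_poly (T + all_ones_mat n) = T.\<chi> - resolvent T e e"
      unfolding T_def e_def by (rule char_poly_skew_adj_plus_ones)
    then have chi_eq: "S.\<chi> = T.\<chi>" and res_eq: "resolvent S e e = resolvent T e e"
      using cosp chi_plus by (simp_all add: gen_skew_cospectral_def S_def T_def)
    interpret cospectral_pair n S T e by unfold_locales (fact n e chi_eq res_eq det)+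
    obtain X where d: "0 < d" and X: "X \<in> carrier_mat n n" and WX: "S.walk e * X = d \<cdot>\<^sub>m 1\<^sub>m n"
      using last_invariant_factor_inverse[OF S.walk_carrier det n] unfolding d_def W by metis
    have cyc: "\<exists>g. pact S g e = d \<cdot>\<^sub>v z" if "z \<in> carrier_vec n" for z
      using walk_cyclic[OF S.int_matrix_axioms e X WX that] by blast
    have sqf: "squarefree d" using assms(3) by (simp add: d_def)
    have transfer: "vdvd p (pact T f e)" if pp: "prime p" "p dvd d" and f: "vdvd p (pact S f e)" for p f
    proof -
      obtain m k where mk: "monic m" "monic k" "degree k + degree m = n" "[:p:] dvd S.\<chi> - k * m"
        and ann: "\<And>f. vdvd p (pact S f e) \<longleftrightarrow> pdvd p m f"
        using S.annihilator_generator[OF pp(1) e] by metis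
      have p2: "\<not> p * p dvd d"
        using sqf pp(1) not_prime_unit unfolding squarefree_def by (metis power2_eq_square)
      interpret skew_walk n S e d p m k
        by unfold_locales (fact e n pp p2 cyc mk ann)+
      have "pdvd p k c" if c: "pdvd p S.\<chi> (c * star c - star (resolvent S e e) * q)" for c q
      proof (cases "p = 2")
        case True
        have "degree m = rank_mod 2 (skew_walk_mat n \<Sigma>)"
          using S.rank_mod_walk[OF pp(1) e mk(1) mk(3) ann] by (simp add: W True)
        \<comment> \<open>The ceiling of \<open>n / 2\<close> is
          \<open>(n + 1) div 2\<close>.\<close>
        then have deg_m: "degree m = (n + 1) div 2" using assms(4) by linarith
        interpret skew_walk_2 n S e d p m k by unfold_locales (fact True ones deg_m)+
        show ?thesis by (rule k_pdvd_2[OF c])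
      next
        case False
        then have odd: "odd p" using pp(1) prime_odd_int[of p] prime_gt_1_int[OF pp(1)] by force
        have pd: "p dvd last_invariant_factor (skew_walk_mat n \<Sigma>)" using pp(2) by (simp add: d_def)
        define \<Phi> where "\<Phi> = Phi_mod p n \<Sigma>"
        have \<Phi>: "\<Phi> = gcd_mod p S.\<chi> (S.\<chi> - resolvent S e e)"
          using chi_plus by (simp add: \<Phi>_def Phi_mod_def S_def)
        have mon: "monic \<Phi>" unfolding \<Phi> by (rule gcd_mod_props(1)[OF pp(1) S.monic_chi])
        let ?F = "monic_irreducible_factors_mod p \<Phi>"
        have F: "pdvd p f S.\<chi>" "pdvd p f (resolvent S e e)" "pdvd p f (star f)" if "f \<in> ?F" for f
          using self_conj_factors[OF pp(1) S.monic_chi \<Phi> S.star_chi S.star_resolvent_self[OF e] _ that]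
            assms(6)[OF pp(1) odd pd] unfolding \<Phi>_def by blast+
        have "monic (\<Prod>?F)" by (intro monic_prod) (auto simp: monic_irreducible_factors_mod_def)
        moreover have "\<not> p dvd 1" using pp(1) not_prime_unit by blast
        \<comment> \<open>The reduction inside \<open>sfp_mod\<close> preserves the degree of a
          monic product, so condition (i) becomes an equality with the degree of
          \<open>k\<close>.\<close>
        ultimately have "degree (\<Prod>?F) = degree (sfp_mod p \<Phi>)"
          unfolding sfp_mod_def by (intro degree_Mp_monic[symmetric])
        also have "\<dots> = nullity_mod p (S.walk e)"
          using assms(5)[OF pp(1) odd pd] by (simp add: \<Phi>_def W)
        also have "\<dots> = degree k" by (rule S.nullity_mod_walk[OF pp(1) e mk(1) mk(3) ann n])
        finally have deg: "degree (\<Prod>?F) = degree k" .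
        show ?thesis
        proof (rule k_pdvd_of_self_conj_factors[OF _ _ deg c])
          show "finite ?F" by (rule finite_monic_irreducible_factors_mod[OF pp(1) mon])
          show "poly_mod.irreducible_m p f \<and> monic f \<and> poly_mod.Mp p f = f \<and> pdvd p f S.\<chi>
              \<and> pdvd p f (resolvent S e e) \<and> pdvd p f (star f)" if "f \<in> ?F" for f
            using F[OF that] that unfolding monic_irreducible_factors_mod_def by blast
        qed
      qed
      then show ?thesis using vdvd_transfer[OF mk(4) ann _ f] by blast
    qed
    show ?thesis
    proof (rule permutation_similar[OF cyc _ ones])
      show "d \<noteq> 0" using d by simp
      fix f assume f: "vdvd d (pact S f e)"
      show "vdvd d (pact T f e)" unfolding vdvd_def
      proof (intro allI impI)
        fix i assume i: "i < dim_vec (pact T f e)"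
        \<comment> \<open>As \<open>d\<close> is square-free, the transfer modulo each of its primes
          adds up to the transfer modulo \<open>d\<close>.\<close>
        show "d dvd pact T f e $ i"
        proof (rule squarefree_dvdI[OF sqf])
          fix p assume p: "prime p" "p dvd d"
          have "vdvd p (pact S f e)" using f p(2) dvd_trans unfolding vdvd_def by blast
          then show "p dvd pact T f e $ i" using transfer[OF p] i unfolding vdvd_def by blast
        qed (use d in simp)
      qed
    qed
  qed
  then obtain \<sigma> where "bij_betw \<sigma> {..<n} {..<n}" "\<And>i j. i < n \<Longrightarrow> j < n \<Longrightarrow> S $$ (i, j) = T $$ (\<sigma> i, \<sigma> j)"
    by blast
  then show "digraph_iso (with_proj H) (with_proj \<Sigma>)"
    using digraph_iso_of_skew_adj[OF assms(1) H] unfolding S_def T_def by blast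
qed

end
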